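(* Writing $i = \sqrt{-1}$ and, for real $d>0$, $\sqrt{-d} = i\sqrt{d}$ and $\widetilde{\lambda}_d := \lambda\!\left(\frac{\sqrt{-d}-1}{\sqrt{-d}+1}\right)$, one has \begin{align*} \widetilde{\lambda}_3 &= \tfrac12 + \tfrac12\sqrt{-3},\qquad \widetilde{\lambda}_7 = \tfrac12 + \tfrac32\sqrt{-7},\\ \widetilde{\lambda}_{11} &= \tfrac12 + \tfrac76\sqrt{-11} + \tfrac43 i\left((7\sqrt{11}+3\sqrt3)^{1/3} + (7\sqrt{11}-3\sqrt3)^{1/3}\right),\\ \widetilde{\lambda}_{19} &= \tfrac12 + \tfrac92\sqrt{-19} + 4 i\left((27\sqrt{19}+3\sqrt3)^{1/3} + (27\sqrt{19}-3\sqrt3)^{1/3}\right),\\ \widetilde{\lambda}_{27} &= \tfrac12 + \tfrac16\sqrt{-3}\left(253 + 200\sqrt[3]{2} + 160\sqrt[3]{4}\right),\\ \widetilde{\lambda}_{43} &= \tfrac12 + \tfrac{189}{2}\sqrt{-43} + 40 i\left((567\sqrt{43}+3\sqrt3)^{1/3} + (567\sqrt{43}-3\sqrt3)^{1/3}\right),\\ \widetilde{\lambda}_{67} &= \tfrac12 + \tfrac{1953}{2}\sqrt{-67} + 220 i\left((5859\sqrt{67}+3\sqrt3)^{1/3} + (5859\sqrt{67}-3\sqrt3)^{1/3}\right),\\ \widetilde{\lambda}_{163} &= \tfrac12 + \tfrac{1672209}{2}\sqrt{-163} + 26680 i\left((5016627\sqrt{163}+3\sqrt3)^{1/3} + (5016627\sqrt{163}-3\sqrt3)^{1/3}\right).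 \end{align*}
   Context: For $\tau$ in the upper half plane let $q := e^{2\pi i \tau}$ and $q^{s} := e^{2\pi i s\tau}$. The elliptic lambda function is $\lambda(\tau) := 16 q^{1/2} \prod_{n=1}^{\infty} \frac{(1+q^n)^8}{(1+q^{n-1/2})^8}$. All cube roots are real cube roots of positive real numbers. *)

theory Defs
  imports "HOL-Analysis.Analysis"
begin

text \<open>The power \<open>q\<^sup>s\<close> of the nome \<open>q = exp (2 \<pi> i \<tau>)\<close> is read as \<open>exp (2 \<pi> i s \<tau>)\<close>,
  not as a principal-branch power of \<open>q\<close>.\<close>

definition qpow :: "real \<Rightarrow> complex \<Rightarrow> complex" where
  "qpow s \<tau> = exp (2 * complex_of_real pi * \<i> * complex_of_real s * \<tau>)"

text \<open>Meaningful for \<open>Im \<tau> > 0\<close>, where the product converges. The bound index starts at 0,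
  so it is shifted by \<open>Suc\<close>.\<close>

definition elliptic_lambda :: "complex \<Rightarrow> complex" where
  "elliptic_lambda \<tau> = 16 * qpow (1/2) \<tau> *
     (\<Prod>n. (1 + qpow (real (Suc n)) \<tau>) ^ 8 / (1 + qpow (real (Suc n) - 1/2) \<tau>) ^ 8)"

definition sqrt_neg :: "real \<Rightarrow> complex" where
  "sqrt_neg d = \<i> * complex_of_real (sqrt d)"

text \<open>For \<open>d > 0\<close> the argument has imaginary part \<open>2 * sqrt d / (d + 1) > 0\<close>.\<close>

definition lambda_tilde :: "real \<Rightarrow> complex" where
  "lambda_tilde d = elliptic_lambda ((sqrt_neg d - 1) / (sqrt_neg d + 1))"

end

(* Write s = (1 + sqrt(-d)) / 2. The transformations of lambda under the generators S and T of the
   modular group (obtained from the quasi-periodicity and the zeros of theta products, without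
   Poisson summation) give lambda_tilde d = 1 - 1 / lambda(s), and show that it lies on the line
   Re = 1/2. It is therefore determined by j(s) = 256 (1 - l + l^2)^3 / (l^2 (1 - l)^2), l = lambda(s).

   Integrality of j(s): for a prime p the points (tau + i) / p and p tau satisfy a modular equation
   with integral coefficients. Its diagonal has leading coefficient -1, and j(s) is a root of it
   whenever Z[s] contains an element of norm p. For a suitable set of primes the discriminant has
   class number one and s is, up to equivalence, the only point with all these endomorphisms. As j
   is injective modulo equivalence, j(s) is the only common root of these polynomials, so it is
   rational and hence an integer. For d = 27 the value 3 j(s) is a sum over the 3-isogenies of the
   point with d = 3, where j = 0, so it is an integer as well.

   The leading terms of the q-expansion then identify j(s) from sufficiently precise bounds for
   exp(pi sqrt d), and Cardano's formula solves for lambda_tilde d. *)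

theory Submission
  imports Defs "HOL-Complex_Analysis.Complex_Analysis" "HOL-Real_Asymp.Real_Asymp"
    "HOL-Computational_Algebra.Fundamental_Theorem_Algebra"
begin

section \<open>Infinite products\<close>

text \<open>One modular equation is not enough: its diagonal vanishes wherever there is an
  endomorphism of norm p, so for every discriminant -D with t^2 + k^2 D = 4 p and k > 0. Several
  primes cut this list down to D = d. No set of primes isolates 27, because t^2 + 27 k^2 = t^2 + 3
  (3 k)^2 gives the point with d = 3 the same norms. Hence 27 is reached by an isogeny, integrality
  is known there for three times the value, and all numerical enclosures are made with tolerance
  1/3.

  The modular polynomial in two variables never appears. The diagonal is a product over the p + 1
  points of level p, shown to be a polynomial in j by removing its pole at the cusp; its integrality
  comes from norms of integral power series over the p-th roots of unity.

  j determines lambda only up to six values. On Re = 1/2 the equation involves y^2 alone and is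
  monotone for y^2 > 3/4, and the sign of y is read off the product for lambda.\<close>

definition qprod :: "complex \<Rightarrow> complex \<Rightarrow> complex" where
  "qprod x s = (\<Prod>n. 1 + x * s ^ n)"

lemma qprod_abs_convergent:
  assumes "norm (s::complex) < 1"
  shows "abs_convergent_prod (\<lambda>n. 1 + x * s ^ n)"
  unfolding abs_convergent_prod_conv_summable
  using assms by (auto simp: norm_mult norm_power intro!: summable_mult summable_geometric)

lemma qprod_convergent: "norm (s::complex) < 1 \<Longrightarrow> convergent_prod (\<lambda>n. 1 + x * s ^ n)"
  by (rule abs_convergent_prod_imp_convergent_prod[OF qprod_abs_convergent])

lemma qprod_tendsto:
  assumes "norm s < 1"
  shows "(\<lambda>N. \<Prod>n<N. 1 + x * s ^ n) \<longlonglongrightarrow> qprod x s"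
  using convergent_prod_LIMSEQ[OF qprod_convergent[OF assms, of x]]
  unfolding qprod_def by (subst LIMSEQ_lessThan_iff_atMost)

text \<open>\<open>qprod x s\<close> is the infinite q-Pochhammer symbol (-x; s). Splitting off its
  first factor is the source of the quasi-periodicity of theta and of the factor 2 in the inversion
  of lambda.\<close>

lemma qprod_step:
  assumes "norm s < 1"
  shows "qprod x s = (1 + x) * qprod (x * s) s"
proof (rule LIMSEQ_unique)
  show "(\<lambda>N. \<Prod>n<Suc N. 1 + x * s ^ n) \<longlonglongrightarrow> qprod x s"
    using qprod_tendsto[OF assms] by (rule LIMSEQ_Suc)
  have "(\<lambda>N. (1 + x) * (\<Prod>n<N. 1 + (x * s) * s ^ n)) \<longlonglongrightarrow> (1 + x) * qprod (x * s) s"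
    by (intro tendsto_intros qprod_tendsto assms)
  thus "(\<lambda>N. \<Prod>n<Suc N. 1 + x * s ^ n) \<longlonglongrightarrow> (1 + x) * qprod (x * s) s"
    by (subst prod.lessThan_Suc_shift) (simp add: mult.assoc)
qed

lemma qprod_eq_0_iff:
  assumes "norm s < 1"
  shows "qprod x s = 0 \<longleftrightarrow> (\<exists>n. x * s ^ n = -1)"
proof -
  have "(\<lambda>n. 1 + x * s ^ n) has_prod qprod x s"
    using qprod_convergent[OF assms] unfolding qprod_def by (simp add: convergent_prod_has_prod)
  hence "qprod x s = 0 \<longleftrightarrow> (\<exists>n. 1 + x * s ^ n = 0)"
    by (auto simp: has_prod_eq_0_iff)
  also have "\<dots> \<longleftrightarrow> (\<exists>n. x * s ^ n = -1)"
    by (metis add.commute add_eq_0_iff)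
  finally show ?thesis .
qed

lemma qprod_neg_mult:
  assumes "norm s < 1"
  shows "qprod x s * qprod (-x) s = qprod (-x\<^sup>2) (s\<^sup>2)"
proof (rule LIMSEQ_unique)
  have "norm (s\<^sup>2) < 1"
    using assms by (simp add: norm_power power_less_one_iff)
  thus "(\<lambda>N. \<Prod>n<N. 1 + (-x\<^sup>2) * (s\<^sup>2) ^ n) \<longlonglongrightarrow> qprod (-x\<^sup>2) (s\<^sup>2)"
    by (rule qprod_tendsto)
  have "(\<lambda>N. (\<Prod>n<N. 1 + x * s ^ n) * (\<Prod>n<N. 1 + (-x) * s ^ n)) \<longlonglongrightarrow> qprod x s * qprod (-x) s"
    by (intro tendsto_intros qprod_tendsto assms)
  also have "(\<lambda>N. (\<Prod>n<N. 1 + x * s ^ n) * (\<Prod>n<N. 1 + (-x) * s ^ n)) =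
      (\<lambda>N. \<Prod>n<N. 1 + (-x\<^sup>2) * (s\<^sup>2) ^ n)"
    by (subst prod.distrib[symmetric])
       (simp add: algebra_simps power2_eq_square power_mult_distrib)
  finally show "(\<lambda>N. \<Prod>n<N. 1 + (-x\<^sup>2) * (s\<^sup>2) ^ n) \<longlonglongrightarrow> qprod x s * qprod (-x) s" .
qed

text \<open>From |prod (1 + a_n) - 1| <= exp (sum |a_n|) - 1 and a geometric series. This is the
  quantitative estimate behind the numerical enclosures and the sign of Im lambda.\<close>

lemma norm_qprod_minus_1_le:
  assumes "norm s < 1"
  shows "norm (qprod x s - 1) \<le> exp (norm x / (1 - norm s)) - 1"
proof (rule tendsto_upperbound)
  show "(\<lambda>N. norm ((\<Prod>n<N. 1 + x * s ^ n) - 1)) \<longlonglongrightarrow> norm (qprod x s - 1)"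
    by (intro tendsto_intros qprod_tendsto assms)
  show "\<forall>\<^sub>F N in sequentially. norm ((\<Prod>n<N. 1 + x * s ^ n) - 1) \<le> exp (norm x / (1 - norm s)) - 1"
  proof (intro always_eventually allI)
    fix N
    have "norm ((\<Prod>n<N. 1 + x * s ^ n) - 1) \<le> (\<Prod>n<N. 1 + norm (x * s ^ n)) - 1"
      by (rule norm_prod_minus1_le_prod_minus1)
    also have "(\<Prod>n<N. 1 + norm (x * s ^ n)) \<le> exp (\<Sum>n<N. norm (x * s ^ n))"
      by (rule prod_le_exp_sum) auto
    also have "(\<Sum>n<N. norm (x * s ^ n)) \<le> (\<Sum>n. norm x * norm s ^ n)"
      unfolding norm_mult norm_power using assms
      by (intro sum_le_suminf summable_mult summable_geometric) auto
    also have "\<dots> = norm x / (1 - norm s)"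
      using assms by (subst suminf_mult) (auto intro: summable_geometric simp: suminf_geometric)
    finally show "norm ((\<Prod>n<N. 1 + x * s ^ n) - 1) \<le> exp (norm x / (1 - norm s)) - 1"
      by simp
  qed
qed auto

text \<open>Both arguments vary with the point, since lambda contains products such as
  \<open>qprod t (t^2)\<close>. On a compact set |g| and |h| have bounds M and r < 1, and M r^n is a
  Weierstrass majorant.\<close>

lemma qprod_uniform_limit:
  assumes "compact A" "continuous_on A g" "continuous_on A h" "\<And>z. z \<in> A \<Longrightarrow> norm (h z) < 1"
  shows "uniform_limit A (\<lambda>N z. \<Prod>n<N. 1 + g z * h z ^ n) (\<lambda>z. qprod (g z) (h z)) sequentially"
proof (cases "A = {}")
  case False
  have "bounded (g ` A)"
    by (intro compact_imp_bounded compact_continuous_image assms)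
  then obtain M where M: "\<And>z. z \<in> A \<Longrightarrow> norm (g z) \<le> M"
    by (auto simp: bounded_iff)
  \<comment> \<open>The maximum of |h| is attained, so the common bound r stays strictly below
    1.\<close>
  obtain z0 where z0: "z0 \<in> A" "\<And>z. z \<in> A \<Longrightarrow> norm (h z) \<le> norm (h z0)"
    using continuous_attains_sup[OF assms(1) False, of "\<lambda>z. norm (h z)"] assms(3)
    by (auto intro: continuous_intros)
  define r where "r = norm (h z0)"
  have r: "0 \<le> r" "r < 1"
    using assms(4) z0 by (auto simp: r_def)
  have "uniformly_convergent_on A (\<lambda>N z. \<Sum>n<N. norm (g z * h z ^ n))"
  proof (rule Weierstrass_m_test')
    fix n z assume z: "z \<in> A"
    show "norm (norm (g z * h z ^ n)) \<le> M * r ^ n"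
      using M[OF z] z0(2)[OF z] order.trans[OF norm_ge_zero M[OF z]] unfolding r_def
      by (auto simp: norm_mult norm_power intro!: mult_mono power_mono)
  next
    show "summable (\<lambda>n. M * r ^ n)"
      using r by (intro summable_mult summable_geometric) auto
  qed
  hence "uniformly_convergent_on A (\<lambda>N z. \<Prod>n<N. 1 + g z * h z ^ n)"
    by (intro uniformly_convergent_on_prod continuous_intros assms)
  then obtain l where l: "uniform_limit A (\<lambda>N z. \<Prod>n<N. 1 + g z * h z ^ n) l sequentially"
    by (auto simp: uniformly_convergent_on_def)
  have "l z = qprod (g z) (h z)" if "z \<in> A" for z
    using tendsto_uniform_limitI[OF l that] qprod_tendsto[OF assms(4)[OF that]]
    by (rule LIMSEQ_unique)
  with l show ?thesis
    by (metis (mono_tags, lifting) uniform_limit_cong')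
qed auto

lemma holomorphic_on_qprod [holomorphic_intros]:
  assumes "open A" "g holomorphic_on A" "h holomorphic_on A" "\<And>z. z \<in> A \<Longrightarrow> norm (h z) < 1"
  shows "(\<lambda>z. qprod (g z) (h z)) holomorphic_on A"
proof (rule holomorphic_uniform_sequence[OF assms(1)])
  show "(\<lambda>z. \<Prod>n<N. 1 + g z * h z ^ n) holomorphic_on A" for N
    by (intro holomorphic_intros assms)
  fix x assume "x \<in> A"
  then obtain d where d: "d > 0" "cball x d \<subseteq> A"
    using assms(1) open_contains_cball by blast
  show "\<exists>d>0. cball x d \<subseteq> A \<and>
     uniform_limit (cball x d) (\<lambda>N z. \<Prod>n<N. 1 + g z * h z ^ n) (\<lambda>z. qprod (g z) (h z)) sequentially"
    using d assms
    by (intro exI[of _ d] conjI qprod_uniform_limit)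
       (auto intro!: holomorphic_on_imp_continuous_on elim: holomorphic_on_subset)
qed

section \<open>Inversion of theta products\<close>

text \<open>The behaviour of Jacobi's theta_3 under the lattice Z + Z tau.\<close>

definition quasi_periodic :: "complex \<Rightarrow> (complex \<Rightarrow> complex) \<Rightarrow> bool" where
  "quasi_periodic \<tau> f \<longleftrightarrow>
     (\<forall>z. f (z + 1) = f z) \<and> (\<forall>z. f (z + \<tau>) = exp (- (pi * \<i> * (\<tau> + 2 * z))) * f z)"

lemma quasi_periodic_shift:
  assumes "quasi_periodic \<tau> f"
  shows "f (z + of_int m + of_int k * \<tau>) = exp (- (pi * \<i> * (of_int k ^ 2 * \<tau> + 2 * of_int k * z))) * f z"
proof -
  have p1: "f (w + of_int m) = f w" for w
  proof (induction m rule: int_induct[of _ 0])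
    case (step1 i)
    have "f (w + of_int (i + 1)) = f (w + of_int i + 1)" by (simp add: add.assoc)
    also have "\<dots> = f w" using assms step1 by (simp add: quasi_periodic_def)
    finally show ?case .
  next
    case (step2 i)
    have "f (w + of_int i) = f (w + of_int (i - 1) + 1)" by simp
    also have "\<dots> = f (w + of_int (i - 1))" using assms unfolding quasi_periodic_def by blast
    finally show ?case using step2 by simp
  qed auto
  have mult: "f (w + \<tau>) = exp (- (pi * \<i> * (\<tau> + 2 * w))) * f w" for w
    using assms by (simp add: quasi_periodic_def)
  have p2: "f (w + of_int k * \<tau>) = exp (- (pi * \<i> * (of_int k ^ 2 * \<tau> + 2 * of_int k * w))) * f w" for w
  proof (induction k rule: int_induct[of _ 0])
    case (step1 i)
    have "f (w + of_int (i + 1) * \<tau>) = f (w + of_int i * \<tau> + \<tau>)" by (simp add: algebra_simps)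
    also have "\<dots> = exp (- (pi * \<i> * (\<tau> + 2 * (w + of_int i * \<tau>)))) *
        (exp (- (pi * \<i> * (of_int i ^ 2 * \<tau> + 2 * of_int i * w))) * f w)"
      by (subst mult) (simp only: step1)
    also have "\<dots> = exp (- (pi * \<i> * (of_int (i+1) ^ 2 * \<tau> + 2 * of_int (i+1) * w))) * f w"
      unfolding mult.assoc[symmetric] exp_add[symmetric]
      by (simp add: algebra_simps power2_eq_square)
    finally show ?case .
  next
    case (step2 i)
    have "exp (- (pi * \<i> * (of_int i ^ 2 * \<tau> + 2 * of_int i * w))) * f w = f (w + of_int i * \<tau>)"
      by (simp only: step2)
    also have "w + of_int i * \<tau> = w + of_int (i - 1) * \<tau> + \<tau>" by (simp add: algebra_simps)
    also have "f \<dots> = exp (- (pi * \<i> * (\<tau> + 2 * (w + of_int (i - 1) * \<tau>)))) * f (w + of_int (i - 1) * \<tau>)"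
      by (subst mult) auto
    finally have "f (w + of_int (i - 1) * \<tau>) = exp (pi * \<i> * (\<tau> + 2 * (w + of_int (i - 1) * \<tau>))) *
        (exp (- (pi * \<i> * (of_int i ^ 2 * \<tau> + 2 * of_int i * w))) * f w)"
      by (simp add: exp_minus)
    also have "\<dots> = exp (- (pi * \<i> * (of_int (i-1) ^ 2 * \<tau> + 2 * of_int (i-1) * w))) * f w"
      unfolding mult.assoc[symmetric] exp_add[symmetric]
      by (simp add: algebra_simps power2_eq_square)
    finally show ?case .
  qed auto
  show ?thesis
    using p2[of z] p1[of "z + of_int k * \<tau>"] by (simp add: add_ac)
qed

text \<open>Near a simple zero \<open>g\<close> is injective, which isolates the zero. The quotient
  of the two difference quotients then tends to f'/g', the value that removes the
  singularity.\<close>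

lemma holomorphic_divide_simple_zeros:
  assumes f: "f holomorphic_on UNIV" and g: "g holomorphic_on UNIV"
    and zeros: "\<And>a. g a = 0 \<Longrightarrow> f a = 0 \<and> deriv g a \<noteq> 0"
  shows "(\<lambda>z. if g z = 0 then deriv f z / deriv g z else f z / g z) holomorphic_on UNIV" (is "?h holomorphic_on _")
    and "g a = 0 \<Longrightarrow> eventually (\<lambda>z. g z \<noteq> 0) (at a)"
proof -
  have iso: "\<exists>r>0. \<forall>z\<in>ball a r - {a}. g z \<noteq> 0" if ga: "g a = 0" for a
  proof -
    obtain r where "r > 0" "inj_on g (ball a r)"
      using has_complex_derivative_locally_injective[OF g, of a] zeros[OF ga] by auto
    moreover have "g z \<noteq> 0" if "z \<in> ball a r - {a}" for z
      using inj_onD[OF \<open>inj_on g (ball a r)\<close>, of z a] that \<open>g a = 0\<close> \<open>r > 0\<close> by auto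
    ultimately show ?thesis by blast
  qed
  show "eventually (\<lambda>z. g z \<noteq> 0) (at a)" if "g a = 0" for a
    using iso[OF that] by (auto simp: eventually_at dist_commute)
  show "?h holomorphic_on UNIV"
  proof -
    have "\<exists>r>0. ?h holomorphic_on ball a r" for a
    proof (cases "g a = 0")
      case False
      have "open (g -` (-{0}))"
        using g by (intro open_vimage) (auto intro: holomorphic_on_imp_continuous_on)
      then obtain r where r: "r > 0" "ball a r \<subseteq> g -` (-{0})"
        using False by (metis ComplI open_contains_ball singletonD vimage_eq)
      have "(\<lambda>z. f z / g z) holomorphic_on ball a r"
        using r by (intro holomorphic_intros holomorphic_on_subset[OF f] holomorphic_on_subset[OF g]) auto
      also have "?this \<longleftrightarrow> ?h holomorphic_on ball a r"
        using r by (intro holomorphic_cong) auto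
      finally show ?thesis using r by blast
    next
      case True
      obtain r where r: "r > 0" "\<And>z. z \<in> ball a r - {a} \<Longrightarrow> g z \<noteq> 0"
        using iso[OF True] by auto
      have "(f has_field_derivative deriv f a) (at a)" "(g has_field_derivative deriv g a) (at a)"
        using f g by (auto intro!: holomorphic_derivI[where S = UNIV])
      hence "((\<lambda>z. (f z - f a) / (z - a)) \<longlongrightarrow> deriv f a) (at a)"
            "((\<lambda>z. (g z - g a) / (z - a)) \<longlongrightarrow> deriv g a) (at a)"
        by (simp_all add: has_field_derivative_iff)
      hence "((\<lambda>z. ((f z - f a) / (z - a)) / ((g z - g a) / (z - a))) \<longlongrightarrow> deriv f a / deriv g a) (at a)"
        using zeros[OF True] by (intro tendsto_divide) auto
      also have "?this \<longleftrightarrow> ((\<lambda>z. f z / g z) \<longlongrightarrow> deriv f a / deriv g a) (at a)"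
        using zeros[OF True] True
        by (intro filterlim_cong) (auto simp: eventually_at_filter)
      finally have lim: "((\<lambda>z. f z / g z) \<longlongrightarrow> deriv f a / deriv g a) (at a)" .
      have "(\<lambda>z. if z = a then deriv f a / deriv g a else f z / g z) holomorphic_on ball a r"
        using r by (intro removable_singularity[OF _ _ lim] holomorphic_intros
            holomorphic_on_subset[OF f] holomorphic_on_subset[OF g]) auto
      also have "?this \<longleftrightarrow> ?h holomorphic_on ball a r"
        using r True by (intro holomorphic_cong) auto
      finally show ?thesis using r by blast
    qed
    thus ?thesis
      by (meson UNIV_I analytic_imp_holomorphic analytic_on_def)
  qed
qed

text \<open>The factors of automorphy cancel in the quotient, which is entire and doubly periodic,
  hence constant by Liouville: a theta function of degree one is determined by its zeros up to a
  factor.\<close>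

lemma quasi_periodic_proportional:
  assumes \<tau>: "Im \<tau> > 0"
    and f: "f holomorphic_on UNIV" "quasi_periodic \<tau> f"
    and g: "g holomorphic_on UNIV" "quasi_periodic \<tau> g"
    and zeros: "\<And>a. g a = 0 \<Longrightarrow> f a = 0 \<and> deriv g a \<noteq> 0"
  shows "\<exists>C. \<forall>z. f z = C * g z"
proof -
  define h where "h = (\<lambda>z. if g z = 0 then deriv f z / deriv g z else f z / g z)"
  note hh = holomorphic_divide_simple_zeros[OF f(1) g(1) zeros, folded h_def]
  have h: "h holomorphic_on UNIV" using hh(1) by simp
  have hper: "h (z + of_int m + of_int k * \<tau>) = h z" if "g z \<noteq> 0" for z m k
    using that quasi_periodic_shift[OF f(2), of z m k] quasi_periodic_shift[OF g(2), of z m k]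
    by (simp add: h_def)
  define K where "K = (\<lambda>(x, y). complex_of_real x + of_real y * \<tau>) ` ({0..1} \<times> {0..1})"
  have "compact K"
    unfolding K_def case_prod_unfold by (intro compact_continuous_image continuous_intros compact_Times compact_Icc)
  hence "bounded (h ` K)"
    by (intro compact_imp_bounded compact_continuous_image holomorphic_on_imp_continuous_on
        holomorphic_on_subset[OF h]) auto
  then obtain M where M: "\<And>z. z \<in> K \<Longrightarrow> norm (h z) \<le> M"
    by (auto simp: bounded_iff)
  have M1: "norm (h z) \<le> M" if "g z \<noteq> 0" for z
  proof -
    define y where "y = Im z / Im \<tau>"
    define x where "x = Re z - y * Re \<tau>"
    have z: "z = of_real x + of_real y * \<tau>"
      using \<tau> by (simp add: complex_eq_iff x_def y_def)
    \<comment> \<open>The translate into the fundamental parallelogram, whose coordinates are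
      fractional parts.\<close>
    define w where "w = of_real (frac x) + of_real (frac y) * \<tau>"
    have zw: "z = w + of_int \<lfloor>x\<rfloor> + of_int \<lfloor>y\<rfloor> * \<tau>"
      by (simp add: z w_def frac_def algebra_simps)
    have "w \<in> K"
      unfolding K_def w_def by (intro image_eqI[of _ _ "(frac x, frac y)"]) (auto simp: frac_lt_1 less_imp_le)
    moreover have "g w \<noteq> 0"
      using that quasi_periodic_shift[OF g(2), of w] unfolding zw by auto
    ultimately show ?thesis
      using M hper[of w] zw by metis
  qed
  \<comment> \<open>Periodicity of \<open>h\<close> is available only off the zeros of
    \<open>g\<close>; continuity carries the bound over to them.\<close>
  have M2: "norm (h a) \<le> M" for a
  proof (cases "g a = 0")
    case True
    have "isCont h a"
      using h by (metis UNIV_I continuous_on_eq_continuous_at holomorphic_on_imp_continuous_on open_UNIV)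
    hence "((\<lambda>z. norm (h z)) \<longlongrightarrow> norm (h a)) (at a)"
      by (intro tendsto_norm) (simp add: isCont_def)
    moreover have "eventually (\<lambda>z. norm (h z) \<le> M) (at a)"
      using hh(2)[OF _ True] by (rule eventually_mono) (auto intro: M1)
    ultimately show ?thesis
      by (rule tendsto_upperbound) auto
  qed (use M1 in auto)
  have "bounded (range h)"
    using M2 by (auto simp: bounded_iff)
  then obtain C where C: "\<And>z. h z = C"
    using Liouville_theorem[OF h] by (auto simp: constant_on_def)
  have "f z = C * g z" for z
    using C[of z] zeros[of z] by (auto simp: h_def field_simps split: if_splits)
  thus ?thesis by blast
qed

section \<open>The theta product: periods, zeros and inversion\<close>

definition nome :: "complex \<Rightarrow> complex" where
  "nome \<tau> = exp (pi * \<i> * \<tau>)"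

text \<open>Jacobi's triple product for theta_3 without the factor prod (1 - t^(2n)), t the nome.
  That factor does not depend on z and is absorbed by the constant of proportionality.\<close>

definition theta_prod :: "complex \<Rightarrow> complex \<Rightarrow> complex" where
  "theta_prod \<tau> z = qprod (nome \<tau> * exp (2 * pi * \<i> * z)) (nome \<tau> ^ 2) *
     qprod (nome \<tau> * exp (- (2 * pi * \<i> * z))) (nome \<tau> ^ 2)"

lemma nome_nonzero [simp]: "nome \<tau> \<noteq> 0"
  by (simp add: nome_def)

lemma norm_nome: "norm (nome \<tau>) = exp (- pi * Im \<tau>)"
  by (simp add: nome_def)

lemma norm_nome_less_1 [simp]: "Im \<tau> > 0 \<Longrightarrow> norm (nome \<tau>) < 1"
  by (simp add: norm_nome)

lemma norm_nome_sq_less_1 [simp]: "Im \<tau> > 0 \<Longrightarrow> norm (nome \<tau> ^ 2) < 1"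
  by (simp add: norm_power power_less_one_iff)

lemma holomorphic_theta_prod: "Im \<tau> > 0 \<Longrightarrow> theta_prod \<tau> holomorphic_on UNIV"
  unfolding theta_prod_def by (intro holomorphic_intros) auto

lemma quasi_periodic_theta_prod:
  assumes "Im \<tau> > 0"
  shows "quasi_periodic \<tau> (theta_prod \<tau>)"
proof -
  have s: "norm (nome \<tau> ^ 2) < 1"
    using assms by simp
  have "theta_prod \<tau> (z + 1) = theta_prod \<tau> z" for z
    by (simp add: theta_prod_def ring_distribs exp_add exp_diff exp_minus)
  moreover have "theta_prod \<tau> (z + \<tau>) = exp (- (pi * \<i> * (\<tau> + 2 * z))) * theta_prod \<tau> z" for z
  proof -
    define t w where "t = nome \<tau>" and "w = exp (2 * pi * \<i> * z)"
    have [simp]: "t \<noteq> 0" "w \<noteq> 0" by (auto simp: t_def w_def)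
    have t2: "exp (2 * pi * \<i> * \<tau>) = t ^ 2"
      by (simp add: t_def nome_def exp_double[symmetric] mult_ac)
    have 1: "qprod (t * w) (t\<^sup>2) = (1 + t * w) * qprod (t * w * t\<^sup>2) (t\<^sup>2)"
      using s by (intro qprod_step) (simp add: t_def)
    have 2: "qprod (inverse (t * w)) (t\<^sup>2) = (1 + inverse (t * w)) * qprod (inverse (t * w) * t\<^sup>2) (t\<^sup>2)"
      using s by (intro qprod_step) (simp add: t_def)
    have e: "exp (2 * pi * \<i> * (z + \<tau>)) = w * t ^ 2"
      using t2 by (simp add: w_def ring_distribs exp_add)
    \<comment> \<open>The shift turns w into w t^2: the first product loses its factor 1 + t w and
      the second gains 1 + 1/(t w). Their ratio 1/(t w) is the factor of automorphy.\<close>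
    have "theta_prod \<tau> (z + \<tau>) = qprod (t * w * t\<^sup>2) (t\<^sup>2) * qprod (inverse (t * w)) (t\<^sup>2)"
      unfolding theta_prod_def exp_minus e t_def[symmetric]
      by (simp add: field_simps power2_eq_square)
    also have "\<dots> = qprod (t * w * t\<^sup>2) (t\<^sup>2) * ((1 + inverse (t * w)) * qprod (t / w) (t\<^sup>2))"
    proof -
      have "inverse (t * w) * t\<^sup>2 = t / w" by (simp add: field_simps power2_eq_square)
      with 2 show ?thesis by simp
    qed
    also have "\<dots> = inverse (t * w) * ((1 + t * w) * qprod (t * w * t\<^sup>2) (t\<^sup>2) * qprod (t / w) (t\<^sup>2))"
      by (simp add: field_simps)
    also have "\<dots> = inverse (t * w) * (qprod (t * w) (t\<^sup>2) * qprod (t / w) (t\<^sup>2))"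
      by (simp add: 1)
    also have "\<dots> = inverse (t * w) * theta_prod \<tau> z"
      unfolding theta_prod_def exp_minus t_def[symmetric] w_def[symmetric] by (simp add: divide_inverse)
    also have "inverse (t * w) = exp (- (pi * \<i> * (\<tau> + 2 * z)))"
      by (simp add: t_def w_def nome_def exp_minus[symmetric] exp_add[symmetric] algebra_simps
          flip: inverse_mult_distrib)
    finally show ?thesis .
  qed
  ultimately show ?thesis by (simp add: quasi_periodic_def)
qed

text \<open>The product vanishes only through one of its factors. The first product supplies the
  zeros with k < 0, the second those with k >= 0.\<close>

lemma theta_prod_zeros:
  assumes \<tau>: "Im \<tau> > 0" and z: "theta_prod \<tau> z = 0"
  shows "\<exists>m k. z = (1 + \<tau>) / 2 + of_int m + of_int k * \<tau>"
proof -
  have s: "norm (nome \<tau> ^ 2) < 1" using \<tau> by simp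
  have pw: "(nome \<tau> ^ 2) ^ n = exp (2 * pi * \<i> * (of_nat n * \<tau>))" for n
    by (simp add: nome_def power_mult[symmetric] exp_of_nat_mult[symmetric] mult_ac)
  from z consider n where "nome \<tau> * exp (2 * pi * \<i> * z) * (nome \<tau> ^ 2) ^ n = -1"
    | n where "nome \<tau> * exp (- (2 * pi * \<i> * z)) * (nome \<tau> ^ 2) ^ n = -1"
    by (auto simp: theta_prod_def qprod_eq_0_iff[OF s])
  thus ?thesis
  proof cases
    case 1
    hence "exp (pi * \<i> * \<tau> + 2 * pi * \<i> * z + 2 * pi * \<i> * (of_nat n * \<tau>)) = exp (pi * \<i>)"
      unfolding pw by (simp add: exp_add nome_def)
    from iffD1[OF exp_eq this] obtain k :: int where "pi * \<i> * \<tau> + 2 * pi * \<i> * z + 2 * pi * \<i> * (of_nat n * \<tau>) = pi * \<i> + 2 * of_int k * pi * \<i>"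
      by (auto simp: algebra_simps)
    hence "(2 * pi * \<i>) * (\<tau> / 2 + z + of_nat n * \<tau>) = (2 * pi * \<i>) * (1/2 + of_int k)"
      by (simp add: algebra_simps)
    hence "\<tau> / 2 + z + of_nat n * \<tau> = 1/2 + of_int k"
      by (rule mult_left_cancel[THEN iffD1, rotated]) simp
    hence "z = 1/2 + of_int k - \<tau> / 2 - of_nat n * \<tau>"
      by (simp add: eq_diff_eq add_ac)
    hence "z = (1 + \<tau>) / 2 + of_int k + of_int (-1 - int n) * \<tau>"
      by (simp add: add_divide_distrib left_diff_distrib)
    thus ?thesis by blast
  next
    case 2
    hence "exp (pi * \<i> * \<tau> - 2 * pi * \<i> * z + 2 * pi * \<i> * (of_nat n * \<tau>)) = exp (pi * \<i>)"
      unfolding pw by (simp add: exp_add exp_diff exp_minus nome_def field_simps)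
    from iffD1[OF exp_eq this] obtain k :: int where "pi * \<i> * \<tau> - 2 * pi * \<i> * z + 2 * pi * \<i> * (of_nat n * \<tau>) = pi * \<i> + 2 * of_int k * pi * \<i>"
      by (auto simp: algebra_simps)
    hence "(2 * pi * \<i>) * (\<tau> / 2 - z + of_nat n * \<tau>) = (2 * pi * \<i>) * (1/2 + of_int k)"
      by (simp add: algebra_simps)
    hence "\<tau> / 2 - z + of_nat n * \<tau> = 1/2 + of_int k"
      by (rule mult_left_cancel[THEN iffD1, rotated]) simp
    moreover have "z = \<tau> / 2 + of_nat n * \<tau> - (\<tau> / 2 - z + of_nat n * \<tau>)"
      by simp
    ultimately have "z = \<tau> / 2 + of_nat n * \<tau> - (1/2 + of_int k)"
      by (simp only:)
    hence "z = (1 + \<tau>) / 2 + of_int (-k-1) + of_int (int n) * \<tau>"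
      by (simp add: add_divide_distrib)
    thus ?thesis by blast
  qed
qed

text \<open>The second zero is recorded for the inversion: with tau' = -1/tau, the point (1 +
  tau)/(2 tau) is 1/2 - tau'/2.\<close>

lemma theta_prod_zero_half:
  assumes \<tau>: "Im \<tau> > 0"
  shows "theta_prod \<tau> ((1 + \<tau>) / 2) = 0" "theta_prod \<tau> (1 / 2 - \<tau> / 2) = 0"
    and "deriv (theta_prod \<tau>) ((1 + \<tau>) / 2) \<noteq> 0"
proof -
  have s: "norm (nome \<tau> ^ 2) < 1" using \<tau> by simp
  define z0 where "z0 = (1 + \<tau>) / 2"
  define t where "t = nome \<tau>"
  have [simp]: "t \<noteq> 0" by (simp add: t_def)
  have s': "norm (t ^ 2) < 1" using s by (simp add: t_def)
  have w0: "exp (2 * pi * \<i> * z0) = -t"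
  proof -
    have "2 * pi * \<i> * z0 = pi * \<i> + pi * \<i> * \<tau>"
      by (simp add: z0_def field_simps)
    thus ?thesis by (simp add: t_def nome_def exp_add)
  qed
  have w0': "exp (2 * pi * \<i> * (1 / 2 - \<tau> / 2)) = -1/t"
  proof -
    have "2 * pi * \<i> * (1 / 2 - \<tau> / 2) = pi * \<i> - pi * \<i> * \<tau>"
      by (simp add: field_simps)
    thus ?thesis by (simp only: t_def nome_def exp_diff exp_pi_i)
  qed
  show 0: "theta_prod \<tau> ((1 + \<tau>) / 2) = 0"
    unfolding theta_prod_def z0_def[symmetric] exp_minus w0 t_def[symmetric]
    using qprod_eq_0_iff[OF s', of "-1"] by (auto intro!: exI[of _ 0])
  show "theta_prod \<tau> (1 / 2 - \<tau> / 2) = 0"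
    unfolding theta_prod_def exp_minus w0' t_def[symmetric]
    using qprod_eq_0_iff[OF s', of "-1"] by (auto intro!: exI[of _ 0])
  \<comment> \<open>The theta product without the factor 1 + t exp(-2 pi i z), which alone vanishes
    at \<open>z0\<close>. The derivative there is 2 pi i times the value of
    \<open>G\<close>.\<close>
  define G where "G = (\<lambda>z. qprod (t * exp (2 * pi * \<i> * z)) (t ^ 2) * qprod (t * exp (- (2 * pi * \<i> * z)) * t ^ 2) (t ^ 2))"
  have hG: "G holomorphic_on UNIV"
    unfolding G_def using s' by (intro holomorphic_intros) auto
  have eq: "theta_prod \<tau> = (\<lambda>z. (1 + t * exp (- (2 * pi * \<i> * z))) * G z)"
    unfolding theta_prod_def G_def t_def[symmetric] fun_eq_iff
    using qprod_step[OF s', of "t * exp (- (2 * pi * \<i> * z))" for z]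
    by (simp add: mult_ac)
  have nz: "norm (t ^ n) < 1" if "n > 0" for n
    using \<tau> that by (simp add: t_def norm_power power_less_one_iff)
  have pw: "t ^ 2 * (t ^ 2) ^ n = t ^ (2 * n + 2)" for n
    by (simp only: power_mult[symmetric] power_add[symmetric] add.commute)
  have G0: "G z0 \<noteq> 0"
  proof
    assume "G z0 = 0"
    then obtain n where "-t * t * (t^2)^n = -1 \<or> (- 1) * t^2 * (t^2)^n = -1"
      unfolding G_def exp_minus w0 using qprod_eq_0_iff[OF s'] by (auto simp: mult_ac)
    hence "t ^ (2 * n + 2) = 1"
      unfolding pw[symmetric] by (auto simp: power2_eq_square)
    with nz[of "2 * n + 2"] show False by simp
  qed
  have "(theta_prod \<tau> has_field_derivative
      (- (2 * pi * \<i>) * (t * exp (- (2 * pi * \<i> * z0)))) * G z0 + (1 + t * exp (- (2 * pi * \<i> * z0))) * deriv G z0) (at z0)"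
    unfolding eq
    by (rule derivative_eq_intros holomorphic_derivI[OF hG] refl | simp)+
  hence "(theta_prod \<tau> has_field_derivative (2 * pi * \<i>) * G z0) (at z0)"
    unfolding exp_minus w0 by simp
  hence "deriv (theta_prod \<tau>) z0 = (2 * pi * \<i>) * G z0"
    by (rule DERIV_imp_deriv)
  thus "deriv (theta_prod \<tau>) ((1 + \<tau>) / 2) \<noteq> 0"
    using G0 by (simp add: z0_def)
qed

text \<open>Every zero is a lattice translate of (1 + tau)/2, and the nowhere vanishing factor of
  automorphy transports the nonzero derivative.\<close>

lemma theta_prod_simple_zeros:
  assumes \<tau>: "Im \<tau> > 0" and z: "theta_prod \<tau> z = 0"
  shows "deriv (theta_prod \<tau>) z \<noteq> 0"
proof -
  obtain m k where mk: "z = (1 + \<tau>) / 2 + of_int m + of_int k * \<tau>"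
    using theta_prod_zeros[OF assms] by blast
  define z0 where "z0 = (1 + \<tau>) / 2"
  define c where "c = of_int m + of_int k * \<tau>"
  define E where "E = (\<lambda>w. exp (- (pi * \<i> * (of_int k ^ 2 * \<tau> + 2 * of_int k * w))))"
  have zc: "z = z0 + c" using mk by (simp add: z0_def c_def)
  have "theta_prod \<tau> w = E (w - c) * theta_prod \<tau> (w - c)" for w
    using quasi_periodic_shift[OF quasi_periodic_theta_prod[OF \<tau>], of "w - c" m k]
    by (simp add: E_def c_def algebra_simps)
  hence eq: "theta_prod \<tau> = (\<lambda>w. E (w - c) * theta_prod \<tau> (w - c))" by blast
  have d: "((\<lambda>w. w - c) has_field_derivative 1) (at z)"
    by (auto intro!: derivative_eq_intros)
  have E: "(E has_field_derivative deriv E z0) (at (z - c))"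
    unfolding E_def zc by (auto intro!: holomorphic_derivI[of _ UNIV] holomorphic_intros)
  have T: "(theta_prod \<tau> has_field_derivative deriv (theta_prod \<tau>) z0) (at (z - c))"
    unfolding zc using holomorphic_derivI[OF holomorphic_theta_prod[OF \<tau>]] by simp
  have "((\<lambda>w. E (w - c) * theta_prod \<tau> (w - c)) has_field_derivative
     deriv E z0 * theta_prod \<tau> (z - c) + deriv (theta_prod \<tau>) z0 * E (z - c)) (at z)"
    using DERIV_mult[OF DERIV_chain2[OF E d] DERIV_chain2[OF T d]] by simp
  hence "(theta_prod \<tau> has_field_derivative deriv (theta_prod \<tau>) z0 * E z0) (at z)"
    unfolding eq[symmetric] using theta_prod_zero_half(1)[OF \<tau>] by (simp add: zc z0_def)
  hence "deriv (theta_prod \<tau>) z = deriv (theta_prod \<tau>) z0 * E z0"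
    by (rule DERIV_imp_deriv)
  thus ?thesis
    using theta_prod_zero_half(3)[OF \<tau>] by (simp add: z0_def E_def)
qed

text \<open>The Gaussian factor makes the rescaled theta product for -1/tau quasi-periodic for tau,
  and it vanishes where the one for tau does. \<open>C\<close> is never computed: it cancels in
  ratios of theta values.\<close>

lemma theta_prod_inversion:
  assumes \<tau>: "Im \<tau> > 0"
  shows "\<exists>C. \<forall>z. exp (- (pi * \<i> * z\<^sup>2 / \<tau>)) * theta_prod (-1/\<tau>) (z / \<tau>) = C * theta_prod \<tau> z"
proof (rule quasi_periodic_proportional[OF \<tau> _ _ holomorphic_theta_prod[OF \<tau>] quasi_periodic_theta_prod[OF \<tau>]])
  have [simp]: "\<tau> \<noteq> 0" using \<tau> by auto
  have \<tau>': "Im (-1/\<tau>) > 0"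
    using \<tau> by (simp add: Im_divide_Reals Im_divide divide_simps sum_power2_gt_zero_iff complex_eq_iff)
  let ?f = "\<lambda>z. exp (- (pi * \<i> * z\<^sup>2 / \<tau>)) * theta_prod (-1/\<tau>) (z / \<tau>)"
  have "theta_prod (-1/\<tau>) \<circ> (\<lambda>z. z / \<tau>) holomorphic_on UNIV"
    by (intro holomorphic_on_compose_gen[OF _ holomorphic_theta_prod[OF \<tau>']] holomorphic_intros) auto
  thus "?f holomorphic_on UNIV"
    by (intro holomorphic_intros) (auto simp: o_def)
  have qp: "quasi_periodic (-1/\<tau>) (theta_prod (-1/\<tau>))"
    by (rule quasi_periodic_theta_prod[OF \<tau>'])
  have "?f (z + 1) = ?f z" for z
  proof -
    \<comment> \<open>Adding 1 to z adds 1/tau to z/tau, which is one negative step along the period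
      -1/tau.\<close>
    have "theta_prod (-1/\<tau>) (z / \<tau> + of_int 0 + of_int (-1) * (-1/\<tau>)) =
       exp (- (pi * \<i> * (of_int (-1) ^ 2 * (-1/\<tau>) + 2 * of_int (-1) * (z/\<tau>)))) * theta_prod (-1/\<tau>) (z / \<tau>)"
      by (rule quasi_periodic_shift[OF qp])
    hence "?f (z + 1) = exp (- (pi * \<i> * (z+1)\<^sup>2 / \<tau>)) *
       exp (- (pi * \<i> * (-1/\<tau> - 2 * (z/\<tau>)))) * theta_prod (-1/\<tau>) (z / \<tau>)"
      by (simp add: add_divide_distrib)
    also have "exp (- (pi * \<i> * (z+1)\<^sup>2 / \<tau>)) * exp (- (pi * \<i> * (-1/\<tau> - 2 * (z/\<tau>)))) = exp (- (pi * \<i> * z\<^sup>2 / \<tau>))"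
    proof -
      have "- (pi * \<i> * (z+1)\<^sup>2 / \<tau>) + - (pi * \<i> * (-1/\<tau> - 2 * (z/\<tau>))) = - (pi * \<i> * z\<^sup>2 / \<tau>)"
        by (simp add: field_simps power2_eq_square)
      thus ?thesis by (simp only: exp_add[symmetric])
    qed
    finally show ?thesis .
  qed
  moreover have "?f (z + \<tau>) = exp (- (pi * \<i> * (\<tau> + 2 * z))) * ?f z" for z
  proof -
    have 1: "theta_prod (-1/\<tau>) (z / \<tau> + 1) = theta_prod (-1/\<tau>) (z / \<tau>)"
      using qp by (simp add: quasi_periodic_def)
    have 2: "(z + \<tau>) / \<tau> = z / \<tau> + 1"
      by (simp add: add_divide_distrib)
    have "- (pi * \<i> * (z+\<tau>)\<^sup>2 / \<tau>) = - (pi * \<i> * (\<tau> + 2 * z)) + - (pi * \<i> * z\<^sup>2 / \<tau>)"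
      by (simp add: field_simps power2_eq_square)
    hence 3: "exp (- (pi * \<i> * (z+\<tau>)\<^sup>2 / \<tau>)) =
        exp (- (pi * \<i> * (\<tau> + 2 * z))) * exp (- (pi * \<i> * z\<^sup>2 / \<tau>))"
      by (simp only: exp_add[symmetric])
    show ?thesis unfolding 2 1 3 by (simp only: mult.assoc)
  qed
  ultimately show qf: "quasi_periodic \<tau> ?f" by (simp add: quasi_periodic_def)
  fix a assume a: "theta_prod \<tau> a = 0"
  obtain m k where mk: "a = (1 + \<tau>) / 2 + of_int m + of_int k * \<tau>"
    using theta_prod_zeros[OF \<tau> a] by blast
  have "(1 + \<tau>) / 2 / \<tau> = 1 / 2 - (-1/\<tau>) / 2" by (simp add: field_simps)
  hence "?f ((1 + \<tau>) / 2) = 0"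
    using theta_prod_zero_half(2)[OF \<tau>'] by simp
  hence "?f a = 0"
    using quasi_periodic_shift[OF qf, of "(1 + \<tau>) / 2" m k] mk by simp
  thus "?f a = 0 \<and> deriv (theta_prod \<tau>) a \<noteq> 0"
    using theta_prod_simple_zeros[OF \<tau> a] by simp
qed

section \<open>The modular group and the lambda function\<close>

abbreviation uhp :: "complex set" where
  "uhp \<equiv> {\<tau>. Im \<tau> > 0}"

abbreviation at_cusp :: "complex filter" where
  "at_cusp \<equiv> filtercomap Im at_top"

lemma open_uhp [simp]: "open uhp"
  by (rule open_halfspace_Im_gt)

lemma connected_uhp [simp]: "connected uhp"
  by (intro convex_connected convex_halfspace_Im_gt)

lemma Im_moebius:
  fixes a b c d :: int
  shows "Im ((of_int a * \<tau> + of_int b) / (of_int c * \<tau> + of_int d)) =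
    of_int (a * d - b * c) * Im \<tau> / norm (of_int c * \<tau> + of_int d) ^ 2"
  by (simp add: Im_divide cmod_power2 algebra_simps)

lemma moebius_denominator_nonzero:
  fixes c d :: int
  assumes "Im \<tau> > 0" "c \<noteq> 0 \<or> d \<noteq> 0"
  shows "of_int c * \<tau> + of_int d \<noteq> 0"
  using assms by (auto simp: complex_eq_iff)

lemma Im_minus_inverse_pos: "Im \<tau> > 0 \<Longrightarrow> Im (-1/\<tau>) > 0"
  using Im_moebius[of 0 \<tau> "-1" 1 0] by (auto simp: zero_less_divide_iff)

section \<open>Modular equivalence, reduction and modular functions\<close>

definition modular_equiv :: "complex \<Rightarrow> complex \<Rightarrow> bool" where
  "modular_equiv \<tau> \<tau>' \<longleftrightarrow>
     (\<exists>a b c d :: int. a * d - b * c = 1 \<and> \<tau>' = (of_int a * \<tau> + of_int b) / (of_int c * \<tau> + of_int d))"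

lemma moebius_compose:
  fixes a b c d a' b' c' d' :: int
  assumes "Im \<tau> > 0" "c \<noteq> 0 \<or> d \<noteq> 0"
    and "\<tau>' = (of_int a * \<tau> + of_int b) / (of_int c * \<tau> + of_int d)"
  shows "(of_int a' * \<tau>' + of_int b') / (of_int c' * \<tau>' + of_int d') =
     (of_int (a' * a + b' * c) * \<tau> + of_int (a' * b + b' * d)) /
     (of_int (c' * a + d' * c) * \<tau> + of_int (c' * b + d' * d))"
proof -
  have nz: "of_int c * \<tau> + of_int d \<noteq> 0"
    by (rule moebius_denominator_nonzero) fact+
  have "of_int a' * \<tau>' + of_int b' = (of_int (a' * a + b' * c) * \<tau> + of_int (a' * b + b' * d)) / (of_int c * \<tau> + of_int d)"
       "of_int c' * \<tau>' + of_int d' = (of_int (c' * a + d' * c) * \<tau> + of_int (c' * b + d' * d)) / (of_int c * \<tau> + of_int d)"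
    using nz by (simp_all add: assms(3) field_simps)
  thus ?thesis using nz by simp
qed

lemma modular_equiv_Im_pos:
  assumes "modular_equiv \<tau> \<tau>'" "Im \<tau> > 0"
  shows "Im \<tau>' > 0"
proof -
  obtain a b c d :: int where *: "a * d - b * c = 1" "\<tau>' = (of_int a * \<tau> + of_int b) / (of_int c * \<tau> + of_int d)"
    using assms(1) by (auto simp: modular_equiv_def)
  hence "c \<noteq> 0 \<or> d \<noteq> 0" by auto
  from moebius_denominator_nonzero[OF assms(2) this] show ?thesis
    unfolding *(2) Im_moebius *(1) using assms(2) by simp
qed

lemma modular_equiv_trans:
  assumes "modular_equiv \<tau> \<tau>'" "modular_equiv \<tau>' \<tau>''" "Im \<tau> > 0"
  shows "modular_equiv \<tau> \<tau>''"
proof -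
  obtain a b c d :: int where 1: "a * d - b * c = 1" "\<tau>' = (of_int a * \<tau> + of_int b) / (of_int c * \<tau> + of_int d)"
    using assms(1) by (auto simp: modular_equiv_def)
  obtain a' b' c' d' :: int where 2: "a' * d' - b' * c' = 1" "\<tau>'' = (of_int a' * \<tau>' + of_int b') / (of_int c' * \<tau>' + of_int d')"
    using assms(2) by (auto simp: modular_equiv_def)
  have "c \<noteq> 0 \<or> d \<noteq> 0" using 1 by auto
  note eq = moebius_compose[OF assms(3) this 1(2), of a' b' c' d', folded 2(2)]
  have "(a' * a + b' * c) * (c' * b + d' * d) - (a' * b + b' * d) * (c' * a + d' * c) =
      (a * d - b * c) * (a' * d' - b' * c')" by algebra
  with 1 2 have "(a' * a + b' * c) * (c' * b + d' * d) - (a' * b + b' * d) * (c' * a + d' * c) = 1" by simp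
  with eq show ?thesis unfolding modular_equiv_def by blast
qed

lemma modular_equiv_sym:
  assumes "modular_equiv \<tau> \<tau>'" "Im \<tau> > 0"
  shows "modular_equiv \<tau>' \<tau>"
proof -
  obtain a b c d :: int where 1: "a * d - b * c = 1" "\<tau>' = (of_int a * \<tau> + of_int b) / (of_int c * \<tau> + of_int d)"
    using assms(1) by (auto simp: modular_equiv_def)
  have "c \<noteq> 0 \<or> d \<noteq> 0" using 1 by auto
  note eq = moebius_compose[OF assms(2) this 1(2), of d "-b" "-c" a]
  have "(of_int d * \<tau>' + of_int (-b)) / (of_int (-c) * \<tau>' + of_int a) = \<tau>"
    unfolding eq using 1(1) by (simp add: mult.commute flip: of_int_mult of_int_diff of_int_add)
  moreover have "d * a - (-b) * (-c) = 1" using 1 by (simp add: mult.commute)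
  ultimately show ?thesis unfolding modular_equiv_def by metis
qed

text \<open>Stated for the two generators, which is what can be checked on explicit
  functions.\<close>

definition modular_invariant :: "(complex \<Rightarrow> complex) \<Rightarrow> bool" where
  "modular_invariant f \<longleftrightarrow> (\<forall>\<tau>. Im \<tau> > 0 \<longrightarrow> f (\<tau> + 1) = f \<tau> \<and> f (-1/\<tau>) = f \<tau>)"

lemma periodic_shift_int:
  assumes "\<And>\<tau>. Im \<tau> > 0 \<Longrightarrow> f (\<tau> + 1) = f \<tau>" "Im \<tau> > 0"
  shows "f (\<tau> + of_int n) = f \<tau>"
proof (induction n rule: int_induct[of _ 0])
  case (step1 i)
  thus ?case using assms(1)[of "\<tau> + of_int i"] assms(2) by (simp add: add.assoc)
next
  case (step2 i)
  thus ?case using assms(1)[of "\<tau> + of_int (i - 1)"] assms(2) by simp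
qed auto

text \<open>Induction on |c| by the Euclidean algorithm: a translation reduces a modulo c, and the
  inversion makes the remainder the new lower left entry.\<close>

lemma modular_invariant_moebius:
  fixes a b c d :: int
  assumes f: "modular_invariant f" and \<tau>: "Im \<tau> > 0" and det: "a * d - b * c = 1"
  shows "f ((of_int a * \<tau> + of_int b) / (of_int c * \<tau> + of_int d)) = f \<tau>"
  using det
proof (induction "nat \<bar>c\<bar>" arbitrary: a b c d rule: less_induct)
  case less
  have shift: "f (z + of_int n) = f z" if "Im z > 0" for z n
    using f that by (intro periodic_shift_int) (auto simp: modular_invariant_def)
  show ?case
  proof (cases "c = 0")
    case True
    with less.prems have "a * d = 1" by simp
    hence "a = 1 \<and> d = 1 \<or> a = -1 \<and> d = -1" by (simp add: zmult_eq_1_iff)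
    thus ?thesis
      using shift[OF \<tau>, of b] shift[OF \<tau>, of "-b"] True by auto
  next
    case False
    \<comment> \<open>The remainder is taken modulo |c|, so that it is nonnegative and smaller than
      |c|; the sign of c goes into the quotient.\<close>
    define r where "r = a mod \<bar>c\<bar>"
    define q where "q = (a div \<bar>c\<bar>) * sgn c"
    have r: "0 \<le> r" "r < \<bar>c\<bar>" using False by (auto simp: r_def)
    have "(a div \<bar>c\<bar>) * \<bar>c\<bar> + r = a" unfolding r_def by (rule div_mult_mod_eq)
    hence a: "a = q * c + r"
      by (simp add: q_def abs_sgn mult_ac)
    define \<tau>' where "\<tau>' = (of_int a * \<tau> + of_int b) / (of_int c * \<tau> + of_int d)"
    have \<tau>'pos: "Im \<tau>' > 0"
      using modular_equiv_Im_pos[OF _ \<tau>] less.prems unfolding modular_equiv_def \<tau>'_def by blast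
    have nz: "of_int c * \<tau> + of_int d \<noteq> 0"
      using False by (intro moebius_denominator_nonzero[OF \<tau>]) auto
    have eq: "\<tau>' + of_int (-q) = (of_int r * \<tau> + of_int (b - q * d)) / (of_int c * \<tau> + of_int d)"
      using nz by (simp add: \<tau>'_def a field_simps)
    have "f \<tau>' = f (\<tau>' + of_int (-q))"
      by (rule shift[OF \<tau>'pos, symmetric])
    also have "\<dots> = f (-1 / (\<tau>' + of_int (-q)))"
      using f \<tau>'pos unfolding modular_invariant_def by simp
    also have "-1 / (\<tau>' + of_int (-q)) = (of_int (-c) * \<tau> + of_int (-d)) / (of_int r * \<tau> + of_int (b - q * d))"
      unfolding eq by (simp add: minus_divide_left)
    also have "f \<dots> = f \<tau>"
    proof (rule less.hyps)
      show "nat \<bar>r\<bar> < nat \<bar>c\<bar>" using r by simp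
      show "- c * (b - q * d) - - d * r = 1"
        using less.prems unfolding a by (simp add: algebra_simps)
    qed
    finally show ?thesis by (simp add: \<tau>'_def)
  qed
qed

lemma modular_invariant_equiv:
  "modular_invariant f \<Longrightarrow> modular_equiv \<tau> \<tau>' \<Longrightarrow> Im \<tau> > 0 \<Longrightarrow> f \<tau>' = f \<tau>"
  using modular_invariant_moebius by (auto simp: modular_equiv_def)

lemma finite_moebius_denominators:
  assumes "Im \<tau> > 0"
  shows "finite {(c::int, d::int). norm (of_int c * \<tau> + of_int d) \<le> R}"
proof -
  define M where "M = \<lceil>R / Im \<tau>\<rceil>"
  define N where "N = \<lceil>R + (R / Im \<tau>) * norm \<tau>\<rceil>"
  have "{(c::int, d::int). norm (of_int c * \<tau> + of_int d) \<le> R} \<subseteq> {-M..M} \<times> {-N..N}"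
  proof (rule subrelI)
    fix c d :: int assume "(c, d) \<in> {(c, d). norm (of_int c * \<tau> + of_int d) \<le> R}"
    hence *: "norm (of_int c * \<tau> + of_int d) \<le> R" by simp
    have "\<bar>Im (of_int c * \<tau> + of_int d)\<bar> \<le> R"
      using abs_Im_le_cmod * by (rule order.trans)
    hence c: "\<bar>of_int c\<bar> \<le> R / Im \<tau>"
      using assms by (simp add: abs_mult field_simps)
    have "norm (of_int d :: complex) \<le> norm (of_int c * \<tau> + of_int d) + norm (of_int c * \<tau>)"
      using norm_triangle_ineq4[of "of_int c * \<tau> + of_int d" "of_int c * \<tau>"] by simp
    also have "\<dots> \<le> R + (R / Im \<tau>) * norm \<tau>"
      using * mult_right_mono[OF c norm_ge_zero[of \<tau>]] by (simp add: norm_mult)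
    finally have d: "\<bar>of_int d\<bar> \<le> R + (R / Im \<tau>) * norm \<tau>" by simp
    have "\<bar>c\<bar> \<le> M" "\<bar>d\<bar> \<le> N"
      using c d by (simp_all add: M_def N_def le_ceiling_iff)
    thus "(c, d) \<in> {-M..M} \<times> {-N..N}" by auto
  qed
  thus ?thesis by (rule finite_subset) auto
qed

text \<open>The pair \<open>(c, d)\<close> minimising \<open>\<bar>c \<tau> + d\<bar>\<close> gives the reduced representative.\<close>

lemma modular_reduction:
  assumes \<tau>: "Im \<tau> > 0"
  obtains \<tau>' where "modular_equiv \<tau> \<tau>'" "\<bar>Re \<tau>'\<bar> \<le> 1/2" "norm \<tau>' \<ge> 1"
proof -
  define P where "P = {(c::int, d::int). norm (of_int c * \<tau> + of_int d) \<le> 1} - {(0, 0)}"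
  have finP: "finite P" unfolding P_def using finite_moebius_denominators[OF \<tau>] by blast
  have inP: "(0, 1) \<in> P" by (auto simp: P_def)
  define F where "F = (\<lambda>(c::int, d::int). norm (of_int c * \<tau> + of_int d))"
  obtain c d where cd: "(c, d) \<in> P" "\<And>p. p \<in> P \<Longrightarrow> F (c, d) \<le> F p"
    using arg_min_if_finite(1)[OF finP, of F] arg_min_least[OF finP, of _ F] inP
    by (metis (no_types, lifting) empty_iff surj_pair)
  have nz0: "c \<noteq> 0 \<or> d \<noteq> 0" using cd(1) by (auto simp: P_def)
  define w where "w = of_int c * \<tau> + of_int d"
  have w: "norm w > 0" "norm w \<le> 1"
    using cd(1) moebius_denominator_nonzero[OF \<tau> nz0] by (auto simp: w_def P_def)
  have min: "norm w \<le> norm (of_int c' * \<tau> + of_int d')" if "c' \<noteq> 0 \<or> d' \<noteq> 0" for c' d' :: int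
  proof (cases "norm (of_int c' * \<tau> + of_int d') \<le> 1")
    case True
    hence "(c', d') \<in> P" using that by (auto simp: P_def)
    from cd(2)[OF this] show ?thesis by (simp add: F_def w_def)
  next
    case False thus ?thesis using w by linarith
  qed
  \<comment> \<open>The minimal pair is coprime, since dividing it by its gcd would give a smaller
    value.\<close>
  define g where "g = gcd c d"
  have g: "g > 0" using nz0 by (auto simp: g_def)
  define c1 d1 where "c1 = c div g" and "d1 = d div g"
  have c1: "c = g * c1" "d = g * d1" "coprime c1 d1"
    using div_gcd_coprime[OF nz0] by (simp_all add: c1_def d1_def g_def)
  have nz1: "c1 \<noteq> 0 \<or> d1 \<noteq> 0" using nz0 c1 by auto
  have "norm w = of_int g * norm (of_int c1 * \<tau> + of_int d1)"
    using g by (simp add: w_def c1 norm_mult mult.assoc flip: distrib_left)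
  moreover from this w(1) have "norm (of_int c1 * \<tau> + of_int d1) > 0"
    by (metis mult_zero_right norm_ge_zero order_le_less)
  ultimately have "real_of_int g \<le> 1"
    using min[OF nz1] by simp
  hence "g = 1" using g by simp
  hence cop: "coprime c d" using c1 by simp
  obtain u v where uv: "u * c + v * d = 1"
    using cop by (metis bezout_int coprime_iff_gcd_eq_1)
  define \<tau>1 where "\<tau>1 = (of_int v * \<tau> + of_int (-u)) / (of_int c * \<tau> + of_int d)"
  define n where "n = round (Re \<tau>1)"
  define \<tau>2 where "\<tau>2 = \<tau>1 - of_int n"
  have wnz: "of_int c * \<tau> + of_int d \<noteq> 0" using w by (auto simp: w_def)
  have eq: "\<tau>2 = (of_int (v - n * c) * \<tau> + of_int (-u - n * d)) / (of_int c * \<tau> + of_int d)"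
    using wnz by (simp add: \<tau>2_def \<tau>1_def field_simps)
  have det: "(v - n * c) * d - (-u - n * d) * c = 1"
    using uv by (simp add: algebra_simps)
  show ?thesis
  proof
    show "modular_equiv \<tau> \<tau>2"
      unfolding modular_equiv_def using det eq by blast
    show "\<bar>Re \<tau>2\<bar> \<le> 1/2"
      using of_int_round_abs_le[of "Re \<tau>1"] by (simp add: \<tau>2_def n_def abs_minus_commute)
    \<comment> \<open>The numerator is itself a nonzero integral combination of tau and 1, so
      minimality of the denominator yields norm at least 1.\<close>
    have "v - n * c \<noteq> 0 \<or> -u - n * d \<noteq> 0" using det by auto
    from min[OF this] w show "norm \<tau>2 \<ge> 1"
      unfolding eq norm_divide w_def[symmetric] by simp
  qed
qed

text \<open>The sharp bound is sqrt 3 / 2; the rational value 1/2 serves equally well to make the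
  truncated domain compact.\<close>

lemma fundamental_domain_Im:
  assumes "\<bar>Re \<tau>\<bar> \<le> 1/2" "norm \<tau> \<ge> 1" "Im \<tau> > 0"
  shows "Im \<tau> \<ge> 1/2"
proof -
  have "(Re \<tau>)\<^sup>2 \<le> (1/2)\<^sup>2" using assms(1) by (simp add: abs_le_square_iff[symmetric])
  moreover have "1 \<le> (Re \<tau>)\<^sup>2 + (Im \<tau>)\<^sup>2"
    using assms(2) by (metis cmod_power2 one_le_power)
  ultimately have "(1/2)\<^sup>2 \<le> (Im \<tau>)\<^sup>2" by (simp add: power2_eq_square)
  thus ?thesis by (rule power2_le_imp_le) (use assms(3) in simp)
qed

lemma compact_truncated_domain: "compact {\<tau>. \<bar>Re \<tau>\<bar> \<le> 1/2 \<and> 1/2 \<le> Im \<tau> \<and> Im \<tau> \<le> Y}"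
proof -
  have "{\<tau>. \<bar>Re \<tau>\<bar> \<le> 1/2 \<and> 1/2 \<le> Im \<tau> \<and> Im \<tau> \<le> Y} = cbox (Complex (-1/2) (1/2)) (Complex (1/2) Y)"
    by (auto simp: in_cbox_complex_iff abs_le_iff)
  thus ?thesis by (simp only: compact_cbox)
qed

lemma eventually_at_cuspD:
  assumes "eventually P at_cusp"
  obtains Y where "Y > 0" "\<And>\<tau>. Im \<tau> \<ge> Y \<Longrightarrow> P \<tau>"
proof -
  obtain Y where Y: "\<And>\<tau>. Im \<tau> \<ge> Y \<Longrightarrow> P \<tau>"
    using assms by (auto simp: eventually_filtercomap_at_top_linorder)
  show ?thesis by (rule that[of "max 1 Y"]) (auto intro: Y)
qed

lemma eventually_at_cuspI: "(\<And>\<tau>. Im \<tau> \<ge> Y \<Longrightarrow> P \<tau>) \<Longrightarrow> eventually P at_cusp"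
  by (auto simp: eventually_filtercomap_at_top_linorder)

lemma at_cusp_neq_bot [simp]: "at_cusp \<noteq> bot"
proof
  assume "at_cusp = bot"
  hence "eventually (\<lambda>_. False) at_cusp" by simp
  then obtain Y where Y: "\<And>\<tau>. Im \<tau> \<ge> Y \<Longrightarrow> False" by (rule eventually_at_cuspD) blast
  from Y[of "Complex 0 Y"] show False by simp
qed

text \<open>Decay at the cusp confines the large values of |f| to a truncated fundamental domain, so
  a nonzero f would attain its maximum. By the maximum principle it would be constant, against the
  decay. Jacobi's identity, the polynomials in j and the surjectivity of j all rest on this.\<close>

lemma modular_invariant_vanishing:
  assumes hol: "f holomorphic_on uhp" and inv: "modular_invariant f"
    and lim: "(f \<longlongrightarrow> 0) at_cusp" and \<tau>: "Im \<tau> > 0"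
  shows "f \<tau> = 0"
proof (rule ccontr)
  assume nz: "f \<tau> \<noteq> 0"
  have "eventually (\<lambda>z. norm (f z) < norm (f \<tau>)) at_cusp"
    using order_tendstoD(2)[OF tendsto_norm[OF lim], of "norm (f \<tau>)"] nz by simp
  then obtain Y where Y: "Y > 0" "\<And>z. Im z \<ge> Y \<Longrightarrow> norm (f z) < norm (f \<tau>)"
    by (rule eventually_at_cuspD) blast
  define K where "K = {\<tau>. \<bar>Re \<tau>\<bar> \<le> 1/2 \<and> 1/2 \<le> Im \<tau> \<and> Im \<tau> \<le> Y}"
  have K: "compact K" unfolding K_def by (rule compact_truncated_domain)
  have red: "\<exists>z'\<in>K. f z' = f z" if z: "Im z > 0" "norm (f z) \<ge> norm (f \<tau>)" for z
  proof -
    obtain z' where z': "modular_equiv z z'" "\<bar>Re z'\<bar> \<le> 1/2" "norm z' \<ge> 1"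
      using modular_reduction[OF z(1)] .
    have "Im z' > 0" by (rule modular_equiv_Im_pos[OF z'(1) z(1)])
    hence "Im z' \<ge> 1/2" using z' by (intro fundamental_domain_Im)
    moreover have fz: "f z' = f z" by (rule modular_invariant_equiv[OF inv z'(1) z(1)])
    moreover have "Im z' \<le> Y" using Y(2)[of z'] z(2) fz by force
    ultimately show ?thesis using z' by (auto simp: K_def)
  qed
  have "K \<noteq> {}" using red[OF \<tau>] by auto
  moreover have "K \<subseteq> uhp" by (auto simp: K_def)
  moreover have "continuous_on K (\<lambda>z. norm (f z))"
    using continuous_on_subset[OF holomorphic_on_imp_continuous_on[OF hol]] \<open>K \<subseteq> uhp\<close>
    by (intro continuous_intros)
  ultimately obtain m where m: "m \<in> K" "\<And>z. z \<in> K \<Longrightarrow> norm (f z) \<le> norm (f m)"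
    using continuous_attains_sup[OF K, of "\<lambda>z. norm (f z)"] by blast
  have m1: "norm (f \<tau>) \<le> norm (f m)" using red[OF \<tau>] m(2) by force
  have max: "norm (f z) \<le> norm (f m)" if "Im z > 0" for z
    using red[OF that] m(2) m1 by force
  have "f constant_on uhp"
    using max m(1) \<open>K \<subseteq> uhp\<close>
    by (intro maximum_modulus_principle[OF hol open_uhp connected_uhp open_uhp, of m]) auto
  then obtain c where c: "\<And>z. Im z > 0 \<Longrightarrow> f z = c" by (auto simp: constant_on_def)
  have "norm (f (Complex 0 Y)) < norm (f \<tau>)" using Y by simp
  thus False using c \<tau> Y(1) by simp
qed

section \<open>Lambda and its complement as products in the nome\<close>

definition lambda_disc :: "complex \<Rightarrow> complex" where
  "lambda_disc t = 16 * t * (qprod (t\<^sup>2) (t\<^sup>2) / qprod t (t\<^sup>2)) ^ 8"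

text \<open>In theta constants \<open>lambda_disc\<close> is theta_2^4 / theta_3^4 and this is
  theta_4^4 / theta_3^4, the product for 1 - lambda. That the two add up to 1 is proved
  below.\<close>

definition colambda_disc :: "complex \<Rightarrow> complex" where
  "colambda_disc t = (qprod (-t) (t\<^sup>2) / qprod t (t\<^sup>2)) ^ 8"

lemma disc_sq: "norm (t::complex) < 1 \<Longrightarrow> norm (t\<^sup>2) < 1"
  by (simp add: norm_power power_less_one_iff)

lemma qprod_disc_nonzero:
  assumes "norm t < 1"
  shows "qprod t (t\<^sup>2) \<noteq> 0" "qprod (-t) (t\<^sup>2) \<noteq> 0" "qprod (t\<^sup>2) (t\<^sup>2) \<noteq> 0"
proof -
  have *: "x * (t\<^sup>2) ^ n \<noteq> -1" if "norm x < 1" for x n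
  proof
    assume "x * (t\<^sup>2) ^ n = -1"
    hence "norm x * norm (t\<^sup>2) ^ n = 1" by (metis norm_minus_cancel norm_mult norm_one norm_power)
    moreover have "norm x * norm (t\<^sup>2) ^ n \<le> norm x * 1"
      using disc_sq[OF assms] by (intro mult_left_mono power_le_one) auto
    ultimately show False using that by simp
  qed
  show "qprod t (t\<^sup>2) \<noteq> 0" "qprod (-t) (t\<^sup>2) \<noteq> 0" "qprod (t\<^sup>2) (t\<^sup>2) \<noteq> 0"
    using *[of t] *[of "-t"] *[of "t\<^sup>2"] assms disc_sq[OF assms] by (auto simp: qprod_eq_0_iff)
qed

lemma elliptic_lambda_nome:
  assumes "Im \<tau> > 0"
  shows "elliptic_lambda \<tau> = lambda_disc (nome \<tau>)"
proof -
  define t where "t = nome \<tau>"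
  have t: "norm t < 1" using assms by (simp add: t_def)
  have q: "qpow (real n / 2) \<tau> = t ^ n" for n
    unfolding qpow_def t_def nome_def exp_of_nat_mult[symmetric] by (simp add: mult_ac)
  have q1: "qpow (1/2) \<tau> = t" using q[of 1] by simp
  have q2: "qpow (real (Suc n)) \<tau> = t\<^sup>2 * (t\<^sup>2) ^ n" for n
  proof -
    have "real (Suc n) = real (2 * Suc n) / 2" by simp
    moreover have "t ^ (2 * Suc n) = t\<^sup>2 * (t\<^sup>2) ^ n"
      unfolding power_mult by simp
    ultimately show ?thesis using q[of "2 * Suc n"] by (simp only:)
  qed
  have q3: "qpow (real (Suc n) - 1/2) \<tau> = t * (t\<^sup>2) ^ n" for n
  proof -
    have "real (Suc n) - 1/2 = real (2 * n + 1) / 2" by (simp add: field_simps)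
    moreover have "t ^ (2 * n + 1) = t * (t\<^sup>2) ^ n"
      by (simp add: power_mult)
    ultimately show ?thesis using q[of "2 * n + 1"] by (simp only:)
  qed
  have c: "convergent_prod (\<lambda>n. 1 + x * (t\<^sup>2) ^ n)" for x
    by (rule qprod_convergent[OF disc_sq[OF t]])
  have "(\<Prod>n. (1 + t\<^sup>2 * (t\<^sup>2) ^ n) ^ 8 / (1 + t * (t\<^sup>2) ^ n) ^ 8) =
      (\<Prod>n. ((1 + t\<^sup>2 * (t\<^sup>2) ^ n) / (1 + t * (t\<^sup>2) ^ n)) ^ 8)"
    by (simp add: power_divide)
  also have "\<dots> = (\<Prod>n. (1 + t\<^sup>2 * (t\<^sup>2) ^ n) / (1 + t * (t\<^sup>2) ^ n)) ^ 8"
    by (intro prodinf_power convergent_prod_divide c)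
  also have "(\<Prod>n. (1 + t\<^sup>2 * (t\<^sup>2) ^ n) / (1 + t * (t\<^sup>2) ^ n)) = qprod (t\<^sup>2) (t\<^sup>2) / qprod t (t\<^sup>2)"
    unfolding qprod_def by (intro prodinf_divide[symmetric] c)
  finally show ?thesis
    unfolding elliptic_lambda_def q1 q2 q3 lambda_disc_def t_def[symmetric] by simp
qed

definition mod_lambda :: "complex \<Rightarrow> complex" where "mod_lambda \<tau> = lambda_disc (nome \<tau>)"
definition mod_colambda :: "complex \<Rightarrow> complex" where "mod_colambda \<tau> = colambda_disc (nome \<tau>)"

lemma nome_plus_1: "nome (\<tau> + 1) = - nome \<tau>"
  by (simp add: nome_def ring_distribs exp_add)

lemma mod_lambda_nonzero: "Im \<tau> > 0 \<Longrightarrow> mod_lambda \<tau> \<noteq> 0"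
  by (simp add: mod_lambda_def lambda_disc_def qprod_disc_nonzero)

lemma mod_colambda_nonzero: "Im \<tau> > 0 \<Longrightarrow> mod_colambda \<tau> \<noteq> 0"
  by (simp add: mod_colambda_def colambda_disc_def qprod_disc_nonzero)

text \<open>The translation changes the sign of the nome, which exchanges the products of theta_3
  and theta_4.\<close>

lemma mod_lambda_plus_1:
  assumes "Im \<tau> > 0"
  shows "mod_lambda (\<tau> + 1) = - mod_lambda \<tau> / mod_colambda \<tau>"
    and "mod_colambda (\<tau> + 1) = 1 / mod_colambda \<tau>"
  using qprod_disc_nonzero[of "nome \<tau>"] assms
  unfolding mod_lambda_def mod_colambda_def lambda_disc_def colambda_disc_def nome_plus_1
  by (simp_all add: power_divide)

text \<open>Theta inversion at z = 0 and at z = 1/2; the unknown constant drops out of the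
  quotient.\<close>

lemma mod_lambda_inversion:
  assumes \<tau>: "Im \<tau> > 0"
  shows "mod_lambda (-1/\<tau>) = mod_colambda \<tau>"
proof -
  have [simp]: "\<tau> \<noteq> 0" using \<tau> by auto
  define \<tau>' where "\<tau>' = -1/\<tau>"
  have \<tau>': "Im \<tau>' > 0" unfolding \<tau>'_def by (rule Im_minus_inverse_pos[OF \<tau>])
  define t t' where "t = nome \<tau>" and "t' = nome \<tau>'"
  have t: "norm t < 1" "norm t' < 1" using \<tau> \<tau>' by (simp_all add: t_def t'_def)
  have [simp]: "t' \<noteq> 0" by (simp add: t'_def)
  obtain C where C: "\<And>z. exp (- (pi * \<i> * z\<^sup>2 / \<tau>)) * theta_prod \<tau>' (z / \<tau>) = C * theta_prod \<tau> z"
    using theta_prod_inversion[OF \<tau>] unfolding \<tau>'_def by blast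
  have 0: "qprod t' (t'\<^sup>2) ^ 2 = C * qprod t (t\<^sup>2) ^ 2"
    using C[of 0] by (simp add: theta_prod_def t_def t'_def power2_eq_square)
  \<comment> \<open>A fourth root of the nome of -1/tau, which turns into the leading factor of
    lambda in the fourth power below.\<close>
  define e where "e = exp (- (pi * \<i> * (1/2)\<^sup>2 / \<tau>))"
  have e4: "e ^ 4 = t'"
    unfolding e_def t'_def nome_def \<tau>'_def exp_of_nat_mult[symmetric]
    by (simp add: power2_eq_square field_simps)
  have w1: "exp (2 * pi * \<i> * (1/2)) = -1" by simp
  have w2: "exp (2 * pi * \<i> * (1/2 / \<tau>)) = 1 / t'"
  proof -
    have "2 * pi * \<i> * (1/2 / \<tau>) = - (pi * \<i> * \<tau>')" by (simp add: \<tau>'_def)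
    thus ?thesis by (simp only: t'_def nome_def exp_minus inverse_eq_divide)
  qed
  have "e * (qprod 1 (t'\<^sup>2) * qprod (t' * t') (t'\<^sup>2)) = C * (qprod (-t) (t\<^sup>2) * qprod (-t) (t\<^sup>2))"
    using C[of "1/2"] unfolding theta_prod_def t_def[symmetric] t'_def[symmetric] e_def[symmetric]
    unfolding exp_minus w1 w2 by simp
  \<comment> \<open>This product begins with 1 + 1. The factor 2 together with e^4 = t' accounts for
    16 t' in lambda.\<close>
  also have "qprod 1 (t'\<^sup>2) = 2 * qprod (t'\<^sup>2) (t'\<^sup>2)"
    using qprod_step[OF disc_sq[OF t(2)], of 1] by simp
  finally have 1: "2 * e * qprod (t'\<^sup>2) (t'\<^sup>2) ^ 2 = C * qprod (-t) (t\<^sup>2) ^ 2"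
    by (simp add: power2_eq_square mult_ac)
  note nz = qprod_disc_nonzero[OF t(1)] qprod_disc_nonzero[OF t(2)]
  have "C \<noteq> 0" using 0 nz by auto
  have "2 * e * (qprod (t'\<^sup>2) (t'\<^sup>2) / qprod t' (t'\<^sup>2)) ^ 2 = (qprod (-t) (t\<^sup>2) / qprod t (t\<^sup>2)) ^ 2"
    unfolding power_divide 0 times_divide_eq_right 1 using \<open>C \<noteq> 0\<close> by simp
  hence "(2 * e * (qprod (t'\<^sup>2) (t'\<^sup>2) / qprod t' (t'\<^sup>2)) ^ 2) ^ 4 = ((qprod (-t) (t\<^sup>2) / qprod t (t\<^sup>2)) ^ 2) ^ 4"
    by simp
  hence "16 * t' * (qprod (t'\<^sup>2) (t'\<^sup>2) / qprod t' (t'\<^sup>2)) ^ 8 = (qprod (-t) (t\<^sup>2) / qprod t (t\<^sup>2)) ^ 8"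
    by (simp add: power_mult_distrib e4 power_divide flip: power_mult)
  thus ?thesis
    by (simp add: mod_lambda_def mod_colambda_def lambda_disc_def colambda_disc_def t_def t'_def \<tau>'_def)
qed

lemma mod_colambda_inversion:
  assumes "Im \<tau> > 0"
  shows "mod_colambda (-1/\<tau>) = mod_lambda \<tau>"
  using mod_lambda_inversion[OF Im_minus_inverse_pos[OF assms]] by simp

lemma lambda_disc_holomorphic: "lambda_disc holomorphic_on ball 0 1" "colambda_disc holomorphic_on ball 0 1"
  unfolding lambda_disc_def colambda_disc_def
  by (intro holomorphic_intros; auto simp: qprod_disc_nonzero disc_sq)+

lemma nome_holomorphic [holomorphic_intros]:
  assumes "f holomorphic_on A"
  shows "(\<lambda>z. nome (f z)) holomorphic_on A"
  unfolding nome_def by (intro holomorphic_intros assms)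

lemma mod_lambda_holomorphic: "mod_lambda holomorphic_on uhp" "mod_colambda holomorphic_on uhp"
proof -
  have "lambda_disc \<circ> nome holomorphic_on uhp" "colambda_disc \<circ> nome holomorphic_on uhp"
    by (rule holomorphic_on_compose_gen[OF _ lambda_disc_holomorphic(1)]
        holomorphic_on_compose_gen[OF _ lambda_disc_holomorphic(2)]; auto intro!: holomorphic_intros)+
  thus "mod_lambda holomorphic_on uhp" "mod_colambda holomorphic_on uhp"
    by (simp_all add: mod_lambda_def[abs_def] mod_colambda_def[abs_def] o_def)
qed

lemma filterlim_nome_cusp: "filterlim nome (at 0) at_cusp"
proof -
  have "((\<lambda>\<tau>. exp (- pi * Im \<tau>)) \<longlongrightarrow> 0) at_cusp"
  proof -
    have "((\<lambda>y. exp (- pi * y)) \<longlongrightarrow> 0) at_top" by real_asymp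
    thus ?thesis by (rule filterlim_compose) (rule filterlim_filtercomap)
  qed
  hence "(nome \<longlongrightarrow> 0) at_cusp"
    unfolding norm_nome[symmetric] by (rule tendsto_norm_zero_cancel)
  thus ?thesis by (auto simp: filterlim_at)
qed

text \<open>Jacobi's identity: \<open>(1 - \<lambda> - \<lambda>')\<^sup>3 / (\<lambda> \<lambda>')\<close> is modular invariant and vanishes at the cusp.\<close>

lemma mod_lambda_add_colambda:
  assumes \<tau>: "Im \<tau> > 0"
  shows "mod_lambda \<tau> + mod_colambda \<tau> = 1"
proof -
  \<comment> \<open>The exponents balance under the translation: 1 - lambda - lambda' picks up the
    factor -1/lambda', and lambda lambda' the factor -1/lambda'^3.\<close>
  define W where "W = (\<lambda>\<tau>. (1 - mod_lambda \<tau> - mod_colambda \<tau>) ^ 3 / (mod_lambda \<tau> * mod_colambda \<tau>))"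
  have "W holomorphic_on uhp"
    unfolding W_def by (intro holomorphic_intros mod_lambda_holomorphic)
      (auto simp: mod_lambda_nonzero mod_colambda_nonzero)
  moreover have "modular_invariant W"
    unfolding modular_invariant_def
  proof (intro allI impI conjI)
    fix \<tau> assume \<tau>: "Im \<tau> > 0"
    define a b where "a = mod_lambda \<tau>" and "b = mod_colambda \<tau>"
    have nz: "a \<noteq> 0" "b \<noteq> 0" using \<tau> by (simp_all add: a_def b_def mod_lambda_nonzero mod_colambda_nonzero)
    have "1 - (-a/b) - 1/b = (a + b - 1) / b" using nz by (simp add: field_simps)
    hence "W (\<tau> + 1) = ((a + b - 1) / b) ^ 3 / ((-a/b) * (1/b))"
      using mod_lambda_plus_1[OF \<tau>] by (simp add: W_def a_def b_def)
    also have "\<dots> = - ((a + b - 1) ^ 3) / (a * b)"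
      using nz by (simp add: power_divide divide_simps) (simp add: power3_eq_cube algebra_simps)
    also have "- ((a + b - 1) ^ 3) = (1 - a - b) ^ 3"
      by (simp add: power3_eq_cube algebra_simps)
    finally show "W (\<tau> + 1) = W \<tau>" by (simp add: W_def a_def b_def)
    show "W (-1/\<tau>) = W \<tau>"
      using mod_lambda_inversion[OF \<tau>] mod_colambda_inversion[OF \<tau>] by (simp add: W_def algebra_simps)
  qed
  moreover have "(W \<longlongrightarrow> 0) at_cusp"
  proof -
    define u where "u = (\<lambda>t. 16 * (qprod (t\<^sup>2) (t\<^sup>2) / qprod t (t\<^sup>2)) ^ 8)"
    define D where "D = (\<lambda>t. 1 - lambda_disc t - colambda_disc t)"
    have hD: "D holomorphic_on ball 0 1"
      unfolding D_def by (intro holomorphic_intros lambda_disc_holomorphic)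
    have hu: "u holomorphic_on ball 0 1"
      unfolding u_def by (intro holomorphic_intros) (auto simp: qprod_disc_nonzero disc_sq)
    have q0: "qprod 0 0 = 1" by (simp add: qprod_def)
    have D0: "D 0 = 0" "u 0 = 16" "colambda_disc 0 = 1"
      by (simp_all add: D_def u_def lambda_disc_def colambda_disc_def q0)
    have cont: "isCont f 0" if "f holomorphic_on ball 0 1" for f :: "complex \<Rightarrow> complex"
      using holomorphic_on_imp_continuous_on[OF that] by (simp add: continuous_on_eq_continuous_at)
    have "(D has_field_derivative deriv D 0) (at 0)"
      by (rule holomorphic_derivI[OF hD]) auto
    hence d: "(\<lambda>t. D t / t) \<midarrow>0\<rightarrow> deriv D 0" by (simp add: has_field_derivative_iff D0)
    \<comment> \<open>\<open>D\<close> vanishes at 0 and lambda has only a simple zero there, so two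
      factors \<open>D\<close> are left over and force the limit 0.\<close>
    have "(\<lambda>t. (D t / t) * D t ^ 2 / (u t * colambda_disc t)) \<midarrow>0\<rightarrow> deriv D 0 * D 0 ^ 2 / (u 0 * colambda_disc 0)"
      using cont[OF hD] cont[OF hu] cont[OF lambda_disc_holomorphic(2)]
      by (intro tendsto_intros d) (auto simp: isCont_def D0)
    from filterlim_compose[OF this filterlim_nome_cusp]
    have "((\<lambda>\<tau>. (D (nome \<tau>) / nome \<tau>) * D (nome \<tau>) ^ 2 / (u (nome \<tau>) * colambda_disc (nome \<tau>))) \<longlongrightarrow> 0) at_cusp"
      by (simp add: D0)
    also have "(\<lambda>\<tau>. (D (nome \<tau>) / nome \<tau>) * D (nome \<tau>) ^ 2 / (u (nome \<tau>) * colambda_disc (nome \<tau>))) = W"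
      by (auto simp: W_def D_def u_def mod_lambda_def mod_colambda_def lambda_disc_def fun_eq_iff
          power3_eq_cube power2_eq_square mult_ac)
    finally show ?thesis .
  qed
  ultimately have "W \<tau> = 0" using \<tau> by (intro modular_invariant_vanishing)
  thus ?thesis
    using \<tau> by (simp add: W_def mod_lambda_nonzero mod_colambda_nonzero algebra_simps)
qed

section \<open>Integral q-expansions and the j-invariant\<close>

definition int_fps :: "complex fps \<Rightarrow> bool" where
  "int_fps F \<longleftrightarrow> (\<forall>n. fps_nth F n \<in> \<int>)"

lemma int_fps_const: "c \<in> \<int> \<Longrightarrow> int_fps (fps_const c)"
  by (auto simp: int_fps_def)

lemma int_fps_X: "int_fps fps_X"
  by (auto simp: int_fps_def fps_X_def)

lemma int_fps_1: "int_fps 1"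
  by (auto simp: int_fps_def)

lemma int_fps_add: "int_fps F \<Longrightarrow> int_fps G \<Longrightarrow> int_fps (F + G)"
  by (auto simp: int_fps_def)

lemma int_fps_diff: "int_fps F \<Longrightarrow> int_fps G \<Longrightarrow> int_fps (F - G)"
  by (auto simp: int_fps_def)

lemma int_fps_mult: "int_fps F \<Longrightarrow> int_fps G \<Longrightarrow> int_fps (F * G)"
  by (auto simp: int_fps_def fps_mult_nth intro!: Ints_sum Ints_mult)

lemma int_fps_power: "int_fps F \<Longrightarrow> int_fps (F ^ n)"
  by (induction n) (auto intro: int_fps_mult int_fps_1)

lemma int_fps_inverse:
  assumes F: "int_fps F" "fps_nth F 0 = 1"
  shows "int_fps (inverse F)"
proof -
  have "fps_nth (inverse F) n \<in> \<int>" for n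
  proof (induction n rule: less_induct)
    case (less n)
    show ?case
    proof (cases "n = 0")
      case False
      have "F * inverse F = 1" using F by (intro inverse_mult_eq_1') auto
      hence "(\<Sum>i=0..n. fps_nth F i * fps_nth (inverse F) (n - i)) = 0"
        using False by (metis fps_mult_nth fps_one_nth)
      hence "fps_nth (inverse F) n = - (\<Sum>i=1..n. fps_nth F i * fps_nth (inverse F) (n - i))"
        using F by (subst (asm) sum.atLeast_Suc_atMost) (auto simp: add_eq_0_iff)
      also have "\<dots> \<in> \<int>"
        using F less by (intro Ints_minus Ints_sum Ints_mult) (auto simp: int_fps_def)
      finally show ?thesis .
    qed (use F in auto)
  qed
  thus ?thesis by (auto simp: int_fps_def)
qed

text \<open>Integrality of q-expansions is handled through functions on the disc. The class is
  closed under ring operations, inverses with constant term 1 and locally uniform limits, so no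
  coefficient has to be computed.\<close>

definition int_hol :: "(complex \<Rightarrow> complex) \<Rightarrow> bool" where
  "int_hol f \<longleftrightarrow> f holomorphic_on ball 0 1 \<and> (\<exists>F. f has_fps_expansion F \<and> int_fps F)"

lemma int_hol_holomorphic: "int_hol f \<Longrightarrow> f holomorphic_on ball 0 1"
  by (simp add: int_hol_def)

lemma disc_has_fps_expansion:
  "f holomorphic_on ball 0 1 \<Longrightarrow> f has_fps_expansion fps_expansion f 0"
  by (rule has_fps_expansion_fps_expansion[of "ball 0 1"]) auto

lemma int_hol_at_0: "int_hol f \<Longrightarrow> f 0 \<in> \<int>"
  unfolding int_hol_def int_fps_def
  using has_fps_expansion_imp_0_eq_fps_nth_0 by metis

lemma int_hol_const: "c \<in> \<int> \<Longrightarrow> int_hol (\<lambda>_. c)"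
  unfolding int_hol_def by (auto intro!: exI[of _ "fps_const c"] int_fps_const)

lemma int_hol_id: "int_hol (\<lambda>z. z)"
  unfolding int_hol_def by (auto intro!: exI[of _ fps_X] int_fps_X fps_expansion_intros)

lemma int_hol_add: "int_hol f \<Longrightarrow> int_hol g \<Longrightarrow> int_hol (\<lambda>z. f z + g z)"
  unfolding int_hol_def by (blast intro: holomorphic_intros fps_expansion_intros int_fps_add)

lemma int_hol_diff: "int_hol f \<Longrightarrow> int_hol g \<Longrightarrow> int_hol (\<lambda>z. f z - g z)"
  unfolding int_hol_def by (blast intro: holomorphic_intros fps_expansion_intros int_fps_diff)

lemma int_hol_minus: "int_hol f \<Longrightarrow> int_hol (\<lambda>z. - f z)"
  using int_hol_diff[OF int_hol_const[of 0]] by simp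

lemma int_hol_mult: "int_hol f \<Longrightarrow> int_hol g \<Longrightarrow> int_hol (\<lambda>z. f z * g z)"
  unfolding int_hol_def by (blast intro: holomorphic_intros fps_expansion_intros int_fps_mult)

lemma int_hol_power: "int_hol f \<Longrightarrow> int_hol (\<lambda>z. f z ^ n)"
  unfolding int_hol_def by (blast intro: holomorphic_intros fps_expansion_intros int_fps_power)

lemma int_hol_prod: "(\<And>x. x \<in> A \<Longrightarrow> int_hol (f x)) \<Longrightarrow> int_hol (\<lambda>z. \<Prod>x\<in>A. f x z)"
  by (induction A rule: infinite_finite_induct) (auto intro!: int_hol_mult int_hol_const)

lemma int_hol_inverse:
  assumes "int_hol f" "f 0 = 1" "\<And>z. norm z < 1 \<Longrightarrow> f z \<noteq> 0"
  shows "int_hol (\<lambda>z. inverse (f z))"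
proof -
  obtain F where F: "f has_fps_expansion F" "int_fps F"
    using assms(1) by (auto simp: int_hol_def)
  have F0: "fps_nth F 0 = 1" using has_fps_expansion_imp_0_eq_fps_nth_0[OF F(1)] assms(2) by simp
  have "(\<lambda>z. inverse (f z)) has_fps_expansion inverse F"
    by (intro fps_expansion_intros F) (simp add: F0)
  moreover have "(\<lambda>z. inverse (f z)) holomorphic_on ball 0 1"
    using assms by (intro holomorphic_intros int_hol_holomorphic) auto
  ultimately show ?thesis using int_fps_inverse[OF F(2) F0] by (auto simp: int_hol_def)
qed

text \<open>The step that lowers the order of a pole at the cusp by one while keeping
  integrality.\<close>

lemma int_hol_divide_X:
  assumes "int_hol G" "G 0 = 0"
  obtains H where "int_hol H" "\<And>q. G q = q * H q"
proof -
  define H where "H = (\<lambda>q. if q = 0 then deriv G 0 else (G q - G 0) / (q - 0))"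
  have hol: "H holomorphic_on ball 0 1"
    unfolding H_def using assms by (intro pole_lemma_open int_hol_holomorphic) auto
  have eq: "G q = q * H q" for q
    using assms(2) by (simp add: H_def)
  obtain F where F: "G has_fps_expansion F" "int_fps F"
    using assms(1) by (auto simp: int_hol_def)
  have HF: "H has_fps_expansion fps_expansion H 0"
    by (rule disc_has_fps_expansion[OF hol])
  have "(\<lambda>q. q * H q) has_fps_expansion fps_X * fps_expansion H 0"
    by (intro fps_expansion_intros HF)
  hence "F = fps_X * fps_expansion H 0"
    using F(1) fps_expansion_unique_complex[of G] unfolding eq[abs_def, symmetric] by blast
  hence "fps_nth (fps_expansion H 0) n = fps_nth F (Suc n)" for n
    by simp
  hence "int_fps (fps_expansion H 0)"
    using F(2) by (auto simp: int_fps_def)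
  with hol HF have "int_hol H" by (auto simp: int_hol_def)
  thus ?thesis using eq by (rule that)
qed

lemma fps_compose_X_power_nth:
  fixes F :: "complex fps"
  assumes "m > 0"
  shows "fps_nth (fps_compose F (fps_X ^ m)) k = (if m dvd k then fps_nth F (k div m) else 0)"
proof -
  have "fps_nth (fps_compose F (fps_X ^ m)) k = (\<Sum>i=0..k. if m * i = k then fps_nth F i else 0)"
    by (simp add: fps_compose_nth power_mult[symmetric] if_distrib cong: if_cong) (metis (no_types, lifting))
  also have "\<dots> = (if m dvd k then fps_nth F (k div m) else 0)"
  proof (cases "m dvd k")
    case True
    then obtain j where "k = m * j" by blast
    moreover have "j \<le> k" using assms calculation by simp
    ultimately show ?thesis using assms by (simp add: sum.delta)
  next
    case False
    thus ?thesis by (auto intro!: sum.neutral)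
  qed
  finally show ?thesis .
qed

lemma has_fps_expansion_compose_power:
  fixes f :: "complex \<Rightarrow> complex"
  assumes "f has_fps_expansion F" "m > 0"
  shows "(\<lambda>s. f (s ^ m)) has_fps_expansion fps_compose F (fps_X ^ m)"
proof -
  have "(f \<circ> (\<lambda>s. s ^ m)) has_fps_expansion fps_compose F (fps_X ^ m)"
    using assms by (intro has_fps_expansion_compose fps_expansion_intros) auto
  thus ?thesis by (simp add: o_def)
qed

lemma norm_power_less_1: "norm (s::complex) < 1 \<Longrightarrow> m > 0 \<Longrightarrow> norm (s ^ m) < 1"
  by (simp add: norm_power power_less_one_iff)

lemma int_hol_compose_power:
  assumes "int_hol f" "m > 0"
  shows "int_hol (\<lambda>s. f (s ^ m))"
proof -
  obtain F where F: "f has_fps_expansion F" "int_fps F"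
    using assms(1) by (auto simp: int_hol_def)
  have "f \<circ> (\<lambda>s. s ^ m) holomorphic_on ball 0 1"
    using assms by (intro holomorphic_on_compose_gen[OF _ int_hol_holomorphic[OF assms(1)]] holomorphic_intros)
      (auto intro: norm_power_less_1)
  moreover have "int_fps (fps_compose F (fps_X ^ m))"
    using F(2) assms(2) by (auto simp: int_fps_def fps_compose_X_power_nth)
  ultimately show ?thesis
    using has_fps_expansion_compose_power[OF F(1) assms(2)] by (auto simp: int_hol_def o_def)
qed

text \<open>The coefficients of G are those of f at the multiples of m. The hypothesis leaves out s
  = 0, where the equality is recovered by continuity.\<close>

lemma int_hol_from_power:
  assumes G: "G holomorphic_on ball 0 1" and m: "m > 0"
    and f: "int_hol f" "\<And>s. norm s < 1 \<Longrightarrow> s \<noteq> 0 \<Longrightarrow> f s = G (s ^ m)"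
  shows "int_hol G"
proof -
  define F where "F = fps_expansion G 0"
  have F: "G has_fps_expansion F"
    unfolding F_def by (rule disc_has_fps_expansion[OF G])
  obtain F' where F': "f has_fps_expansion F'" "int_fps F'"
    using f(1) by (auto simp: int_hol_def)
  have c1: "isCont f 0" "isCont (\<lambda>s. G (s ^ m)) 0"
    using has_fps_expansion_imp_continuous[OF F'(1)]
      has_fps_expansion_imp_continuous[OF has_fps_expansion_compose_power[OF F m]] by auto
  have ev: "eventually (\<lambda>s. f s = G (s ^ m)) (at 0)"
    using f(2) by (auto simp: eventually_at intro!: exI[of _ 1])
  have "(f \<longlongrightarrow> G (0 ^ m)) (at 0)"
    using c1(2) tendsto_cong[OF ev] by (simp add: isCont_def)
  hence f0: "f 0 = G (0 ^ m)"
    using c1(1) unfolding isCont_def by (rule LIM_unique[rotated])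
  have "f has_fps_expansion fps_compose F (fps_X ^ m)"
  proof (subst has_fps_expansion_cong[OF _ refl])
    have "eventually (\<lambda>s. s \<in> ball 0 1) (nhds (0::complex))"
      by (intro eventually_nhds_in_open) auto
    thus "eventually (\<lambda>s. f s = G (s ^ m)) (nhds 0)"
      by eventually_elim (use f(2) f0 in \<open>metis dist_0_norm mem_ball\<close>)
  qed (rule has_fps_expansion_compose_power[OF F m])
  hence eq: "F' = fps_compose F (fps_X ^ m)"
    using F'(1) fps_expansion_unique_complex by blast
  have "fps_nth F n = fps_nth F' (m * n)" for n
    unfolding eq fps_compose_X_power_nth[OF m] using m by simp
  hence "int_fps F" using F'(2) by (auto simp: int_fps_def)
  thus ?thesis using F G by (auto simp: int_hol_def)
qed

text \<open>Taylor coefficients converge under locally uniform limits, and the integers form a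
  closed set.\<close>

lemma int_hol_uniform_limit:
  assumes f: "\<And>n. int_hol (f n)" and g: "g holomorphic_on ball 0 1"
    and lim: "uniform_limit (ball 0 (1/2)) f g sequentially"
  shows "int_hol g"
proof -
  have "fps_nth (fps_expansion g 0) k \<in> \<int>" for k
  proof -
    have "((\<lambda>n. (deriv ^^ k) (f n) 0) \<longlongrightarrow> (deriv ^^ k) g 0) sequentially"
    proof (rule higher_deriv_complex_uniform_limit[OF lim])
      show "eventually (\<lambda>n. f n holomorphic_on ball 0 (1/2)) sequentially"
        using f by (intro always_eventually allI holomorphic_on_subset[OF int_hol_holomorphic]) auto
    qed auto
    hence lim: "((\<lambda>n. (deriv ^^ k) (f n) 0 / fact k) \<longlongrightarrow> (deriv ^^ k) g 0 / fact k) sequentially"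
      by (intro tendsto_intros) auto
    have ints: "(deriv ^^ k) (f n) 0 / fact k \<in> \<int>" for n
    proof -
      obtain F where F: "f n has_fps_expansion F" "int_fps F"
        using f by (auto simp: int_hol_def)
      have eq: "fps_nth F k = (deriv ^^ k) (f n) 0 / fact k"
        using F(1) by (rule fps_nth_fps_expansion)
      show ?thesis using F(2) unfolding int_fps_def eq[symmetric] by blast
    qed
    have "(deriv ^^ k) g 0 / fact k \<in> \<int>"
      by (rule Lim_in_closed_set[OF closed_Ints always_eventually _ lim]) (use ints in blast, simp)
    thus ?thesis by (simp add: fps_expansion_def)
  qed
  thus ?thesis using g disc_has_fps_expansion[OF g] by (auto simp: int_hol_def int_fps_def)
qed

lemma int_hol_qprod:
  assumes "int_hol g" "int_hol h" "\<And>z. norm z < 1 \<Longrightarrow> norm (h z) < 1"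
  shows "int_hol (\<lambda>z. qprod (g z) (h z))"
proof (rule int_hol_uniform_limit)
  show "int_hol (\<lambda>z. \<Prod>n<N. 1 + g z * h z ^ n)" for N
    by (intro int_hol_prod int_hol_add int_hol_mult int_hol_power int_hol_const assms) auto
  show "(\<lambda>z. qprod (g z) (h z)) holomorphic_on ball 0 1"
    using assms by (intro holomorphic_intros int_hol_holomorphic) auto
  have "uniform_limit (cball 0 (1/2)) (\<lambda>N z. \<Prod>n<N. 1 + g z * h z ^ n) (\<lambda>z. qprod (g z) (h z)) sequentially"
    using assms
    by (intro qprod_uniform_limit holomorphic_on_imp_continuous_on
        holomorphic_on_subset[OF int_hol_holomorphic]) auto
  thus "uniform_limit (ball 0 (1/2)) (\<lambda>N z. \<Prod>n<N. 1 + g z * h z ^ n) (\<lambda>z. qprod (g z) (h z)) sequentially"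
    by (rule uniform_limit_on_subset) auto
qed

section \<open>The coordinate q at the cusp\<close>

definition qexp :: "complex \<Rightarrow> complex" where
  "qexp \<tau> = nome \<tau> ^ 2"

lemma qexp_exp: "qexp \<tau> = exp (2 * pi * \<i> * \<tau>)"
  by (simp add: qexp_def nome_def exp_double[symmetric] mult_ac)

lemma qexp_nonzero [simp]: "qexp \<tau> \<noteq> 0"
  by (simp add: qexp_def)

lemma norm_qexp_less_1 [simp]: "Im \<tau> > 0 \<Longrightarrow> norm (qexp \<tau>) < 1"
  by (simp add: qexp_def)

lemma qexp_plus_1: "qexp (\<tau> + 1) = qexp \<tau>"
  by (simp add: qexp_def nome_plus_1)

lemma filterlim_qexp_cusp: "filterlim qexp (at 0) at_cusp"
proof -
  have "((\<lambda>\<tau>. nome \<tau> ^ 2) \<longlongrightarrow> 0 ^ 2) at_cusp"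
    using filterlim_nome_cusp by (intro tendsto_intros) (auto simp: filterlim_at)
  thus ?thesis by (auto simp: filterlim_at qexp_def[abs_def])
qed

lemma qexp_holomorphic [holomorphic_intros]:
  "f holomorphic_on A \<Longrightarrow> (\<lambda>z. qexp (f z)) holomorphic_on A"
  unfolding qexp_def by (intro holomorphic_intros)

lemma nome_Ln: "t \<noteq> 0 \<Longrightarrow> nome (Ln t / (pi * \<i>)) = t"
  by (simp add: nome_def)

lemma Im_nome_Ln:
  assumes "t \<noteq> 0" "norm t < 1"
  shows "Im (Ln t / (pi * \<i>)) > 0"
proof -
  have "Im (Ln t / (pi * \<i>)) = - ln (norm t) / pi"
    using assms by (simp add: Im_divide power2_eq_square)
  moreover have "ln (norm t) < 0" using assms by simp
  ultimately show ?thesis by (simp add: divide_neg_pos)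
qed

text \<open>The function of q is defined through the principal logarithm. Periodicity makes it
  independent of the branch, and boundedness removes the singularity at q = 0.\<close>

lemma periodic_factors_qexp:
  assumes f: "f holomorphic_on uhp" "\<And>\<tau>. Im \<tau> > 0 \<Longrightarrow> f (\<tau> + 1) = f \<tau>"
    and bd: "eventually (\<lambda>\<tau>. norm (f \<tau>) \<le> M) at_cusp"
  obtains G where "G holomorphic_on ball 0 1" "\<And>\<tau>. Im \<tau> > 0 \<Longrightarrow> f \<tau> = G (qexp \<tau>)"
proof -
  define g where "g = (\<lambda>z. f (Ln z / (2 * pi * \<i>)))"
  have Im_pos: "Im (w / (2 * pi * \<i>)) > 0" if "norm (exp w) < 1" for w
  proof -
    have "Re w < 0" using that by simp
    thus ?thesis by (simp add: Im_divide power2_eq_square divide_simps)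
  qed
  have gexp: "g (exp w) = f (w / (2 * pi * \<i>))" if "norm (exp w) < 1" for w
  proof -
    have "exp (Ln (exp w)) = exp w" by simp
    from iffD1[OF exp_eq this] obtain n :: int where "Ln (exp w) = w + 2 * of_int n * pi * \<i>"
      by (auto simp: mult_ac)
    hence "Ln (exp w) / (2 * pi * \<i>) = w / (2 * pi * \<i>) + of_int n"
      by (simp add: field_simps)
    thus ?thesis
      unfolding g_def using periodic_shift_int[where f = f, OF f(2) Im_pos[OF that]] by simp
  qed
  have gq: "g (qexp \<tau>) = f \<tau>" if "Im \<tau> > 0" for \<tau>
    using gexp[of "2 * pi * \<i> * \<tau>"] that norm_qexp_less_1[OF that] by (simp add: qexp_exp)
  have "g analytic_on {z0}" if z0: "z0 \<in> ball 0 1 - {0}" for z0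
  proof -
    \<comment> \<open>On this half disc around \<open>z0\<close> the branch Ln (z / z0) + Ln z0 is
      holomorphic, also across the cut of the principal logarithm.\<close>
    define A where "A = {z. norm z < 1} \<inter> {z. Re (z / z0) > 0}"
    have "open A" unfolding A_def
      by (intro open_Int open_Collect_less continuous_intros) (use z0 in auto)
    moreover have "z0 \<in> A" using z0 by (auto simp: A_def)
    moreover have "g holomorphic_on A"
    proof -
      have Lnz: "exp (Ln (z / z0) + Ln z0) = z" if "z \<in> A" for z
      proof -
        have "z / z0 \<noteq> 0" using that by (auto simp: A_def)
        thus ?thesis using z0 by (simp add: exp_add)
      qed
      have "f \<circ> (\<lambda>z. (Ln (z / z0) + Ln z0) / (2 * pi * \<i>)) holomorphic_on A"
      proof (rule holomorphic_on_compose_gen[OF _ f(1)])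
        show "(\<lambda>z. (Ln (z / z0) + Ln z0) / (2 * pi * \<i>)) holomorphic_on A"
          using z0 by (intro holomorphic_intros) (auto simp: A_def complex_nonpos_Reals_iff)
        show "(\<lambda>z. (Ln (z / z0) + Ln z0) / (2 * pi * \<i>)) ` A \<subseteq> uhp"
        proof (intro image_subsetI CollectI Im_pos)
          fix z assume "z \<in> A"
          thus "norm (exp (Ln (z / z0) + Ln z0)) < 1" using Lnz by (simp add: A_def)
        qed
      qed
      also have "?this \<longleftrightarrow> g holomorphic_on A"
      proof (rule holomorphic_cong[OF refl])
        fix z assume "z \<in> A"
        thus "(f \<circ> (\<lambda>z. (Ln (z / z0) + Ln z0) / (2 * pi * \<i>))) z = g z"
          using gexp[of "Ln (z / z0) + Ln z0"] Lnz[of z] by (simp add: A_def)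
      qed
      finally show ?thesis .
    qed
    ultimately show ?thesis by (auto simp: analytic_at)
  qed
  hence hol: "g holomorphic_on ball 0 1 - {0}"
    by (meson analytic_imp_holomorphic analytic_on_analytic_at)
  have "eventually (\<lambda>z. norm (g z) \<le> M) (at 0)"
  proof -
    obtain Y where Y: "Y > 0" "\<And>\<tau>. Im \<tau> \<ge> Y \<Longrightarrow> norm (f \<tau>) \<le> M"
      using eventually_at_cuspD[OF bd] by blast
    have "norm (g z) \<le> M" if z: "z \<noteq> 0" "norm z < exp (- (2 * pi * Y))" for z
    proof -
      have "Re (Ln z) < - (2 * pi * Y)" using z by (metis Re_Ln exp_less_cancel_iff exp_ln zero_less_norm_iff)
      hence "Im (Ln z / (2 * pi * \<i>)) \<ge> Y"
        by (simp add: Im_divide power2_eq_square field_simps)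
      thus ?thesis unfolding g_def by (rule Y(2))
    qed
    thus ?thesis by (auto simp: eventually_at intro!: exI[of _ "exp (- (2 * pi * Y))"])
  qed
  then obtain G where G: "G holomorphic_on ball 0 1" "\<And>z. z \<in> ball 0 1 - {0} \<Longrightarrow> G z = g z"
    using holomorphic_on_extend_bounded[OF hol] by auto
  show ?thesis
    by (rule that[OF G(1)]) (use G(2) gq in auto)
qed

definition j_inv :: "complex \<Rightarrow> complex" where
  "j_inv \<tau> = 256 * (1 - mod_lambda \<tau> + mod_lambda \<tau> ^ 2) ^ 3 /
     (mod_lambda \<tau> ^ 2 * (1 - mod_lambda \<tau>) ^ 2)"

lemma one_minus_mod_lambda: "Im \<tau> > 0 \<Longrightarrow> 1 - mod_lambda \<tau> = mod_colambda \<tau>"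
  using mod_lambda_add_colambda[of \<tau>] by (simp add: algebra_simps)

lemma mod_lambda_neq_1: "Im \<tau> > 0 \<Longrightarrow> mod_lambda \<tau> \<noteq> 1"
  using one_minus_mod_lambda mod_colambda_nonzero by force

lemma j_inv_holomorphic: "j_inv holomorphic_on uhp"
  unfolding j_inv_def
  by (intro holomorphic_intros mod_lambda_holomorphic) (auto simp: mod_lambda_nonzero dest: mod_lambda_neq_1)

text \<open>S and T act on lambda by l -> 1 - l and l -> l / (l - 1). These generate the anharmonic
  group, of which this rational function is the invariant.\<close>

lemma modular_invariant_j_inv: "modular_invariant j_inv"
  unfolding modular_invariant_def
proof (intro allI impI conjI)
  fix \<tau> assume \<tau>: "Im \<tau> > 0"
  define l where "l = mod_lambda \<tau>"
  have nz: "l \<noteq> 0" "1 - l \<noteq> 0" using mod_lambda_nonzero[OF \<tau>] mod_lambda_neq_1[OF \<tau>] by (auto simp: l_def)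
  have 1: "mod_lambda (-1/\<tau>) = 1 - l"
    using mod_lambda_inversion[OF \<tau>] one_minus_mod_lambda[OF \<tau>] by (simp add: l_def)
  have "1 - (1 - l) + (1 - l)\<^sup>2 = 1 - l + l\<^sup>2" by (simp add: power2_eq_square algebra_simps)
  thus "j_inv (-1/\<tau>) = j_inv \<tau>" unfolding j_inv_def 1 l_def[symmetric] by (simp only: mult.commute diff_diff_eq2 add_diff_cancel_left')
  have 2: "mod_lambda (\<tau> + 1) = - l / (1 - l)"
    using mod_lambda_plus_1[OF \<tau>] one_minus_mod_lambda[OF \<tau>] by (simp add: l_def)
  have 3: "1 - (- l / (1 - l)) = 1 / (1 - l)" using nz by (simp add: field_simps)
  have 4: "1 / (1 - l) + (- l / (1 - l))\<^sup>2 = (1 - l + l\<^sup>2) / (1 - l)\<^sup>2"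
  proof -
    have "1 / m + (- l / m)\<^sup>2 = (m + l\<^sup>2) / m\<^sup>2" if "m \<noteq> 0" for m
      using that by (simp add: power_divide divide_simps power2_eq_square)
    thus ?thesis using nz by blast
  qed
  have "j_inv (\<tau> + 1) = 256 * ((1 - l + l\<^sup>2) / (1 - l)\<^sup>2) ^ 3 / ((- l / (1 - l))\<^sup>2 * (1 / (1 - l))\<^sup>2)"
    unfolding j_inv_def 2 3 4 ..
  also have "\<dots> = 256 * (1 - l + l\<^sup>2) ^ 3 / (l\<^sup>2 * (1 - l)\<^sup>2)"
  proof -
    have "256 * (A / m\<^sup>2) ^ 3 / ((- l / m)\<^sup>2 * (1 / m)\<^sup>2) = 256 * A ^ 3 / (l\<^sup>2 * m\<^sup>2)" if "m \<noteq> 0" for A m :: complex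
      using that nz(1) by (simp add: power_divide divide_simps flip: power_mult)
    thus ?thesis using nz by blast
  qed
  finally show "j_inv (\<tau> + 1) = j_inv \<tau>" by (simp add: j_inv_def l_def)
qed

lemma j_inv_plus_1: "Im \<tau> > 0 \<Longrightarrow> j_inv (\<tau> + 1) = j_inv \<tau>"
  and j_inv_minus_inverse: "Im \<tau> > 0 \<Longrightarrow> j_inv (-1/\<tau>) = j_inv \<tau>"
  using modular_invariant_j_inv by (simp_all add: modular_invariant_def)

text \<open>The factor 256 cancels against (16 t)^2 in the denominator, so q j is an integral series
  in the nome t. Since it is invariant under translation, it is one in q = t^2. The constant term 1
  is the usual normalisation of j.\<close>

lemma j_inv_q_expansion:
  "\<exists>K. int_hol K \<and> K 0 = 1 \<and> (\<forall>\<tau>. Im \<tau> > 0 \<longrightarrow> j_inv \<tau> * qexp \<tau> = K (qexp \<tau>))"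
proof -
  define u where "u = (\<lambda>t. (qprod (t\<^sup>2) (t\<^sup>2) * inverse (qprod t (t\<^sup>2))) ^ 8)"
  define L where "L = (\<lambda>t. (1 - 16 * t * u t + (16 * t * u t) ^ 2) ^ 3 * inverse (u t ^ 2 * (1 - 16 * t * u t) ^ 2))"
  have q0: "qprod 0 0 = 1" by (simp add: qprod_def)
  have u0: "u 0 = 1" by (simp add: u_def q0)
  have lam: "lambda_disc t = 16 * t * u t" for t
    by (simp add: lambda_disc_def u_def divide_inverse)
  have intu: "int_hol u"
    unfolding u_def
    by (intro int_hol_power int_hol_mult int_hol_inverse int_hol_qprod int_hol_id)
       (auto simp: q0 disc_sq qprod_disc_nonzero)
  \<comment> \<open>The fact that lambda omits 1, carried to the disc by a logarithm of t.\<close>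
  have lne: "16 * t * u t \<noteq> 1" if "norm t < 1" for t
  proof (cases "t = 0")
    case False
    have "mod_lambda (Ln t / (pi * \<i>)) \<noteq> 1"
      by (rule mod_lambda_neq_1[OF Im_nome_Ln[OF False that]])
    thus ?thesis using False by (simp add: mod_lambda_def nome_Ln lam)
  qed auto
  have unz: "u t \<noteq> 0" if "norm t < 1" for t
    using that by (simp add: u_def qprod_disc_nonzero)
  have intL: "int_hol L"
    unfolding L_def
    by (intro int_hol_power int_hol_mult int_hol_inverse int_hol_add int_hol_diff int_hol_const int_hol_id intu)
       (use lne unz in \<open>auto simp: u0\<close>)
  have L0: "L 0 = 1" by (simp add: L_def u0)
  have JL: "j_inv \<tau> * qexp \<tau> = L (nome \<tau>)" for \<tau>
  proof -
    have "256 * A / ((16 * t * v) ^ 2 * m) * t ^ 2 = A * inverse (v ^ 2 * m)" if "t \<noteq> 0" for A m t v :: complex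
      using that by (simp add: power_mult_distrib divide_simps)
    thus ?thesis unfolding j_inv_def L_def mod_lambda_def lam qexp_def by simp
  qed
  have contL: "isCont L 0"
    using holomorphic_on_imp_continuous_on[OF int_hol_holomorphic[OF intL]]
    by (simp add: continuous_on_eq_continuous_at)
  have "((\<lambda>\<tau>. L (nome \<tau>)) \<longlongrightarrow> L 0) at_cusp"
    by (rule filterlim_compose[OF _ filterlim_nome_cusp]) (use contL in \<open>simp add: isCont_def\<close>)
  hence "eventually (\<lambda>\<tau>. norm (L (nome \<tau>)) < 2) at_cusp"
    by (intro order_tendstoD(2)[OF tendsto_norm]) (auto simp: L0)
  hence "eventually (\<lambda>\<tau>. norm (j_inv \<tau> * qexp \<tau>) \<le> 2) at_cusp"
    by (auto simp: JL elim: eventually_mono)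
  moreover have "(\<lambda>\<tau>. j_inv \<tau> * qexp \<tau>) holomorphic_on uhp"
    by (intro holomorphic_intros j_inv_holomorphic)
  ultimately obtain K where K: "K holomorphic_on ball 0 1"
      "\<And>\<tau>. Im \<tau> > 0 \<Longrightarrow> j_inv \<tau> * qexp \<tau> = K (qexp \<tau>)"
    using periodic_factors_qexp[of "\<lambda>\<tau>. j_inv \<tau> * qexp \<tau>" 2] by (auto simp: j_inv_plus_1 qexp_plus_1)
  have "L t = K (t ^ 2)" if "norm t < 1" "t \<noteq> 0" for t
    using K(2)[OF Im_nome_Ln[OF that(2,1)]] that by (simp add: JL) (simp add: qexp_def nome_Ln)
  hence "int_hol K" by (intro int_hol_from_power[OF K(1) _ intL]) auto
  moreover have "K 0 = 1"
  proof -
    have "isCont K 0"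
      using holomorphic_on_imp_continuous_on[OF K(1)] by (simp add: continuous_on_eq_continuous_at)
    hence "((\<lambda>\<tau>. K (qexp \<tau>)) \<longlongrightarrow> K 0) at_cusp"
      by (intro filterlim_compose[OF _ filterlim_qexp_cusp]) (simp add: isCont_def)
    moreover have "eventually (\<lambda>\<tau>. L (nome \<tau>) = K (qexp \<tau>)) at_cusp"
      by (rule eventually_at_cuspI[of 1]) (use K(2) JL in auto)
    ultimately have "((\<lambda>\<tau>. L (nome \<tau>)) \<longlongrightarrow> K 0) at_cusp"
      by (simp cong: tendsto_cong)
    with \<open>((\<lambda>\<tau>. L (nome \<tau>)) \<longlongrightarrow> L 0) at_cusp\<close> show ?thesis
      using tendsto_unique[OF at_cusp_neq_bot] L0 by metis
  qed
  ultimately show ?thesis using K(2) by blast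
qed

text \<open>q j as a function of q on the unit disc, with the expansion 1 + 744 q + ... .\<close>

definition j_disc :: "complex \<Rightarrow> complex" where
  "j_disc = (SOME K. int_hol K \<and> K 0 = 1 \<and> (\<forall>\<tau>. Im \<tau> > 0 \<longrightarrow> j_inv \<tau> * qexp \<tau> = K (qexp \<tau>)))"

lemma int_hol_j_disc: "int_hol j_disc"
  and j_disc_0: "j_disc 0 = 1"
  and j_inv_qexp: "Im \<tau> > 0 \<Longrightarrow> j_inv \<tau> * qexp \<tau> = j_disc (qexp \<tau>)"
  using someI_ex[OF j_inv_q_expansion, folded j_disc_def] by blast+

lemma j_inv_eq: "Im \<tau> > 0 \<Longrightarrow> j_inv \<tau> = j_disc (qexp \<tau>) / qexp \<tau>"
  using j_inv_qexp[of \<tau>] by (simp add: field_simps)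

text \<open>Subtracting an integral multiple of a power of j lowers the pole at the cusp until a
  function that vanishes there remains. The top coefficient is recorded because it becomes the
  leading coefficient of the modular equation.\<close>

lemma modular_function_is_polynomial:
  assumes "f holomorphic_on uhp" "modular_invariant f" "int_hol G"
    and "\<And>\<tau>. Im \<tau> > 0 \<Longrightarrow> f \<tau> * qexp \<tau> ^ N = G (qexp \<tau>)"
  shows "\<exists>P. (\<forall>i. coeff P i \<in> \<int>) \<and> degree P \<le> N \<and> coeff P N = G 0 \<and>
     (\<forall>\<tau>. Im \<tau> > 0 \<longrightarrow> f \<tau> = poly P (j_inv \<tau>))"
  using assms
proof (induction N arbitrary: f G)
  case 0
  have "((\<lambda>\<tau>. G (qexp \<tau>) - G 0) \<longlongrightarrow> G 0 - G 0) at_cusp"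
  proof -
    have "isCont G 0"
      using holomorphic_on_imp_continuous_on[OF int_hol_holomorphic[OF 0(3)]]
      by (simp add: continuous_on_eq_continuous_at)
    hence "((\<lambda>\<tau>. G (qexp \<tau>)) \<longlongrightarrow> G 0) at_cusp"
      by (intro filterlim_compose[OF _ filterlim_qexp_cusp]) (simp add: isCont_def)
    thus ?thesis by (intro tendsto_intros)
  qed
  moreover have "eventually (\<lambda>\<tau>. G (qexp \<tau>) - G 0 = f \<tau> - G 0) at_cusp"
    using 0(4) by (intro eventually_at_cuspI[of 1]) auto
  ultimately have "((\<lambda>\<tau>. f \<tau> - G 0) \<longlongrightarrow> G 0 - G 0) at_cusp"
    by (rule Lim_transform_eventually)
  hence "((\<lambda>\<tau>. f \<tau> - G 0) \<longlongrightarrow> 0) at_cusp" by simp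
  moreover have "modular_invariant (\<lambda>\<tau>. f \<tau> - G 0)" "(\<lambda>\<tau>. f \<tau> - G 0) holomorphic_on uhp"
    using 0 by (auto simp: modular_invariant_def intro!: holomorphic_intros)
  ultimately have "f \<tau> - G 0 = 0" if "Im \<tau> > 0" for \<tau>
    using that modular_invariant_vanishing[of "\<lambda>\<tau>. f \<tau> - G 0" \<tau>] by blast
  hence "\<forall>\<tau>. Im \<tau> > 0 \<longrightarrow> f \<tau> = poly [:G 0:] (j_inv \<tau>)" by simp
  moreover have "\<forall>i. coeff [:G 0:] i \<in> \<int>"
    using int_hol_at_0[OF 0(3)] by (auto simp: coeff_pCons split: nat.splits)
  ultimately show ?case by (intro exI[of _ "[:G 0:]"]) auto
next
  case (Suc N)
  define c where "c = G 0"
  have c: "c \<in> \<int>" unfolding c_def by (rule int_hol_at_0[OF Suc.prems(3)])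
  \<comment> \<open>The expansion of f - c j^(N+1) multiplied by q^(N+1); the leading terms
    cancel.\<close>
  define G1 where "G1 = (\<lambda>q. G q - c * j_disc q ^ Suc N)"
  have "int_hol G1" unfolding G1_def
    by (intro int_hol_diff int_hol_mult int_hol_power int_hol_const int_hol_j_disc Suc.prems c)
  moreover have "G1 0 = 0" by (simp add: G1_def c_def j_disc_0)
  ultimately obtain H where H: "int_hol H" "\<And>q. G1 q = q * H q"
    using int_hol_divide_X by blast
  define f1 where "f1 = (\<lambda>\<tau>. f \<tau> - c * j_inv \<tau> ^ Suc N)"
  have "\<exists>P. (\<forall>i. coeff P i \<in> \<int>) \<and> degree P \<le> N \<and> coeff P N = H 0 \<and>
     (\<forall>\<tau>. Im \<tau> > 0 \<longrightarrow> f1 \<tau> = poly P (j_inv \<tau>))"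
  proof (rule Suc.IH)
    show "f1 holomorphic_on uhp" unfolding f1_def
      by (intro holomorphic_intros Suc.prems j_inv_holomorphic)
    show "modular_invariant f1"
      using Suc.prems(2) modular_invariant_j_inv by (auto simp: modular_invariant_def f1_def)
    show "int_hol H" by fact
    fix \<tau> assume \<tau>: "Im \<tau> > 0"
    have "qexp \<tau> * (f1 \<tau> * qexp \<tau> ^ N) = f \<tau> * qexp \<tau> ^ Suc N - c * (j_inv \<tau> * qexp \<tau>) ^ Suc N"
      by (simp add: f1_def power_mult_distrib algebra_simps)
    also have "\<dots> = G1 (qexp \<tau>)"
      unfolding Suc.prems(4)[OF \<tau>] j_inv_qexp[OF \<tau>] G1_def ..
    also have "\<dots> = qexp \<tau> * H (qexp \<tau>)" by (rule H(2))
    finally show "f1 \<tau> * qexp \<tau> ^ N = H (qexp \<tau>)" by simp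
  qed
  then obtain P where P: "\<forall>i. coeff P i \<in> \<int>" "degree P \<le> N"
     "\<And>\<tau>. Im \<tau> > 0 \<Longrightarrow> f1 \<tau> = poly P (j_inv \<tau>)" by blast
  show ?case
  proof (intro exI[of _ "P + monom c (Suc N)"] conjI allI impI)
    show "coeff (P + monom c (Suc N)) i \<in> \<int>" for i
      using P(1) c by (auto simp: coeff_monom)
    show "degree (P + monom c (Suc N)) \<le> Suc N"
      using P(2) by (intro degree_add_le) (auto simp: degree_monom_le)
    show "coeff (P + monom c (Suc N)) (Suc N) = G 0"
      using P(2) by (simp add: coeff_eq_0 c_def)
    show "f \<tau> = poly (P + monom c (Suc N)) (j_inv \<tau>)" if "Im \<tau> > 0" for \<tau>
      using P(3)[OF that] by (simp add: f1_def poly_monom algebra_simps)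
  qed
qed

section \<open>Modular equations\<close>

abbreviation unity_roots :: "nat \<Rightarrow> complex set" where
  "unity_roots p \<equiv> {z. z ^ p = 1}"

lemma unity_roots_simps:
  assumes "p > 0"
  shows "finite (unity_roots p)" "card (unity_roots p) = p"
  using bij_betw_finite[OF Complex.bij_betw_roots_unity[OF assms]]
    bij_betw_same_card[OF Complex.bij_betw_roots_unity[OF assms]] by simp_all

lemma norm_unity_root: "p > 0 \<Longrightarrow> z \<in> unity_roots p \<Longrightarrow> norm z = 1"
  by (rule power_eq_imp_eq_base[of _ p]) (auto simp flip: norm_power)

lemma prod_unity_roots:
  assumes p: "p > 0"
  shows "(\<Prod>z\<in>unity_roots p. y - z) = y ^ p - 1"
proof -
  note R = unity_roots_simps[OF p]
  define P where "P = (\<Prod>z\<in>unity_roots p. [:-z, 1:])"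
  have dP: "degree P = p"
    unfolding P_def by (subst degree_prod_eq_sum_degree) (use R in auto)
  have lP: "lead_coeff P = 1"
    unfolding P_def lead_coeff_prod by simp
  have "P = monom 1 p - 1"
  proof (rule poly_eqI_degree_lead_coeff)
    show "coeff P p = coeff (monom 1 p - 1) p" using dP lP p by auto
    show "card (unity_roots p) \<ge> p" using R by simp
    show "degree (monom (1::complex) p - 1) \<le> p" by (intro degree_diff_le) (auto simp: degree_monom_le)
    fix z :: complex assume "z \<in> unity_roots p"
    thus "poly P z = poly (monom 1 p - 1) z"
      using R by (auto simp: P_def poly_prod poly_monom prod_zero_iff)
  qed (use dP in simp)
  hence "poly P y = y ^ p - 1" by (simp add: poly_monom)
  thus ?thesis by (simp add: P_def poly_prod)
qed

lemma prod_unity_roots_linear: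
  assumes p: "p > 0"
  shows "(\<Prod>z\<in>unity_roots p. 1 + x * z) = 1 - (-x) ^ p"
proof (cases "x = 0")
  case False
  have "(\<Prod>z\<in>unity_roots p. 1 + x * z) = (\<Prod>z\<in>unity_roots p. (-x) * (-1/x - z))"
    using False by (intro prod.cong) (auto simp: field_simps)
  also have "\<dots> = (-x) ^ p * ((-1/x) ^ p - 1)"
    by (simp only: prod.distrib prod_constant unity_roots_simps(2)[OF p] prod_unity_roots[OF p])
  also have "\<dots> = 1 - (-x) ^ p"
    using False by (simp add: right_diff_distrib flip: power_mult_distrib)
  finally show ?thesis .
qed (use p in auto)

lemma bij_betw_unity_roots_power:
  assumes "prime p" "\<not> p dvd k"
  shows "bij_betw (\<lambda>z. z ^ k) (unity_roots p) (unity_roots p)"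
proof -
  have p: "p > 0" using assms(1) prime_gt_0_nat by blast
  have "coprime k p" using prime_imp_coprime[OF assms] by (rule coprime_imp_coprime) auto
  moreover have "k \<noteq> 0" using assms(2) by (metis dvd_0_right)
  ultimately obtain a b where ab: "k * a = p * b + 1"
    using bezout_nat[of k p] by auto
  have "inj_on (\<lambda>z. z ^ k) (unity_roots p)"
  proof (rule inj_on_inverseI[where g = "\<lambda>z. z ^ a"])
    fix z :: complex assume "z \<in> unity_roots p"
    hence "(z ^ p) ^ b * z = z" by simp
    thus "(z ^ k) ^ a = z" by (simp add: power_mult[symmetric] ab)
  qed
  moreover have "(\<lambda>z. z ^ k) ` unity_roots p \<subseteq> unity_roots p"
    by (auto simp: power_mult[symmetric] mult.commute[of k]) (simp add: power_mult)
  ultimately show ?thesis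
    using endo_inj_surj[OF unity_roots_simps(1)[OF p]] by (auto simp: bij_betw_def)
qed

definition rot_fps :: "complex \<Rightarrow> complex fps \<Rightarrow> complex fps" where
  "rot_fps c F = fps_compose F (fps_const c * fps_X)"

lemma rot_fps_nth [simp]: "fps_nth (rot_fps c F) n = c ^ n * fps_nth F n"
  by (simp add: rot_fps_def fps_compose_linear)

lemma rot_fps_mult: "rot_fps c (F * G) = rot_fps c F * rot_fps c G"
  unfolding rot_fps_def by (intro fps_compose_mult_distrib) auto

lemma has_fps_expansion_rot:
  assumes "f has_fps_expansion F"
  shows "(\<lambda>s. f (c * s)) has_fps_expansion rot_fps c F"
proof -
  have "(f \<circ> (\<lambda>s. c * s)) has_fps_expansion rot_fps c F"
    unfolding rot_fps_def using assms by (intro has_fps_expansion_compose fps_expansion_intros) auto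
  thus ?thesis by (simp add: o_def)
qed

lemma fps_agree_mult:
  assumes "\<forall>i\<le>n. fps_nth A i = fps_nth A' i" "\<forall>i\<le>n. fps_nth B i = fps_nth B' i"
  shows "\<forall>i\<le>n. fps_nth (A * B) i = fps_nth (A' * B') (i::nat)"
  using assms by (auto simp: fps_mult_nth intro!: sum.cong)

lemma fps_agree_prod:
  assumes "\<And>x. x \<in> S \<Longrightarrow> \<forall>i\<le>n. fps_nth (f x) i = fps_nth (g x) i"
  shows "\<forall>i\<le>n. fps_nth (\<Prod>x\<in>S. f x) i = fps_nth (\<Prod>x\<in>S. g x) (i::nat)"
  using assms by (induction S rule: infinite_finite_induct) (auto intro: fps_agree_mult[rule_format])

text \<open>If p divides k, all conjugates agree and the norm is a p-th power. Otherwise z -> z^k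
  permutes the roots of unity and the norm is 1 - (-c X^k)^p.\<close>

lemma int_fps_norm_factor:
  assumes p: "prime p" and c: "c \<in> \<int>" and k: "k > 0"
  shows "int_fps (\<Prod>z\<in>unity_roots p. rot_fps z (1 + fps_const c * fps_X ^ k))"
proof -
  have p0: "p > 0" using p prime_gt_0_nat by blast
  have "(\<lambda>s. \<Prod>z\<in>unity_roots p. 1 + c * (z * s) ^ k) has_fps_expansion
      (\<Prod>z\<in>unity_roots p. rot_fps z (1 + fps_const c * fps_X ^ k))"
    by (intro fps_expansion_intros has_fps_expansion_rot)
  also have "(\<lambda>s. \<Prod>z\<in>unity_roots p. 1 + c * (z * s) ^ k) =
      (\<lambda>s. if p dvd k then (1 + c * s ^ k) ^ p else 1 - (- (c * s ^ k)) ^ p)"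
  proof (rule ext)
    fix s
    have *: "(\<Prod>z\<in>unity_roots p. 1 + c * (z * s) ^ k) = (\<Prod>z\<in>unity_roots p. 1 + (c * s ^ k) * z ^ k)"
      by (simp add: power_mult_distrib mult_ac)
    show "(\<Prod>z\<in>unity_roots p. 1 + c * (z * s) ^ k) =
      (if p dvd k then (1 + c * s ^ k) ^ p else 1 - (- (c * s ^ k)) ^ p)"
    proof (cases "p dvd k")
      case True
      hence "(\<Prod>z\<in>unity_roots p. 1 + (c * s ^ k) * z ^ k) = (\<Prod>z\<in>unity_roots p. 1 + c * s ^ k)"
        by (intro prod.cong) (auto simp: power_mult)
      thus ?thesis using True unity_roots_simps[OF p0] by (simp add: *)
    next
      case False
      have "(\<Prod>z\<in>unity_roots p. 1 + (c * s ^ k) * z ^ k) = (\<Prod>z\<in>unity_roots p. 1 + (c * s ^ k) * z)"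
        using prod.reindex_bij_betw[OF bij_betw_unity_roots_power[OF p False], of "\<lambda>z. 1 + (c * s ^ k) * z"] .
      thus ?thesis using False prod_unity_roots_linear[OF p0] by (simp add: *)
    qed
  qed
  finally have exp: "\<dots> has_fps_expansion (\<Prod>z\<in>unity_roots p. rot_fps z (1 + fps_const c * fps_X ^ k))" .
  have "int_hol (\<lambda>s. (1 + c * s ^ k) ^ p)" "int_hol (\<lambda>s. 1 - (- (c * s ^ k)) ^ p)"
    by (intro int_hol_power int_hol_add int_hol_diff int_hol_minus int_hol_mult int_hol_const int_hol_id c; simp)+
  hence "int_hol (\<lambda>s. if p dvd k then (1 + c * s ^ k) ^ p else 1 - (- (c * s ^ k)) ^ p)"
    by (cases "p dvd k") (simp_all only: if_True if_False)
  then obtain F where "(\<lambda>s. if p dvd k then (1 + c * s ^ k) ^ p else 1 - (- (c * s ^ k)) ^ p) has_fps_expansion F" "int_fps F"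
    by (auto simp: int_hol_def)
  with exp show ?thesis using fps_expansion_unique_complex by blast
qed

text \<open>Modulo every power of \<open>X\<close> the series is a product of factors \<open>1 + c X\<^sup>k\<close> with integral \<open>c\<close>,
  for which the norm can be computed.\<close>

lemma int_fps_norm:
  assumes p: "prime p" and U: "int_fps U" "fps_nth U 0 = 1"
  shows "int_fps (\<Prod>z\<in>unity_roots p. rot_fps z U)"
proof -
  have "\<exists>V. int_fps V \<and> fps_nth V 0 = 1 \<and> int_fps (\<Prod>z\<in>unity_roots p. rot_fps z V) \<and>
      (\<forall>i\<le>n. fps_nth U i = fps_nth V i)" for n
  proof (induction n)
    case 0
    have "rot_fps z 1 = 1" for z by (simp add: fps_eq_iff)
    thus ?case using U by (intro exI[of _ 1]) (auto simp: int_fps_1)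
  next
    case (Suc n)
    then obtain V where V: "int_fps V" "fps_nth V 0 = 1" "int_fps (\<Prod>z\<in>unity_roots p. rot_fps z V)"
      "\<forall>i\<le>n. fps_nth U i = fps_nth V i" by blast
    \<comment> \<open>The discrepancy at the next coefficient. The factor 1 + c X^(n+1) removes it
      without changing an earlier coefficient.\<close>
    define c where "c = fps_nth U (Suc n) - fps_nth V (Suc n)"
    have c: "c \<in> \<int>" using U V by (auto simp: c_def int_fps_def)
    define E where "E = 1 + fps_const c * fps_X ^ Suc n"
    have "int_fps E" unfolding E_def
      by (intro int_fps_add int_fps_1 int_fps_mult int_fps_const int_fps_power int_fps_X c)
    moreover have "int_fps (\<Prod>z\<in>unity_roots p. rot_fps z (V * E))"
      unfolding rot_fps_mult prod.distrib E_def
      by (intro int_fps_mult V int_fps_norm_factor p c) auto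
    moreover have "fps_nth (V * E) 0 = 1" using V by (simp add: E_def)
    moreover have "fps_nth U i = fps_nth (V * E) i" if "i \<le> Suc n" for i
    proof -
      have "V * E = V + fps_const c * (V * fps_X ^ Suc n)" by (simp add: E_def algebra_simps)
      hence "fps_nth (V * E) i = fps_nth V i + c * (if i < Suc n then 0 else fps_nth V (i - Suc n))"
        by (simp only: fps_add_nth fps_mult_left_const_nth fps_X_power_mult_right_nth)
      thus ?thesis using that V by (cases "i = Suc n") (auto simp: c_def)
    qed
    ultimately show ?case using V(1) by (intro exI[of _ "V * E"]) (auto intro: int_fps_mult)
  qed
  note approx = this
  have "fps_nth (\<Prod>z\<in>unity_roots p. rot_fps z U) n \<in> \<int>" for n
  proof -
    obtain V where V: "int_fps (\<Prod>z\<in>unity_roots p. rot_fps z V)" "\<forall>i\<le>n. fps_nth U i = fps_nth V i"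
      using approx[of n] by blast
    have "\<forall>i\<le>n. fps_nth (\<Prod>z\<in>unity_roots p. rot_fps z U) i = fps_nth (\<Prod>z\<in>unity_roots p. rot_fps z V) i"
      using V(2) by (intro fps_agree_prod) auto
    thus ?thesis using V(1) by (auto simp: int_fps_def)
  qed
  thus ?thesis by (auto simp: int_fps_def)
qed

lemma holomorphic_rotate:
  assumes "f holomorphic_on ball 0 1" "norm z = 1"
  shows "(\<lambda>s. f (z * s)) holomorphic_on ball 0 1"
proof -
  have "f \<circ> (\<lambda>s. z * s) holomorphic_on ball 0 1"
    using assms(2) by (intro holomorphic_on_compose_gen[OF _ assms(1)] holomorphic_intros) (auto simp: norm_mult)
  thus ?thesis by (simp add: o_def)
qed

lemma int_hol_norm:
  assumes p: "prime p" and U: "int_hol U" "U 0 = 1"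
  shows "int_hol (\<lambda>s. \<Prod>z\<in>unity_roots p. U (z * s))"
proof -
  have p0: "p > 0" using p prime_gt_0_nat by blast
  obtain F where F: "U has_fps_expansion F" "int_fps F"
    using U(1) by (auto simp: int_hol_def)
  have "fps_nth F 0 = 1" using has_fps_expansion_imp_0_eq_fps_nth_0[OF F(1)] U(2) by simp
  hence "int_fps (\<Prod>z\<in>unity_roots p. rot_fps z F)" by (intro int_fps_norm p F)
  moreover have "(\<lambda>s. \<Prod>z\<in>unity_roots p. U (z * s)) has_fps_expansion (\<Prod>z\<in>unity_roots p. rot_fps z F)"
    by (intro fps_expansion_intros has_fps_expansion_rot F)
  moreover have "(\<lambda>s. \<Prod>z\<in>unity_roots p. U (z * s)) holomorphic_on ball 0 1"
    by (intro holomorphic_intros holomorphic_rotate int_hol_holomorphic[OF U(1)] norm_unity_root[OF p0])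
  ultimately show ?thesis by (auto simp: int_hol_def)
qed

text \<open>The coefficient of X^n is multiplied by the sum of all z^n, which is p or 0.\<close>

lemma int_hol_trace:
  assumes p: "prime p" and U: "int_hol U"
  shows "int_hol (\<lambda>s. \<Sum>z\<in>unity_roots p. U (z * s))"
proof -
  have p0: "p > 0" and p1: "p > 1" using p prime_gt_0_nat prime_gt_1_nat by blast+
  obtain F where F: "U has_fps_expansion F" "int_fps F"
    using U(1) by (auto simp: int_hol_def)
  have "(\<Sum>z\<in>unity_roots p. z ^ n) \<in> \<int>" for n
  proof (cases "p dvd n")
    case True
    hence "(\<Sum>z\<in>unity_roots p. z ^ n) = (\<Sum>z\<in>unity_roots p. 1)"
      by (intro sum.cong) (auto simp: power_mult)
    thus ?thesis by simp
  next
    case False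
    have "(\<Sum>z\<in>unity_roots p. z ^ n) = \<Sum>(unity_roots p)"
      using sum.reindex_bij_betw[OF bij_betw_unity_roots_power[OF p False], of "\<lambda>z. z"] .
    thus ?thesis using sum_roots_unity[OF p1] by simp
  qed
  hence "int_fps (\<Sum>z\<in>unity_roots p. rot_fps z F)"
    using F(2) by (auto simp: int_fps_def fps_sum_nth simp flip: sum_distrib_right)
  moreover have "(\<lambda>s. \<Sum>z\<in>unity_roots p. U (z * s)) has_fps_expansion (\<Sum>z\<in>unity_roots p. rot_fps z F)"
    by (intro fps_expansion_intros has_fps_expansion_rot F)
  moreover have "(\<lambda>s. \<Sum>z\<in>unity_roots p. U (z * s)) holomorphic_on ball 0 1"
    by (intro holomorphic_intros holomorphic_rotate int_hol_holomorphic[OF U(1)] norm_unity_root[OF p0])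
  ultimately show ?thesis by (auto simp: int_hol_def)
qed

text \<open>F is a series in q^(1/m); periodicity of f means that only integral powers of q occur in
  it.\<close>

lemma q_expansion_from_root:
  assumes f: "f holomorphic_on uhp" "\<And>\<tau>. Im \<tau> > 0 \<Longrightarrow> f (\<tau> + 1) = f \<tau>"
    and F: "int_hol F" and m: "m > 0"
    and eq: "\<And>\<tau>. Im \<tau> > 0 \<Longrightarrow> f \<tau> * qexp \<tau> ^ N = F (qexp (\<tau> / of_nat m))"
  obtains G where "int_hol G" "G 0 = F 0" "\<And>\<tau>. Im \<tau> > 0 \<Longrightarrow> f \<tau> * qexp \<tau> ^ N = G (qexp \<tau>)"
proof -
  have pw: "qexp (\<tau> / of_nat m) ^ m = qexp \<tau>" for \<tau>
    using m by (simp add: qexp_exp exp_of_nat_mult[symmetric])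
  have "filterlim (\<lambda>\<tau>. \<tau> / of_nat m) at_cusp at_cusp"
  proof -
    have "filterlim (\<lambda>y. y / real m) at_top at_top" using m by real_asymp
    thus ?thesis
      by (auto simp: filterlim_filtercomap_iff o_def intro: filterlim_compose[OF _ filterlim_filtercomap])
  qed
  hence lim0: "filterlim (\<lambda>\<tau>. qexp (\<tau> / of_nat m)) (at 0) at_cusp"
    by (rule filterlim_compose[OF filterlim_qexp_cusp])
  have "isCont F 0"
    using holomorphic_on_imp_continuous_on[OF int_hol_holomorphic[OF F]]
    by (simp add: continuous_on_eq_continuous_at)
  hence limF: "((\<lambda>\<tau>. F (qexp (\<tau> / of_nat m))) \<longlongrightarrow> F 0) at_cusp"
    by (intro filterlim_compose[OF _ lim0]) (simp add: isCont_def)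
  hence "eventually (\<lambda>\<tau>. norm (F (qexp (\<tau> / of_nat m))) < norm (F 0) + 1) at_cusp"
    by (intro order_tendstoD(2)[OF tendsto_norm]) auto
  moreover have "eventually (\<lambda>\<tau>. Im \<tau> > 0) at_cusp" by (rule eventually_at_cuspI[of 1]) auto
  ultimately have bd: "eventually (\<lambda>\<tau>. norm (f \<tau> * qexp \<tau> ^ N) \<le> norm (F 0) + 1) at_cusp"
    by eventually_elim (simp add: eq)
  have "(\<lambda>\<tau>. f \<tau> * qexp \<tau> ^ N) holomorphic_on uhp"
    by (intro holomorphic_intros f)
  then obtain G where G: "G holomorphic_on ball 0 1" "\<And>\<tau>. Im \<tau> > 0 \<Longrightarrow> f \<tau> * qexp \<tau> ^ N = G (qexp \<tau>)"
    using periodic_factors_qexp[OF _ _ bd] f(2) by (auto simp: qexp_plus_1)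
  have FG: "F s = G (s ^ m)" if "norm s < 1" "s \<noteq> 0" for s
  proof -
    \<comment> \<open>The nome is a square root of \<open>qexp\<close>: at \<open>\<tau>\<close>
      divided by m the nome is csqrt s, so \<open>qexp\<close> takes the value s.\<close>
    define \<tau> where "\<tau> = of_nat m * (Ln (csqrt s) / (pi * \<i>))"
    have c: "csqrt s \<noteq> 0" "norm (csqrt s) < 1" using that by (auto simp: norm_csqrt real_sqrt_lt_1_iff)
    have "Im (of_nat m * z) = real m * Im z" for z by simp
    hence "Im \<tau> > 0" using Im_nome_Ln[OF c] m by (simp only: \<tau>_def) simp
    moreover have "qexp (\<tau> / of_nat m) = s"
      using m nome_Ln[OF c(1)] by (simp add: \<tau>_def qexp_def)
    ultimately show ?thesis using eq[of \<tau>] G(2)[of \<tau>] pw[of \<tau>] by simp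
  qed
  have "int_hol G" by (rule int_hol_from_power[OF G(1) m F FG])
  moreover have "G 0 = F 0"
  proof -
    have "isCont G 0"
      using holomorphic_on_imp_continuous_on[OF G(1)] by (simp add: continuous_on_eq_continuous_at)
    hence "((\<lambda>\<tau>. G (qexp \<tau>)) \<longlongrightarrow> G 0) at_cusp"
      by (intro filterlim_compose[OF _ filterlim_qexp_cusp]) (simp add: isCont_def)
    moreover have "eventually (\<lambda>\<tau>. G (qexp \<tau>) = F (qexp (\<tau> / of_nat m))) at_cusp"
      by (rule eventually_at_cuspI[of 1]) (use G(2) eq in auto)
    ultimately have "((\<lambda>\<tau>. F (qexp (\<tau> / of_nat m))) \<longlongrightarrow> G 0) at_cusp"
      by (rule Lim_transform_eventually)
    with limF show ?thesis using tendsto_unique[OF at_cusp_neq_bot] by blast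
  qed
  ultimately show ?thesis using G(2) by (rule that)
qed

text \<open>Representatives of the integral matrices of determinant p modulo the modular group, one
  for each of the p + 1 sublattices of index p. The index p stands for p tau.\<close>

definition hecke_pt :: "nat \<Rightarrow> nat \<Rightarrow> complex \<Rightarrow> complex" where
  "hecke_pt p i \<tau> = (if i = p then of_nat p * \<tau> else (\<tau> + of_nat i) / of_nat p)"

lemma Im_hecke_pt: "p > 0 \<Longrightarrow> Im \<tau> > 0 \<Longrightarrow> Im (hecke_pt p i \<tau>) > 0"
  by (auto simp: hecke_pt_def)

lemma hecke_pt_permute_T:
  assumes p: "p > 0" and f: "modular_invariant f"
  obtains \<pi> where "bij_betw \<pi> {..p} {..p}"
    "\<And>i \<tau>. i \<le> p \<Longrightarrow> Im \<tau> > 0 \<Longrightarrow> f (hecke_pt p i (\<tau> + 1)) = f (hecke_pt p (\<pi> i) \<tau>)"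
proof
  define \<pi> where "\<pi> = (\<lambda>i. if i = p then p else if Suc i = p then 0 else Suc i)"
  have "inj_on \<pi> {..p}" by (auto simp: inj_on_def \<pi>_def split: if_splits)
  moreover have "\<pi> ` {..p} \<subseteq> {..p}" by (auto simp: \<pi>_def)
  ultimately show "bij_betw \<pi> {..p} {..p}"
    using endo_inj_surj[of "{..p}" \<pi>] by (auto simp: bij_betw_def)
  fix i \<tau> assume i: "i \<le> p" and \<tau>: "Im \<tau> > 0"
  have per: "f (z + of_int n) = f z" if "Im z > 0" for z n
    using f that by (intro periodic_shift_int) (auto simp: modular_invariant_def)
  consider "i = p" | "Suc i = p" | "Suc i < p" using i by linarith
  thus "f (hecke_pt p i (\<tau> + 1)) = f (hecke_pt p (\<pi> i) \<tau>)"
  proof cases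
    case 1
    have "f (of_nat p * \<tau> + of_int (int p)) = f (of_nat p * \<tau>)"
      using p \<tau> by (intro per) auto
    thus ?thesis using 1 by (simp add: hecke_pt_def \<pi>_def algebra_simps)
  next
    case 2
    have "(\<tau> + 1 + of_nat i) / of_nat p = \<tau> / of_nat p + of_int 1"
      using 2 p by (simp add: field_simps flip: of_nat_Suc)
    moreover have "f (\<tau> / of_nat p + of_int 1) = f (\<tau> / of_nat p)" using p \<tau> by (intro per) auto
    ultimately show ?thesis using 2 p by (auto simp: hecke_pt_def \<pi>_def)
  next
    case 3
    thus ?thesis by (simp add: hecke_pt_def \<pi>_def add_ac)
  qed
qed

text \<open>The inversion exchanges p tau and tau / p. Any other i goes to the residue g with i g =
  -1 modulo p: if i g + 1 = p e, the matrix (i, -e; p, -g) has determinant 1 and relates the two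
  points.\<close>

lemma hecke_pt_permute_S:
  assumes p: "prime p" and f: "modular_invariant f"
  obtains \<pi> where "bij_betw \<pi> {..p} {..p}"
    "\<And>i \<tau>. i \<le> p \<Longrightarrow> Im \<tau> > 0 \<Longrightarrow> f (hecke_pt p i (-1/\<tau>)) = f (hecke_pt p (\<pi> i) \<tau>)"
proof
  have p0: "p > 0" using p prime_gt_0_nat by blast
  have ex: "\<exists>c. 0 < c \<and> c < p \<and> p dvd b * c + 1" if b: "0 < b" "b < p" for b
  proof -
    have "\<not> p dvd b" using b by (auto dest: dvd_imp_le)
    with p have "coprime p b" by (rule prime_imp_coprime)
    hence "coprime b p" by (rule coprime_imp_coprime) auto
    moreover have "b \<noteq> 0" using b by auto
    ultimately obtain x y where xy: "b * x = p * y + 1" using bezout_nat[of b p] by auto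
    \<comment> \<open>x is an inverse of b modulo p, and p - 1 stands for -1.\<close>
    define c where "c = ((p - 1) * x) mod p"
    have "int p dvd int b * int x - 1" using xy by (simp flip: of_nat_mult)
    have "(b * c + 1) mod p = (b * ((p - 1) * x) + 1) mod p"
      unfolding c_def by (metis mod_add_left_eq mod_mult_right_eq)
    also have "b * ((p - 1) * x) + 1 = (p - 1) * (p * y + 1) + 1" by (simp only: xy[symmetric] mult_ac)
    also have "\<dots> = p * ((p - 1) * y + 1)" using p0 by (cases p) (auto simp: algebra_simps)
    finally have d: "p dvd b * c + 1" by (simp add: mod_eq_0_iff_dvd)
    moreover have "c \<noteq> 0"
    proof
      assume "c = 0"
      with d have "p = 1" by simp
      thus False using p by simp
    qed
    ultimately show ?thesis using p0 by (intro exI[of _ c]) (auto simp: c_def)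
  qed
  define g where "g = (\<lambda>b. SOME c. 0 < c \<and> c < p \<and> p dvd b * c + 1)"
  have g: "0 < g b" "g b < p" "p dvd b * g b + 1" if "0 < b" "b < p" for b
    using someI_ex[OF ex[OF that]] unfolding g_def by blast+
  define \<pi> where "\<pi> = (\<lambda>i. if i = p then 0 else if i = 0 then p else g i)"
  have g_inj: "i = j" if ij: "0 < i" "i < p" "0 < j" "j < p" "g i = g j" for i j
  proof -
    have "int p dvd int (i * g i + 1) - int (j * g j + 1)"
      using g(3)[of i] g(3)[of j] ij by (intro dvd_diff) (simp_all only: of_nat_dvd_iff)
    also have "int (i * g i + 1) - int (j * g j + 1) = (int i - int j) * int (g i)"
      using ij by (simp add: algebra_simps)
    finally have "int p dvd int i - int j \<or> int p dvd int (g i)"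
      using p by (simp add: prime_dvd_mult_iff)
    moreover have "\<not> int p dvd int (g i)" using g[of i] ij by (auto dest: dvd_imp_le)
    ultimately have "int p dvd int i - int j" by blast
    moreover have "\<bar>int i - int j\<bar> < int p" using ij by linarith
    ultimately show ?thesis using zdvd_not_zless[of "\<bar>int i - int j\<bar>" "int p"] by force
  qed
  have "inj_on \<pi> {..p}"
  proof (rule inj_onI)
    fix i j assume ij: "i \<in> {..p}" "j \<in> {..p}" "\<pi> i = \<pi> j"
    have c: "k = p \<and> \<pi> k = 0 \<or> k = 0 \<and> \<pi> k = p \<or> 0 < k \<and> k < p \<and> \<pi> k = g k \<and> 0 < g k \<and> g k < p"
      if "k \<in> {..p}" for k
    proof (cases "k = p \<or> k = 0")
      case False
      with that have k: "0 < k" "k < p" by auto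
      thus ?thesis using g(1)[OF k] g(2)[OF k] by (simp add: \<pi>_def)
    qed (use p0 in \<open>auto simp: \<pi>_def\<close>)
    show "i = j"
      using c[OF ij(1)] c[OF ij(2)] ij(3) g_inj[of i j] p0 by (elim disjE conjE) simp_all
  qed
  moreover have "\<pi> ` {..p} \<subseteq> {..p}"
    using g(2) by (auto simp: \<pi>_def le_less)
  ultimately show "bij_betw \<pi> {..p} {..p}"
    using endo_inj_surj[of "{..p}" \<pi>] by (auto simp: bij_betw_def)
  fix i \<tau> assume i: "i \<le> p" and \<tau>: "Im \<tau> > 0"
  have [simp]: "\<tau> \<noteq> 0" using \<tau> by auto
  have inv: "f (-1/z) = f z" if "Im z > 0" for z
    using f that by (auto simp: modular_invariant_def)
  consider "i = p" | "i = 0" | "0 < i" "i < p" using i by linarith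
  thus "f (hecke_pt p i (-1/\<tau>)) = f (hecke_pt p (\<pi> i) \<tau>)"
  proof cases
    case 1
    thus ?thesis using inv[of "\<tau> / of_nat p"] p0 \<tau> by (simp add: hecke_pt_def \<pi>_def)
  next
    case 2
    thus ?thesis using inv[of "of_nat p * \<tau>"] p0 \<tau> by (simp add: hecke_pt_def \<pi>_def field_simps)
  next
    case 3
    obtain e where e: "i * g i + 1 = p * e" using g(3)[OF 3] by blast
    define w where "w = (\<tau> + of_nat (g i)) / of_nat p"
    have e': "of_nat i * of_nat (g i) + 1 = (of_nat p * of_nat e :: complex)"
    proof -
      have "(of_nat (i * g i + 1) :: complex) = of_nat (p * e)" by (simp only: e)
      thus ?thesis by (simp add: add.commute)
    qed
    have "f ((of_int (int i) * w + of_int (- int e)) / (of_int (int p) * w + of_int (- int (g i)))) = f w"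
    proof (rule modular_invariant_moebius[OF f])
      show "Im w > 0" using \<tau> p0 by (simp add: w_def)
      have "int i * int (g i) + 1 = int p * int e" using arg_cong[OF e, of int] by simp
      thus "int i * - int (g i) - - int e * int p = 1" by (simp add: algebra_simps)
    qed
    moreover have "of_nat p * w - of_nat (g i) = \<tau>" using p0 by (simp add: w_def)
    moreover have "of_nat i * w - of_nat e = (of_nat i * \<tau> - 1) / of_nat p"
    proof -
      have "of_nat p * (of_nat i * w - of_nat e) = of_nat i * \<tau> + of_nat i * of_nat (g i) - of_nat p * of_nat e"
      proof -
        have "of_nat p * w = \<tau> + of_nat (g i)" using p0 by (simp add: w_def)
        hence "of_nat i * (of_nat p * w) = of_nat i * (\<tau> + of_nat (g i))" by simp
        thus ?thesis by (simp add: algebra_simps)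
      qed
      also have "\<dots> = of_nat i * \<tau> - 1" by (simp flip: e')
      finally show ?thesis using p0 by (simp add: field_simps)
    qed
    ultimately have "f ((of_nat i * \<tau> - 1) / of_nat p / \<tau>) = f w" by simp
    moreover have "(of_nat i * \<tau> - 1) / of_nat p / \<tau> = (-1/\<tau> + of_nat i) / of_nat p"
      using p0 by (simp add: field_simps)
    ultimately show ?thesis using 3 g[OF 3] by (simp add: hecke_pt_def \<pi>_def w_def)
  qed
qed

lemma hecke_pt_holomorphic:
  assumes "p > 0"
  shows "(\<lambda>\<tau>. j_inv (hecke_pt p i \<tau>)) holomorphic_on uhp"
proof -
  have "j_inv \<circ> hecke_pt p i holomorphic_on uhp"
  proof (rule holomorphic_on_compose_gen[OF _ j_inv_holomorphic])
    show "hecke_pt p i holomorphic_on uhp"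
      unfolding hecke_pt_def using assms by (cases "i = p") (auto intro!: holomorphic_intros)
  qed (use Im_hecke_pt[OF assms] in auto)
  thus ?thesis by (simp add: o_def)
qed

lemma hecke_pt_unity_roots:
  fixes g :: "complex \<Rightarrow> 'a :: comm_monoid_mult" and h :: "complex \<Rightarrow> 'b :: comm_monoid_add"
  assumes p: "p > 0"
  shows "(\<Prod>i<p. g (qexp (hecke_pt p i \<tau>))) = (\<Prod>z\<in>unity_roots p. g (z * qexp (\<tau> / of_nat p)))"
    and "(\<Sum>i<p. h (qexp (hecke_pt p i \<tau>))) = (\<Sum>z\<in>unity_roots p. h (z * qexp (\<tau> / of_nat p)))"
proof -
  have eq: "qexp (hecke_pt p i \<tau>) = cis (2 * pi * real i / real p) * qexp (\<tau> / of_nat p)" if "i < p" for i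
    using that p by (simp add: hecke_pt_def qexp_exp cis_conv_exp exp_add[symmetric] field_simps)
  show "(\<Prod>i<p. g (qexp (hecke_pt p i \<tau>))) = (\<Prod>z\<in>unity_roots p. g (z * qexp (\<tau> / of_nat p)))"
    by (subst prod.reindex_bij_betw[OF Complex.bij_betw_roots_unity[OF p], symmetric]) (auto intro!: prod.cong simp: eq)
  show "(\<Sum>i<p. h (qexp (hecke_pt p i \<tau>))) = (\<Sum>z\<in>unity_roots p. h (z * qexp (\<tau> / of_nat p)))"
    by (subst sum.reindex_bij_betw[OF Complex.bij_betw_roots_unity[OF p], symmetric]) (auto intro!: sum.cong simp: eq)
qed

text \<open>As q tends to 0, the p factors with (tau + i)/p grow like q^-1 and the factor with p tau
  like -q^(-p). So the product starts with -q^(-2p): Kronecker's leading coefficient -1 of Phi_p(X,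
  X) for prime p.\<close>

theorem modular_equation_diagonal:
  assumes p: "prime p"
  obtains P where "\<forall>i. coeff P i \<in> \<int>" "degree P = 2 * p" "lead_coeff P = -1"
    "\<And>\<tau>. Im \<tau> > 0 \<Longrightarrow> (\<Prod>i\<le>p. j_inv \<tau> - j_inv (hecke_pt p i \<tau>)) = poly P (j_inv \<tau>)"
proof -
  have p0: "p > 0" and p1: "p > 1" using p prime_gt_0_nat prime_gt_1_nat by blast+
  define f where "f = (\<lambda>\<tau>. \<Prod>i\<le>p. j_inv \<tau> - j_inv (hecke_pt p i \<tau>))"
  have hol: "f holomorphic_on uhp"
    unfolding f_def by (intro holomorphic_intros j_inv_holomorphic hecke_pt_holomorphic p0)
  have inv: "modular_invariant f"
    unfolding modular_invariant_def
  proof (intro allI impI conjI)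
    fix \<tau> assume \<tau>: "Im \<tau> > 0"
    obtain \<pi> where \<pi>: "bij_betw \<pi> {..p} {..p}"
      "\<And>i \<tau>. i \<le> p \<Longrightarrow> Im \<tau> > 0 \<Longrightarrow> j_inv (hecke_pt p i (\<tau> + 1)) = j_inv (hecke_pt p (\<pi> i) \<tau>)"
      using hecke_pt_permute_T[OF p0 modular_invariant_j_inv] by blast
    have "f (\<tau> + 1) = (\<Prod>i\<le>p. j_inv \<tau> - j_inv (hecke_pt p (\<pi> i) \<tau>))"
      unfolding f_def by (intro prod.cong refl) (auto simp: \<pi>(2) \<tau> j_inv_plus_1)
    thus "f (\<tau> + 1) = f \<tau>"
      using prod.reindex_bij_betw[OF \<pi>(1), of "\<lambda>i. j_inv \<tau> - j_inv (hecke_pt p i \<tau>)"] by (simp add: f_def)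
    obtain \<pi> where \<pi>: "bij_betw \<pi> {..p} {..p}"
      "\<And>i \<tau>. i \<le> p \<Longrightarrow> Im \<tau> > 0 \<Longrightarrow> j_inv (hecke_pt p i (-1/\<tau>)) = j_inv (hecke_pt p (\<pi> i) \<tau>)"
      using hecke_pt_permute_S[OF p modular_invariant_j_inv] by blast
    have "f (-1/\<tau>) = (\<Prod>i\<le>p. j_inv \<tau> - j_inv (hecke_pt p (\<pi> i) \<tau>))"
      unfolding f_def by (intro prod.cong refl) (simp only: \<pi>(2) \<tau> j_inv_minus_inverse atMost_iff)
    thus "f (-1/\<tau>) = f \<tau>"
      using prod.reindex_bij_betw[OF \<pi>(1), of "\<lambda>i. j_inv \<tau> - j_inv (hecke_pt p i \<tau>)"] by (simp add: f_def)
  qed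
  \<comment> \<open>For s = q^(1/p) and a root of unity z, \<open>U (z * s)\<close> is q times the
    factor of one point (tau + i)/p. The other factor of \<open>F\<close> is q^p times the factor of
    p tau.\<close>
  define U where "U = (\<lambda>s. j_disc (s ^ p) - s ^ (p - 1) * j_disc s)"
  define F where "F = (\<lambda>s. ((s ^ p) ^ (p - 1) * j_disc (s ^ p) - j_disc ((s ^ p) ^ p)) * (\<Prod>z\<in>unity_roots p. U (z * s)))"
  have intU: "int_hol U"
    unfolding U_def by (intro int_hol_diff int_hol_mult int_hol_compose_power int_hol_power int_hol_id int_hol_j_disc p0)
  have U0: "U 0 = 1" using p1 by (simp add: U_def j_disc_0 power_0_left)
  have int1: "int_hol (\<lambda>q. q ^ (p - 1) * j_disc q - j_disc (q ^ p))"
    by (intro int_hol_diff int_hol_mult int_hol_compose_power int_hol_power int_hol_id int_hol_j_disc p0)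
  have intF: "int_hol F"
    unfolding F_def by (intro int_hol_mult int_hol_norm p intU U0 int_hol_compose_power[OF int1 p0])
  have F0: "F 0 = -1" using p1 by (simp add: F_def U0 j_disc_0 power_0_left)
  have key: "f \<tau> * qexp \<tau> ^ (2 * p) = F (qexp (\<tau> / of_nat p))" if \<tau>: "Im \<tau> > 0" for \<tau>
  proof -
    define s q where "s = qexp (\<tau> / of_nat p)" and "q = qexp \<tau>"
    have sq: "s ^ p = q" using p0 by (simp add: s_def q_def qexp_exp exp_of_nat_mult[symmetric])
    have nz: "s \<noteq> 0" "q \<noteq> 0" by (simp_all add: s_def q_def)
    have jq: "j_inv \<tau> = j_disc q / q" unfolding q_def by (rule j_inv_eq[OF \<tau>])
    have "qexp (of_nat p * \<tau>) = q ^ p"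
      by (simp add: q_def qexp_exp exp_of_nat_mult[symmetric] mult_ac)
    hence jp: "j_inv (hecke_pt p p \<tau>) = j_disc (q ^ p) / q ^ p"
      using j_inv_eq[OF Im_hecke_pt[OF p0 \<tau>], of p] by (simp add: hecke_pt_def)
    have "q ^ p * (j_inv \<tau> - j_inv (hecke_pt p p \<tau>)) = q ^ (p - 1) * j_disc q - j_disc (q ^ p)"
      using nz p0 unfolding jq jp by (cases p) (auto simp: field_simps)
    moreover have "q ^ p * (\<Prod>i<p. j_inv \<tau> - j_inv (hecke_pt p i \<tau>)) = (\<Prod>z\<in>unity_roots p. U (z * s))"
    proof -
      have "q ^ p * (\<Prod>i<p. j_inv \<tau> - j_inv (hecke_pt p i \<tau>)) = (\<Prod>i<p. q * (j_inv \<tau> - j_inv (hecke_pt p i \<tau>)))"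
        by (simp add: prod.distrib)
      also have "\<dots> = (\<Prod>i<p. q * (j_inv \<tau> - j_disc (qexp (hecke_pt p i \<tau>)) / qexp (hecke_pt p i \<tau>)))"
        by (simp add: j_inv_eq[OF Im_hecke_pt[OF p0 \<tau>]])
      also have "\<dots> = (\<Prod>z\<in>unity_roots p. q * (j_inv \<tau> - j_disc (z * s) / (z * s)))"
        unfolding s_def by (rule hecke_pt_unity_roots(1)[OF p0])
      also have "\<dots> = (\<Prod>z\<in>unity_roots p. U (z * s))"
      proof (rule prod.cong[OF refl])
        fix z assume z: "z \<in> unity_roots p"
        hence "z \<noteq> 0" using p0 by (auto simp: power_0_left)
        moreover have zs: "(z * s) ^ p = q" using z by (simp add: power_mult_distrib sq)
        moreover have "(z * s) ^ p = z * s * (z * s) ^ (p - 1)" using p0 by (cases p) auto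
        ultimately have "q / (z * s) = (z * s) ^ (p - 1)" using nz by (simp add: field_simps)
        hence "q * (j_disc (z * s) / (z * s)) = (z * s) ^ (p - 1) * j_disc (z * s)"
          by (metis times_divide_eq_left times_divide_eq_right)
        moreover have "q * j_inv \<tau> = j_disc q" using nz by (simp add: jq)
        ultimately show "q * (j_inv \<tau> - j_disc (z * s) / (z * s)) = U (z * s)"
          unfolding U_def zs by (simp only: right_diff_distrib)
      qed
      finally show ?thesis .
    qed
    moreover have "f \<tau> = (\<Prod>i<p. j_inv \<tau> - j_inv (hecke_pt p i \<tau>)) * (j_inv \<tau> - j_inv (hecke_pt p p \<tau>))"
      unfolding f_def by (simp flip: lessThan_Suc_atMost)
    ultimately have "f \<tau> * (q ^ p * q ^ p) = (q ^ (p - 1) * j_disc q - j_disc (q ^ p)) * (\<Prod>z\<in>unity_roots p. U (z * s))"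
      by (metis mult.assoc mult.commute)
    thus ?thesis
      unfolding F_def s_def[symmetric] q_def[symmetric] sq mult_2 power_add .
  qed
  obtain G where G: "int_hol G" "G 0 = -1" "\<And>\<tau>. Im \<tau> > 0 \<Longrightarrow> f \<tau> * qexp \<tau> ^ (2 * p) = G (qexp \<tau>)"
    using q_expansion_from_root[OF hol _ intF p0 key] inv F0 by (auto simp: modular_invariant_def)
  obtain P where P: "\<forall>i. coeff P i \<in> \<int>" "degree P \<le> 2 * p" "coeff P (2 * p) = -1"
      "\<And>\<tau>. Im \<tau> > 0 \<Longrightarrow> f \<tau> = poly P (j_inv \<tau>)"
    using modular_function_is_polynomial[OF hol inv G(1,3)] G(2) by auto
  have "degree P = 2 * p" using P(2,3) le_degree[of P "2 * p"] by auto
  thus ?thesis using P by (intro that[of P]) (auto simp: f_def)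
qed

text \<open>Up to normalisation the sum is the Hecke operator T_p applied to j. For p = 3, evaluated
  where j = 0, it gives the integrality for d = 27.\<close>

theorem hecke_trace_polynomial:
  assumes p: "prime p"
  obtains P where "\<forall>i. coeff P i \<in> \<int>"
    "\<And>\<tau>. Im \<tau> > 0 \<Longrightarrow> (\<Sum>i\<le>p. j_inv (hecke_pt p i \<tau>)) = poly P (j_inv \<tau>)"
proof -
  have p0: "p > 0" and p1: "p > 1" using p prime_gt_0_nat prime_gt_1_nat by blast+
  define f where "f = (\<lambda>\<tau>. \<Sum>i\<le>p. j_inv (hecke_pt p i \<tau>))"
  have hol: "f holomorphic_on uhp"
    unfolding f_def by (intro holomorphic_intros hecke_pt_holomorphic p0)
  have inv: "modular_invariant f"
    unfolding modular_invariant_def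
  proof (intro allI impI conjI)
    fix \<tau> assume \<tau>: "Im \<tau> > 0"
    obtain \<pi> where \<pi>: "bij_betw \<pi> {..p} {..p}"
      "\<And>i \<tau>. i \<le> p \<Longrightarrow> Im \<tau> > 0 \<Longrightarrow> j_inv (hecke_pt p i (\<tau> + 1)) = j_inv (hecke_pt p (\<pi> i) \<tau>)"
      using hecke_pt_permute_T[OF p0 modular_invariant_j_inv] by blast
    have "f (\<tau> + 1) = (\<Sum>i\<le>p. j_inv (hecke_pt p (\<pi> i) \<tau>))"
      unfolding f_def by (intro sum.cong refl) (auto simp: \<pi>(2) \<tau>)
    thus "f (\<tau> + 1) = f \<tau>"
      using sum.reindex_bij_betw[OF \<pi>(1), of "\<lambda>i. j_inv (hecke_pt p i \<tau>)"] by (simp add: f_def)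
    obtain \<pi> where \<pi>: "bij_betw \<pi> {..p} {..p}"
      "\<And>i \<tau>. i \<le> p \<Longrightarrow> Im \<tau> > 0 \<Longrightarrow> j_inv (hecke_pt p i (-1/\<tau>)) = j_inv (hecke_pt p (\<pi> i) \<tau>)"
      using hecke_pt_permute_S[OF p modular_invariant_j_inv] by blast
    have "f (-1/\<tau>) = (\<Sum>i\<le>p. j_inv (hecke_pt p (\<pi> i) \<tau>))"
      unfolding f_def by (intro sum.cong refl) (simp only: \<pi>(2) \<tau> atMost_iff)
    thus "f (-1/\<tau>) = f \<tau>"
      using sum.reindex_bij_betw[OF \<pi>(1), of "\<lambda>i. j_inv (hecke_pt p i \<tau>)"] by (simp add: f_def)
  qed
  define U where "U = (\<lambda>s. s ^ (p - 1) * j_disc s)"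
  define F where "F = (\<lambda>s. j_disc ((s ^ p) ^ p) + (s ^ p) ^ (p - 1) * (\<Sum>z\<in>unity_roots p. U (z * s)))"
  have intU: "int_hol U"
    unfolding U_def by (intro int_hol_mult int_hol_power int_hol_id int_hol_j_disc)
  have intF: "int_hol F"
    unfolding F_def power_mult[symmetric]
    by (intro int_hol_add int_hol_mult int_hol_power int_hol_id int_hol_trace p intU int_hol_compose_power int_hol_j_disc) (use p0 in auto)
  have key: "f \<tau> * qexp \<tau> ^ p = F (qexp (\<tau> / of_nat p))" if \<tau>: "Im \<tau> > 0" for \<tau>
  proof -
    define s q where "s = qexp (\<tau> / of_nat p)" and "q = qexp \<tau>"
    have sq: "s ^ p = q" using p0 by (simp add: s_def q_def qexp_exp exp_of_nat_mult[symmetric])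
    have nz: "s \<noteq> 0" "q \<noteq> 0" by (simp_all add: s_def q_def)
    have "qexp (of_nat p * \<tau>) = q ^ p"
      by (simp add: q_def qexp_exp exp_of_nat_mult[symmetric] mult_ac)
    hence jp: "j_inv (hecke_pt p p \<tau>) * q ^ p = j_disc (q ^ p)"
      using j_inv_eq[OF Im_hecke_pt[OF p0 \<tau>], of p] nz by (simp add: hecke_pt_def)
    have "q * (\<Sum>i<p. j_inv (hecke_pt p i \<tau>)) = (\<Sum>z\<in>unity_roots p. U (z * s))"
    proof -
      have "q * (\<Sum>i<p. j_inv (hecke_pt p i \<tau>)) = (\<Sum>i<p. q * (j_disc (qexp (hecke_pt p i \<tau>)) / qexp (hecke_pt p i \<tau>)))"
        by (simp add: sum_distrib_left j_inv_eq[OF Im_hecke_pt[OF p0 \<tau>]])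
      also have "\<dots> = (\<Sum>z\<in>unity_roots p. q * (j_disc (z * s) / (z * s)))"
        unfolding s_def by (rule hecke_pt_unity_roots(2)[OF p0])
      also have "\<dots> = (\<Sum>z\<in>unity_roots p. U (z * s))"
      proof (rule sum.cong[OF refl])
        fix z assume z: "z \<in> unity_roots p"
        hence "z \<noteq> 0" using p0 by (auto simp: power_0_left)
        moreover have zs: "(z * s) ^ p = q" using z by (simp add: power_mult_distrib sq)
        moreover have "(z * s) ^ p = z * s * (z * s) ^ (p - 1)" using p0 by (cases p) auto
        ultimately have "q / (z * s) = (z * s) ^ (p - 1)" using nz by (simp add: field_simps)
        thus "q * (j_disc (z * s) / (z * s)) = U (z * s)"
          unfolding U_def by (metis times_divide_eq_left times_divide_eq_right)
      qed
      finally show ?thesis .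
    qed
    moreover have "f \<tau> = (\<Sum>i<p. j_inv (hecke_pt p i \<tau>)) + j_inv (hecke_pt p p \<tau>)"
      unfolding f_def by (simp flip: lessThan_Suc_atMost)
    moreover have "q ^ p = q ^ (p - 1) * q" using p0 by (cases p) auto
    ultimately have "f \<tau> * q ^ p = q ^ (p - 1) * (\<Sum>z\<in>unity_roots p. U (z * s)) + j_inv (hecke_pt p p \<tau>) * q ^ p"
      by (metis distrib_right mult.assoc mult.commute)
    thus ?thesis
      unfolding F_def s_def[symmetric] q_def[symmetric] sq jp by (simp only: add.commute)
  qed
  obtain G where G: "int_hol G" "\<And>\<tau>. Im \<tau> > 0 \<Longrightarrow> f \<tau> * qexp \<tau> ^ p = G (qexp \<tau>)"
    using q_expansion_from_root[OF hol _ intF p0 key] inv unfolding modular_invariant_def by metis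
  obtain P where P: "\<forall>i. coeff P i \<in> \<int>" "\<And>\<tau>. Im \<tau> > 0 \<Longrightarrow> f \<tau> = poly P (j_inv \<tau>)"
    using modular_function_is_polynomial[OF hol inv G(1,2)] by auto
  thus ?thesis by (intro that[of P]) (auto simp: f_def)
qed

section \<open>Injectivity of the j-invariant\<close>

lemma uncountable_open: "open (A :: complex set) \<Longrightarrow> A \<noteq> {} \<Longrightarrow> uncountable A"
  by (metis countable_subset ex_in_conv open_contains_ball uncountable_ball)

lemma j_inv_not_constant: "\<not> j_inv constant_on uhp"
  and j_inv_at_cusp: "filterlim j_inv at_infinity at_cusp"
proof -
  have "isCont j_disc 0"
    using holomorphic_on_imp_continuous_on[OF int_hol_holomorphic[OF int_hol_j_disc]]
    by (simp add: continuous_on_eq_continuous_at)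
  hence "((\<lambda>\<tau>. j_disc (qexp \<tau>)) \<longlongrightarrow> 1) at_cusp"
    by (intro filterlim_compose[OF _ filterlim_qexp_cusp]) (simp add: isCont_def j_disc_0)
  hence "filterlim (\<lambda>\<tau>. j_disc (qexp \<tau>) / qexp \<tau>) at_infinity at_cusp"
    using filterlim_qexp_cusp by (intro filterlim_divide_at_infinity) auto
  moreover have "eventually (\<lambda>\<tau>. j_disc (qexp \<tau>) / qexp \<tau> = j_inv \<tau>) at_cusp"
    by (rule eventually_at_cuspI[of 1]) (simp add: j_inv_eq)
  ultimately show *: "filterlim j_inv at_infinity at_cusp"
    by (simp cong: filterlim_cong)
  show "\<not> j_inv constant_on uhp"
  proof
    assume "j_inv constant_on uhp"
    then obtain c where c: "\<And>\<tau>. Im \<tau> > 0 \<Longrightarrow> j_inv \<tau> = c" by (auto simp: constant_on_def)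
    have "eventually (\<lambda>\<tau>. norm (j_inv \<tau>) \<ge> norm c + 1) at_cusp"
      using * by (simp add: filterlim_at_infinity[of "norm c"])
    moreover have "eventually (\<lambda>\<tau>. Im \<tau> > 0) at_cusp" by (rule eventually_at_cuspI[of 1]) auto
    ultimately have "eventually (\<lambda>\<tau>. False) at_cusp"
      by eventually_elim (use c in auto)
    thus False by simp
  qed
qed

text \<open>If c were omitted, 1 / (j - c) would be a modular function vanishing at the cusp, hence
  0. The preimage is moved to the fundamental domain so that its quadratic form is reduced.\<close>

lemma j_inv_surj:
  obtains \<tau> where "Im \<tau> > 0" "j_inv \<tau> = c" "\<bar>Re \<tau>\<bar> \<le> 1/2" "norm \<tau> \<ge> 1"
proof -
  have "\<exists>\<tau>. Im \<tau> > 0 \<and> j_inv \<tau> = c"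
  proof (rule ccontr)
    assume *: "\<not> (\<exists>\<tau>. Im \<tau> > 0 \<and> j_inv \<tau> = c)"
    define f where "f = (\<lambda>\<tau>. inverse (j_inv \<tau> - c))"
    have "f holomorphic_on uhp"
      unfolding f_def using * by (intro holomorphic_intros j_inv_holomorphic) auto
    moreover have "modular_invariant f"
      using modular_invariant_j_inv by (auto simp: modular_invariant_def f_def)
    moreover have "(f \<longlongrightarrow> 0) at_cusp"
    proof -
      have "filterlim (\<lambda>\<tau>. j_inv \<tau> + (-c)) at_infinity at_cusp"
        by (rule tendsto_add_filterlim_at_infinity'[OF j_inv_at_cusp]) auto
      hence "filterlim (\<lambda>\<tau>. inverse (j_inv \<tau> + (-c))) (nhds 0) at_cusp"
        by (rule filterlim_compose[OF tendsto_inverse_0])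
      thus ?thesis by (simp add: f_def)
    qed
    ultimately have "f \<i> = 0" by (intro modular_invariant_vanishing) auto
    moreover have "j_inv \<i> \<noteq> c" using * by (metis imaginary_unit.simps(2) zero_less_one)
    ultimately show False by (simp add: f_def)
  qed
  then obtain \<tau> where \<tau>: "Im \<tau> > 0" "j_inv \<tau> = c" by blast
  obtain \<tau>' where \<tau>': "modular_equiv \<tau> \<tau>'" "\<bar>Re \<tau>'\<bar> \<le> 1/2" "norm \<tau>' \<ge> 1"
    using modular_reduction[OF \<tau>(1)] .
  have "j_inv \<tau>' = c"
    using modular_invariant_equiv[OF modular_invariant_j_inv \<tau>'(1) \<tau>(1)] \<tau>(2) by simp
  thus ?thesis using that modular_equiv_Im_pos[OF \<tau>'(1) \<tau>(1)] \<tau>' by blast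
qed

lemma abs_int_coeff_bounds:
  fixes a b :: int
  assumes "norm (of_int a * z + of_int b) \<le> R" "Im z \<ge> m" "m > 0" "norm z \<le> L"
  shows "\<bar>real_of_int a\<bar> \<le> R / m" "\<bar>real_of_int b\<bar> \<le> R + R / m * L"
proof -
  have "\<bar>Im (of_int a * z + of_int b)\<bar> \<le> R"
    using abs_Im_le_cmod assms(1) by (rule order.trans)
  hence "\<bar>of_int a\<bar> * Im z \<le> R" using assms by (simp add: abs_mult)
  moreover have "\<bar>real_of_int a\<bar> * m \<le> \<bar>of_int a\<bar> * Im z"
    using assms by (intro mult_left_mono) auto
  ultimately show a: "\<bar>real_of_int a\<bar> \<le> R / m" using assms by (simp add: field_simps)
  have "R \<ge> 0" using assms(1) norm_ge_zero order.trans by blast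
  have "norm (of_int b :: complex) \<le> norm (of_int a * z + of_int b) + norm (of_int a * z)"
    using norm_triangle_ineq4[of "of_int a * z + of_int b" "of_int a * z"] by simp
  also have "\<dots> \<le> R + R / m * L"
    using assms a \<open>R \<ge> 0\<close> by (auto simp: norm_mult simp del: times_divide_eq_left intro!: add_mono mult_mono)
  finally show "\<bar>real_of_int b\<bar> \<le> R + R / m * L" by simp
qed

text \<open>Only finitely many matrices can carry a point near \<open>\<tau>1\<close> to a point
  near \<open>\<tau>2\<close>, and each of them is excluded near the pair by continuity.\<close>

lemma properly_discontinuous:
  assumes \<tau>: "Im \<tau>1 > 0" "Im \<tau>2 > 0" and ne: "\<not> modular_equiv \<tau>1 \<tau>2"
  obtains U1 U2 where "open U1" "open U2" "\<tau>1 \<in> U1" "\<tau>2 \<in> U2" "U1 \<subseteq> uhp" "U2 \<subseteq> uhp"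
    "\<And>z1 z2. z1 \<in> U1 \<Longrightarrow> z2 \<in> U2 \<Longrightarrow> \<not> modular_equiv z1 z2"
proof -
  define m where "m = min (Im \<tau>1) (Im \<tau>2) / 2"
  have m: "m > 0" using \<tau> by (simp add: m_def)
  define L where "L = max (norm \<tau>1) (norm \<tau>2) + m"
  have near: "Im z \<ge> m \<and> norm z \<le> L" if "z \<in> ball \<tau>1 m \<or> z \<in> ball \<tau>2 m" for z
  proof -
    from that obtain t where t: "t = \<tau>1 \<or> t = \<tau>2" "norm (z - t) < m" by (auto simp: dist_norm norm_minus_commute)
    have "\<bar>Im (z - t)\<bar> < m" using abs_Im_le_cmod t(2) by (rule order.strict_trans1)
    moreover have "Im t \<ge> 2 * m" using t(1) by (auto simp: m_def)
    moreover have "norm z \<le> norm t + norm (z - t)" using norm_triangle_ineq[of t "z - t"] by simp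
    moreover have "norm t \<le> max (norm \<tau>1) (norm \<tau>2)" using t(1) by auto
    ultimately show ?thesis using t(2) by (auto simp: L_def)
  qed
  \<comment> \<open>Bounds |c z1 + d|, whose square is Im z1 / Im z2 and thus at most L / m.\<close>
  define R where "R = sqrt (L / m)"
  have "L > 0" using m by (simp add: L_def) (smt (verit) norm_ge_zero)
  \<comment> \<open>R (1 + L) bounds the denominator as well as the numerator, which is z2 times the
    denominator. The bound for the four entries follows from
    \<open>abs_int_coeff_bounds\<close>.\<close>
  define B where "B = R * (1 + L) + (R * (1 + L)) / m * (1 + L)"
  define N where "N = \<lceil>B\<rceil>"
  define F where "F = {-N..N} \<times> {-N..N} \<times> {-N..N} \<times> {-N..N} \<inter> {(a, b, c, d). a * d - b * c = 1}"
  have "finite F" unfolding F_def by blast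
  have inF: "(a, b, c, d) \<in> F"
    if z: "z1 \<in> ball \<tau>1 m" "z2 \<in> ball \<tau>2 m" and M: "a * d - b * c = 1"
      "z2 = (of_int a * z1 + of_int b) / (of_int c * z1 + of_int d)" for a b c d z1 z2
  proof -
    have z1: "Im z1 \<ge> m" "norm z1 \<le> L" and z2: "Im z2 \<ge> m" "norm z2 \<le> L"
      using near z by auto
    have nz: "of_int c * z1 + of_int d \<noteq> 0"
      using M(1) m z1 by (intro moebius_denominator_nonzero) auto
    define w where "w = of_int c * z1 + of_int d"
    have "Im z2 * norm w ^ 2 = Im z1"
      unfolding M(2) Im_moebius M(1) w_def using nz by simp
    also have "\<dots> \<le> L" using z1(2) abs_Im_le_cmod[of z1] by linarith
    finally have "m * norm w ^ 2 \<le> L"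
      using z2(1) by (meson mult_right_mono order.trans zero_le_power2)
    hence "norm w ^ 2 \<le> L / m" using m by (simp add: field_simps)
    hence w: "norm w \<le> R" unfolding R_def by (rule real_le_rsqrt)
    have R0: "R \<ge> 0" using w norm_ge_zero order.trans by blast
    have "of_int a * z1 + of_int b = z2 * w" using M(2) nz by (simp add: w_def)
    hence ab: "norm (of_int a * z1 + of_int b) \<le> L * R"
      using z2(2) w by (auto simp: norm_mult intro!: mult_mono order.trans[OF norm_ge_zero z2(2)])
    have le: "R \<le> R * (1 + L)" "L * R \<le> R * (1 + L)" using R0 \<open>L > 0\<close> by (simp_all add: algebra_simps)
    have "\<bar>real_of_int x\<bar> \<le> B \<and> \<bar>real_of_int y\<bar> \<le> B" if xy: "norm (of_int x * z1 + of_int y) \<le> R * (1 + L)" for x y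
    proof -
      define Q where "Q = R * (1 + L)"
      have Q: "Q \<ge> 0" using R0 \<open>L > 0\<close> by (simp add: Q_def)
      have "Q / m \<le> Q / m * (1 + L)" "Q / m * L \<le> Q / m * (1 + L)"
        using Q m \<open>L > 0\<close> by (simp_all add: ring_distribs)
      moreover have "B = Q + Q / m * (1 + L)" by (simp add: B_def Q_def)
      ultimately show ?thesis
        using abs_int_coeff_bounds[OF xy[folded Q_def] z1(1) m z1(2)] Q by linarith
    qed
    from this[of a b] this[of c d] have "\<bar>real_of_int a\<bar> \<le> B" "\<bar>real_of_int b\<bar> \<le> B" "\<bar>real_of_int c\<bar> \<le> B" "\<bar>real_of_int d\<bar> \<le> B"
      using ab w le unfolding w_def by auto
    hence "\<bar>a\<bar> \<le> N" "\<bar>b\<bar> \<le> N" "\<bar>c\<bar> \<le> N" "\<bar>d\<bar> \<le> N"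
      by (simp_all add: N_def le_ceiling_iff)
    thus ?thesis using M(1) by (auto simp: F_def)
  qed
  define E where "E = (\<lambda>p::complex \<times> complex. \<forall>(a, b, c, d)\<in>F. snd p \<noteq> (of_int a * fst p + of_int b) / (of_int c * fst p + of_int d))"
  have "eventually E (nhds (\<tau>1, \<tau>2))"
    unfolding E_def
  proof (rule eventually_ball_finite[OF \<open>finite F\<close>], clarify)
    fix a b c d assume F: "(a, b, c, d) \<in> F"
    hence det: "a * d - b * c = 1" by (auto simp: F_def)
    have "of_int c * \<tau>1 + of_int d \<noteq> 0"
      using det \<tau> by (intro moebius_denominator_nonzero) auto
    hence "((\<lambda>p. snd p - (of_int a * fst p + of_int b) / (of_int c * fst p + of_int d)) \<longlongrightarrow>
        snd (\<tau>1, \<tau>2) - (of_int a * fst (\<tau>1, \<tau>2) + of_int b) / (of_int c * fst (\<tau>1, \<tau>2) + of_int d)) (nhds (\<tau>1, \<tau>2))"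
      by (intro tendsto_intros filterlim_ident) auto
    moreover have "snd (\<tau>1, \<tau>2) - (of_int a * fst (\<tau>1, \<tau>2) + of_int b) / (of_int c * fst (\<tau>1, \<tau>2) + of_int d) \<noteq> 0"
      using ne det unfolding modular_equiv_def by auto
    ultimately have "eventually (\<lambda>p. snd p - (of_int a * fst p + of_int b) / (of_int c * fst p + of_int d) \<noteq> 0) (nhds (\<tau>1, \<tau>2))"
      by (rule tendsto_imp_eventually_ne)
    thus "eventually (\<lambda>p. snd p \<noteq> (of_int a * fst p + of_int b) / (of_int c * fst p + of_int d)) (nhds (\<tau>1, \<tau>2))"
      by eventually_elim simp
  qed
  then obtain A where A: "open A" "(\<tau>1, \<tau>2) \<in> A" "\<And>p. p \<in> A \<Longrightarrow> E p"
    unfolding eventually_nhds by blast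
  obtain V1 V2 where V: "open V1" "open V2" "(\<tau>1, \<tau>2) \<in> V1 \<times> V2" "V1 \<times> V2 \<subseteq> A"
    using open_prod_elim[OF A(1,2)] by metis
  show ?thesis
  proof (rule that)
    show "open (V1 \<inter> ball \<tau>1 m \<inter> uhp)" "open (V2 \<inter> ball \<tau>2 m \<inter> uhp)"
      by (intro open_Int V open_ball open_uhp)+
    show "\<tau>1 \<in> V1 \<inter> ball \<tau>1 m \<inter> uhp" "\<tau>2 \<in> V2 \<inter> ball \<tau>2 m \<inter> uhp" using V m \<tau> by auto
    fix z1 z2 assume z: "z1 \<in> V1 \<inter> ball \<tau>1 m \<inter> uhp" "z2 \<in> V2 \<inter> ball \<tau>2 m \<inter> uhp"
    have "E (z1, z2)" using A(3) V(4) z by blast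
    thus "\<not> modular_equiv z1 z2"
      using inF[of z1 z2] z unfolding modular_equiv_def E_def by fastforce
  qed auto
qed

text \<open>1/j = q / \<open>j_disc\<close> q has derivative 1 at q = 0, so it is injective for
  small q; equal values of q mean points that differ by a translation.\<close>

lemma j_inv_injective_near_cusp:
  obtains Y where "Y > 0"
    "\<And>\<tau>1 \<tau>2. Im \<tau>1 \<ge> Y \<Longrightarrow> Im \<tau>2 \<ge> Y \<Longrightarrow> j_inv \<tau>1 = j_inv \<tau>2 \<Longrightarrow> modular_equiv \<tau>1 \<tau>2"
proof -
  define K where "K = j_disc"
  have holK: "K holomorphic_on ball 0 1" unfolding K_def by (rule int_hol_holomorphic[OF int_hol_j_disc])
  have K0: "K 0 = 1" by (simp add: K_def j_disc_0)
  have "continuous_on (ball 0 1) K" by (rule holomorphic_on_imp_continuous_on[OF holK])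
  hence "open (ball 0 1 \<inter> K -` (- {0}))"
    by (intro continuous_open_preimage) auto
  then obtain r where r: "r > 0" "ball 0 r \<subseteq> ball 0 1 \<inter> K -` (- {0})"
    using K0 unfolding open_contains_ball by (metis (no_types, lifting) ComplI IntI centre_in_ball singletonD vimage_eq zero_less_one zero_neq_one)
  define g where "g = (\<lambda>q. q / K q)"
  have hol: "g holomorphic_on ball 0 r"
    unfolding g_def using r by (intro holomorphic_intros holomorphic_on_subset[OF holK]) auto
  have "(K has_field_derivative deriv K 0) (at 0)"
    by (rule holomorphic_derivI[OF holK]) auto
  hence "(g has_field_derivative 1) (at 0)"
    unfolding g_def by (auto intro!: derivative_eq_intros simp: K0)
  hence "deriv g 0 \<noteq> 0" by (simp add: DERIV_imp_deriv)
  then obtain e where e: "e > 0" "inj_on g (ball 0 e)"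
    using has_complex_derivative_locally_injective[OF hol, of 0] r(1) by auto
  have "(qexp \<longlongrightarrow> 0) at_cusp" using filterlim_qexp_cusp by (simp add: filterlim_at)
  from order_tendstoD(2)[OF tendsto_norm[OF this], of e] e(1)
  have "eventually (\<lambda>\<tau>. norm (qexp \<tau>) < e) at_cusp" by simp
  then obtain Y where Y: "Y > 0" "\<And>\<tau>. Im \<tau> \<ge> Y \<Longrightarrow> norm (qexp \<tau>) < e"
    using eventually_at_cuspD by blast
  show ?thesis
  proof (rule that[OF Y(1)])
    fix \<tau>1 \<tau>2 assume *: "Im \<tau>1 \<ge> Y" "Im \<tau>2 \<ge> Y" "j_inv \<tau>1 = j_inv \<tau>2"
    have g: "g (qexp \<tau>) = inverse (j_inv \<tau>)" if "Im \<tau> \<ge> Y" for \<tau>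
      using j_inv_eq[of \<tau>] Y(1) that by (simp add: g_def K_def)
    have "qexp \<tau>1 = qexp \<tau>2"
    proof (rule inj_onD[OF e(2)])
      show "g (qexp \<tau>1) = g (qexp \<tau>2)" unfolding g[OF *(1)] g[OF *(2)] *(3) ..
      show "qexp \<tau>1 \<in> ball 0 e" "qexp \<tau>2 \<in> ball 0 e" using Y(2)[OF *(1)] Y(2)[OF *(2)] by simp_all
    qed
    hence "exp (2 * pi * \<i> * \<tau>2) = exp (2 * pi * \<i> * \<tau>1)" by (simp add: qexp_exp)
    from iffD1[OF exp_eq this] obtain n :: int where "2 * pi * \<i> * \<tau>2 = 2 * pi * \<i> * \<tau>1 + 2 * of_int n * pi * \<i>"
      by (auto simp: mult_ac)
    hence "(2 * pi * \<i>) * \<tau>2 = (2 * pi * \<i>) * (\<tau>1 + of_int n)" by (simp add: algebra_simps)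
    hence "\<tau>2 = \<tau>1 + of_int n" by (rule mult_left_cancel[THEN iffD1, rotated]) simp
    thus "modular_equiv \<tau>1 \<tau>2"
      unfolding modular_equiv_def by (intro exI[of _ 1] exI[of _ n] exI[of _ 0]) auto
  qed
qed

text \<open>Local injectivity fails at critical points, so their values are set aside. A countable
  set can be removed from the plane without disconnecting it.\<close>

lemma countable_j_inv_critical_values: "countable (j_inv ` {\<tau>\<in>uhp. deriv j_inv \<tau> = 0})"
proof (intro countable_image)
  have hol: "deriv j_inv holomorphic_on uhp"
    by (intro holomorphic_deriv j_inv_holomorphic) auto
  show "countable {\<tau>\<in>uhp. deriv j_inv \<tau> = 0}"
  proof (cases "deriv j_inv constant_on uhp")
    case False
    \<comment> \<open>A countable union of closed half planes, so the upper half plane is an F-sigma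
      set, as the theorem on countable zero sets requires.\<close>
    have "uhp = (\<Union>n. {\<tau>. Im \<tau> \<ge> inverse (real (Suc n))})"
    proof (intro equalityI subsetI)
      fix x assume "x \<in> uhp"
      then obtain n where "inverse (real (Suc n)) < Im x" using reals_Archimedean[of "Im x"] by auto
      thus "x \<in> (\<Union>n. {\<tau>. Im \<tau> \<ge> inverse (real (Suc n))})" by (auto intro!: exI[of _ n])
    next
      fix x assume "x \<in> (\<Union>n. {\<tau>. Im \<tau> \<ge> inverse (real (Suc n))})"
      then obtain n where "Im x \<ge> inverse (real (Suc n))" by blast
      moreover have "inverse (real (Suc n)) > 0" by simp
      ultimately have "Im x > 0" by linarith
      thus "x \<in> uhp" by simp
    qed
    moreover have "fsigma (\<Union>n. {\<tau>. Im \<tau> \<ge> inverse (real (Suc n))})"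
      by (intro fsigma.intros closed_halfspace_Im_ge)
    ultimately have "fsigma uhp" by (simp only:)
    from holomorphic_countable_zeros[OF hol open_uhp connected_uhp this False] show ?thesis by simp
  next
    case True
    then obtain c where c: "\<And>\<tau>. \<tau> \<in> uhp \<Longrightarrow> deriv j_inv \<tau> = c" by (auto simp: constant_on_def)
    have "c \<noteq> 0"
    proof
      assume "c = 0"
      hence "(j_inv has_field_derivative 0) (at \<tau>)" if "\<tau> \<in> uhp" for \<tau>
        using holomorphic_derivI[OF j_inv_holomorphic open_uhp that] c[OF that] by simp
      hence "j_inv constant_on uhp"
        unfolding constant_on_def
        by (intro has_field_derivative_0_imp_constant_on[unfolded constant_on_def]) auto
      thus False using j_inv_not_constant by blast
    qed
    hence "{\<tau>\<in>uhp. deriv j_inv \<tau> = 0} = {}" using c by auto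
    thus ?thesis by (simp only: countable_empty)
  qed
qed

lemma j_inv_compact_sublevel:
  obtains Y where "\<And>\<tau>. Im \<tau> \<ge> Y \<Longrightarrow> norm (j_inv \<tau>) > B"
proof -
  have "eventually (\<lambda>\<tau>. norm (j_inv \<tau>) \<ge> \<bar>B\<bar> + 1) at_cusp"
    using j_inv_at_cusp filterlim_at_infinity[of 0 j_inv at_cusp] by simp
  then obtain Y where "\<And>\<tau>. Im \<tau> \<ge> Y \<Longrightarrow> norm (j_inv \<tau>) \<ge> \<bar>B\<bar> + 1"
    using eventually_at_cuspD by blast
  hence "\<And>\<tau>. Im \<tau> \<ge> Y \<Longrightarrow> norm (j_inv \<tau>) > B" by force
  thus ?thesis by (rule that)
qed

text \<open>This set is open by the open mapping theorem, relatively closed off the countable set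
  \<open>j ` {j' = 0}\<close>, and misses a neighbourhood of infinity because \<open>1/j\<close> is a local coordinate at
  the cusp. Hence it is empty.\<close>

definition j_multiple_values :: "complex set" where
  "j_multiple_values = {c. \<exists>\<tau>1 \<tau>2. Im \<tau>1 > 0 \<and> Im \<tau>2 > 0 \<and> j_inv \<tau>1 = c \<and> j_inv \<tau>2 = c \<and> \<not> modular_equiv \<tau>1 \<tau>2}"

lemma j_multiple_values_reduced:
  assumes "c \<in> j_multiple_values"
  obtains \<tau>1 \<tau>2 where "\<bar>Re \<tau>1\<bar> \<le> 1/2" "Im \<tau>1 \<ge> 1/2" "\<bar>Re \<tau>2\<bar> \<le> 1/2" "Im \<tau>2 \<ge> 1/2"
    "j_inv \<tau>1 = c" "j_inv \<tau>2 = c" "\<not> modular_equiv \<tau>1 \<tau>2"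
proof -
  from assms obtain \<tau>1 \<tau>2 where *: "Im \<tau>1 > 0" "Im \<tau>2 > 0" "j_inv \<tau>1 = c" "j_inv \<tau>2 = c" "\<not> modular_equiv \<tau>1 \<tau>2"
    by (auto simp: j_multiple_values_def)
  obtain t1 where t1: "modular_equiv \<tau>1 t1" "\<bar>Re t1\<bar> \<le> 1/2" "norm t1 \<ge> 1" using modular_reduction[OF *(1)] .
  obtain t2 where t2: "modular_equiv \<tau>2 t2" "\<bar>Re t2\<bar> \<le> 1/2" "norm t2 \<ge> 1" using modular_reduction[OF *(2)] .
  have pos: "Im t1 > 0" "Im t2 > 0" using modular_equiv_Im_pos t1(1) t2(1) * by blast+
  have "j_inv t1 = c" "j_inv t2 = c"
    using modular_invariant_equiv[OF modular_invariant_j_inv] t1(1) t2(1) * by metis+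
  moreover have "\<not> modular_equiv t1 t2"
    using *(5) modular_equiv_trans modular_equiv_sym t1(1) t2(1) *(1,2) pos by metis
  ultimately show ?thesis
    using fundamental_domain_Im[OF t1(2,3) pos(1)] fundamental_domain_Im[OF t2(2,3) pos(2)] t1 t2 by (intro that[of t1 t2])
qed

lemma open_j_multiple_values: "open j_multiple_values"
proof (subst open_subopen, intro ballI)
  fix c assume "c \<in> j_multiple_values"
  then obtain \<tau>1 \<tau>2 where *: "Im \<tau>1 > 0" "Im \<tau>2 > 0" "j_inv \<tau>1 = c" "j_inv \<tau>2 = c" "\<not> modular_equiv \<tau>1 \<tau>2"
    by (auto simp: j_multiple_values_def)
  obtain U1 U2 where U: "open U1" "open U2" "\<tau>1 \<in> U1" "\<tau>2 \<in> U2" "U1 \<subseteq> uhp" "U2 \<subseteq> uhp"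
    "\<And>z1 z2. z1 \<in> U1 \<Longrightarrow> z2 \<in> U2 \<Longrightarrow> \<not> modular_equiv z1 z2"
    using properly_discontinuous[OF *(1,2,5)] by blast
  have "open (j_inv ` U1)" "open (j_inv ` U2)"
    by (rule open_mapping_thm[OF j_inv_holomorphic open_uhp connected_uhp U(1) U(5) j_inv_not_constant]
        open_mapping_thm[OF j_inv_holomorphic open_uhp connected_uhp U(2) U(6) j_inv_not_constant])+
  moreover have "c \<in> j_inv ` U1 \<inter> j_inv ` U2" using imageI[OF U(3), of j_inv] imageI[OF U(4), of j_inv] *(3,4) by simp
  moreover have "j_inv ` U1 \<inter> j_inv ` U2 \<subseteq> j_multiple_values"
  proof
    fix x assume "x \<in> j_inv ` U1 \<inter> j_inv ` U2"
    then obtain z1 z2 where "z1 \<in> U1" "z2 \<in> U2" "j_inv z1 = x" "j_inv z2 = x" by auto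
    thus "x \<in> j_multiple_values" using U(5-7) unfolding j_multiple_values_def by blast
  qed
  ultimately show "\<exists>T. open T \<and> c \<in> T \<and> T \<subseteq> j_multiple_values"
    by (intro exI[of _ "j_inv ` U1 \<inter> j_inv ` U2"]) auto
qed

text \<open>Reduced preimage pairs of a bounded sequence stay in a compact set and have a limit
  pair. If its two points were equivalent, moving one by the matrix would put both preimages next to
  \<open>\<tau>1\<close>, where j is injective because its derivative is nonzero; late pairs would
  then be equivalent.\<close>

lemma j_multiple_values_closed_off_critical:
  assumes c: "\<And>n. c n \<in> j_multiple_values" and lim: "c \<longlonglongrightarrow> l"
    and l: "l \<notin> j_inv ` {\<tau>\<in>uhp. deriv j_inv \<tau> = 0}"
  shows "l \<in> j_multiple_values"
proof -
  have "\<exists>z. \<bar>Re (fst z)\<bar> \<le> 1/2 \<and> Im (fst z) \<ge> 1/2 \<and> \<bar>Re (snd z)\<bar> \<le> 1/2 \<and> Im (snd z) \<ge> 1/2 \<and>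
      j_inv (fst z) = c n \<and> j_inv (snd z) = c n \<and> \<not> modular_equiv (fst z) (snd z)" for n
    using j_multiple_values_reduced[OF c[of n]] by (metis fst_conv snd_conv)
  then obtain z where z: "\<And>n. \<bar>Re (fst (z n))\<bar> \<le> 1/2" "\<And>n. Im (fst (z n)) \<ge> 1/2"
      "\<And>n. \<bar>Re (snd (z n))\<bar> \<le> 1/2" "\<And>n. Im (snd (z n)) \<ge> 1/2"
      "\<And>n. j_inv (fst (z n)) = c n" "\<And>n. j_inv (snd (z n)) = c n" "\<And>n. \<not> modular_equiv (fst (z n)) (snd (z n))"
    by metis
  have "Bseq c" using lim convergentI convergent_imp_Bseq by blast
  then obtain B where B: "\<And>n. norm (c n) \<le> B" by (auto simp: Bseq_def)
  obtain Y where Y: "\<And>\<tau>. Im \<tau> \<ge> Y \<Longrightarrow> norm (j_inv \<tau>) > B"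
    using j_inv_compact_sublevel[of B] by blast
  define K where "K = {\<tau>. \<bar>Re \<tau>\<bar> \<le> 1/2 \<and> 1/2 \<le> Im \<tau> \<and> Im \<tau> \<le> Y}"
  have "z n \<in> K \<times> K" for n
    using z(1-6)[of n] B[of n] Y[of "fst (z n)"] Y[of "snd (z n)"] by (force simp: K_def mem_Times_iff)
  moreover have "compact (K \<times> K)" unfolding K_def by (intro compact_Times compact_truncated_domain)
  ultimately obtain w r where w: "w \<in> K \<times> K" "strict_mono r" "(z \<circ> r) \<longlonglongrightarrow> w"
    unfolding compact_def by blast
  define \<tau>1 \<tau>2 where "\<tau>1 = fst w" and "\<tau>2 = snd w"
  have K\<tau>: "\<tau>1 \<in> K" "\<tau>2 \<in> K" using w by (auto simp: \<tau>1_def \<tau>2_def mem_Times_iff)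
  hence pos: "Im \<tau>1 > 0" "Im \<tau>2 > 0" by (auto simp: K_def)
  have l1: "(\<lambda>n. fst (z (r n))) \<longlonglongrightarrow> \<tau>1" and l2: "(\<lambda>n. snd (z (r n))) \<longlonglongrightarrow> \<tau>2"
    using tendsto_fst[OF w(3)] tendsto_snd[OF w(3)] by (simp_all add: o_def \<tau>1_def \<tau>2_def)
  have lc: "(\<lambda>n. c (r n)) \<longlonglongrightarrow> l" using LIMSEQ_subseq_LIMSEQ[OF lim w(2)] by (simp add: o_def)
  have cont: "isCont j_inv \<tau>" if "Im \<tau> > 0" for \<tau>
    using holomorphic_on_imp_continuous_on[OF j_inv_holomorphic] that
    by (simp add: continuous_on_eq_continuous_at)
  have "(\<lambda>n. c (r n)) \<longlonglongrightarrow> j_inv \<tau>1" "(\<lambda>n. c (r n)) \<longlonglongrightarrow> j_inv \<tau>2"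
    using isCont_tendsto_compose[OF cont[OF pos(1)] l1] isCont_tendsto_compose[OF cont[OF pos(2)] l2] z(5,6) by simp_all
  hence j: "j_inv \<tau>1 = l" "j_inv \<tau>2 = l" using lc LIMSEQ_unique by blast+
  show ?thesis
  proof (cases "modular_equiv \<tau>1 \<tau>2")
    case False
    thus ?thesis using j pos by (auto simp: j_multiple_values_def)
  next
    case True
    hence "modular_equiv \<tau>2 \<tau>1" using modular_equiv_sym pos by blast
    then obtain a b c' d :: int where M: "a * d - b * c' = 1" "\<tau>1 = (of_int a * \<tau>2 + of_int b) / (of_int c' * \<tau>2 + of_int d)"
      by (auto simp: modular_equiv_def)
    define g where "g = (\<lambda>x. (of_int a * x + of_int b) / (of_int c' * x + of_int d) :: complex)"
    have "of_int c' * \<tau>2 + of_int d \<noteq> 0" using M pos by (intro moebius_denominator_nonzero) auto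
    hence lg: "(\<lambda>n. g (snd (z (r n)))) \<longlonglongrightarrow> \<tau>1"
      unfolding M(2) g_def by (intro tendsto_intros l2)
    have "deriv j_inv \<tau>1 \<noteq> 0" using l j(1) pos(1) by auto
    then obtain e where e: "e > 0" "ball \<tau>1 e \<subseteq> uhp" "inj_on j_inv (ball \<tau>1 e)"
      using has_complex_derivative_locally_injective[OF j_inv_holomorphic _ open_uhp, of \<tau>1] pos by auto
    have "eventually (\<lambda>n. fst (z (r n)) \<in> ball \<tau>1 e \<and> g (snd (z (r n))) \<in> ball \<tau>1 e) sequentially"
      using tendstoD[OF l1 e(1)] tendstoD[OF lg e(1)] by eventually_elim (auto simp: dist_commute)
    then obtain n where n: "fst (z (r n)) \<in> ball \<tau>1 e" "g (snd (z (r n))) \<in> ball \<tau>1 e"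
      by (auto simp: eventually_sequentially)
    have p2: "Im (snd (z (r n))) > 0" using z(4)[of "r n"] by simp
    have eq: "modular_equiv (snd (z (r n))) (g (snd (z (r n))))"
      using M(1) unfolding modular_equiv_def g_def by blast
    have "j_inv (g (snd (z (r n)))) = j_inv (snd (z (r n)))"
      by (rule modular_invariant_equiv[OF modular_invariant_j_inv eq p2])
    hence "fst (z (r n)) = g (snd (z (r n)))"
      by (intro inj_onD[OF e(3) _ n]) (simp only: z(5,6))
    hence "modular_equiv (fst (z (r n))) (snd (z (r n)))"
      using modular_equiv_sym[OF eq p2] by simp
    thus ?thesis using z(7) by blast
  qed
qed

theorem j_inv_injective:
  assumes "Im \<tau>1 > 0" "Im \<tau>2 > 0" "j_inv \<tau>1 = j_inv \<tau>2"
  shows "modular_equiv \<tau>1 \<tau>2"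
proof -
  define S where "S = j_multiple_values"
  define R where "R = j_inv ` {\<tau>\<in>uhp. deriv j_inv \<tau> = 0}"
  have R: "countable R" unfolding R_def by (rule countable_j_inv_critical_values)
  obtain Y where Y: "Y > 0"
    "\<And>\<tau>1 \<tau>2. Im \<tau>1 \<ge> Y \<Longrightarrow> Im \<tau>2 \<ge> Y \<Longrightarrow> j_inv \<tau>1 = j_inv \<tau>2 \<Longrightarrow> modular_equiv \<tau>1 \<tau>2"
    using j_inv_injective_near_cusp by blast
  define K where "K = {\<tau>. \<bar>Re \<tau>\<bar> \<le> 1/2 \<and> 1/2 \<le> Im \<tau> \<and> Im \<tau> \<le> Y}"
  have "K \<subseteq> uhp" by (auto simp: K_def)
  hence "bounded (j_inv ` K)"
    unfolding K_def
    by (intro compact_imp_bounded compact_continuous_image compact_truncated_domain holomorphic_on_imp_continuous_on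
        holomorphic_on_subset[OF j_inv_holomorphic]) auto
  then obtain B where B: "\<And>\<tau>. \<tau> \<in> K \<Longrightarrow> norm (j_inv \<tau>) \<le> B" by (auto simp: bounded_iff)
  have bdd: "norm c \<le> B" if "c \<in> S" for c
  proof -
    obtain \<tau>1 \<tau>2 where *: "\<bar>Re \<tau>1\<bar> \<le> 1/2" "Im \<tau>1 \<ge> 1/2" "\<bar>Re \<tau>2\<bar> \<le> 1/2" "Im \<tau>2 \<ge> 1/2"
      "j_inv \<tau>1 = c" "j_inv \<tau>2 = c" "\<not> modular_equiv \<tau>1 \<tau>2"
      using j_multiple_values_reduced \<open>c \<in> S\<close> unfolding S_def by blast
    \<comment> \<open>Two points this high with equal j would be equivalent. So one of them lies in
      \<open>K\<close>, and multiple values are bounded.\<close>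
    have "Im \<tau>1 < Y \<or> Im \<tau>2 < Y" using Y(2)[of \<tau>1 \<tau>2] *(5-7) by force
    hence "\<tau>1 \<in> K \<or> \<tau>2 \<in> K" using * by (auto simp: K_def)
    thus ?thesis using B[of \<tau>1] B[of \<tau>2] *(5,6) by metis
  qed
  have conn: "connected (UNIV - R)"
    using R by (intro connected_open_diff_countable) auto
  have op: "openin (top_of_set (UNIV - R)) (S \<inter> (UNIV - R))"
    using open_j_multiple_values unfolding S_def by (metis Int_commute openin_open_Int)
  have "S \<inter> (UNIV - R) = (UNIV - R) \<inter> closure S"
  proof (intro equalityI subsetI)
    fix l assume l: "l \<in> (UNIV - R) \<inter> closure S"
    then obtain x where "\<And>n. x n \<in> S" "x \<longlonglongrightarrow> l" by (auto simp: closure_sequential)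
    thus "l \<in> S \<inter> (UNIV - R)"
      using j_multiple_values_closed_off_critical[of x l] l by (simp add: S_def R_def)
  qed (use closure_subset in auto)
  hence "closedin (top_of_set (UNIV - R)) (S \<inter> (UNIV - R))"
    by (simp add: closedin_closed_Int)
  hence "S \<inter> (UNIV - R) = {} \<or> S \<inter> (UNIV - R) = UNIV - R"
    using conn op unfolding connected_clopen by blast
  moreover have "S \<inter> (UNIV - R) \<noteq> UNIV - R"
  proof
    assume "S \<inter> (UNIV - R) = UNIV - R"
    hence "x \<in> S" if "x \<notin> R" for x using that by blast
    hence "- cball 0 B \<subseteq> R" using bdd by force
    hence "countable (- cball (0::complex) B)" using R countable_subset by blast
    moreover have "- cball (0::complex) B \<noteq> {}"
    proof -
      have "of_real (\<bar>B\<bar> + 1) \<in> - cball (0::complex) B" by simp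
      thus ?thesis by blast
    qed
    ultimately show False using uncountable_open[of "- cball (0::complex) B"] by (auto simp: open_Compl)
  qed
  ultimately have "S \<subseteq> R" by blast
  hence "countable S" using R countable_subset by blast
  \<comment> \<open>A nonempty open subset of the plane is uncountable.\<close>
  hence "S = {}" using uncountable_open[of S] open_j_multiple_values by (auto simp: S_def)
  thus ?thesis using assms unfolding S_def j_multiple_values_def by blast
qed

section \<open>Complex multiplication and class number one\<close>

text \<open>The minimal polynomial of \<open>x\<close> divides every polynomial in \<open>Ps\<close>, so \<open>x\<close> is its only root.\<close>

lemma rational_unique_common_root:
  fixes Ps :: "complex poly set"
  assumes rat: "\<And>P i. P \<in> Ps \<Longrightarrow> coeff P i \<in> \<rat>" and root: "\<And>P. P \<in> Ps \<Longrightarrow> poly P x = 0"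
    and nz: "\<exists>P\<in>Ps. P \<noteq> 0" and uniq: "\<And>y. (\<And>P. P \<in> Ps \<Longrightarrow> poly P y = 0) \<Longrightarrow> y = x"
  shows "x \<in> \<rat>"
proof -
  define I where "I = {R. (\<forall>i. coeff R i \<in> \<rat>) \<and> poly R x = 0}"
  have "\<exists>R. R \<in> I \<and> R \<noteq> 0" using rat root nz by (auto simp: I_def)
  then obtain m where m: "m \<in> I" "m \<noteq> 0" and min: "\<And>R. R \<in> I \<Longrightarrow> R \<noteq> 0 \<Longrightarrow> degree m \<le> degree R"
    using exists_least_iff[of "\<lambda>n. \<exists>R. R \<in> I \<and> R \<noteq> 0 \<and> degree R = n"] by (metis not_less)
  have dvd: "m dvd R" if "R \<in> I" for R
    using that
  proof (induction "degree R" arbitrary: R rule: less_induct)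
    case less
    show ?case
    proof (cases "R = 0")
      case False
      define n where "n = degree R - degree m"
      have deg: "degree R = degree m + n" using min[OF less.prems False] by (simp add: n_def)
      define c where "c = lead_coeff R / lead_coeff m"
      \<comment> \<open>One step of polynomial division over the rationals: \<open>Q\<close> is a
        multiple of \<open>m\<close> with the degree and leading coefficient of
        \<open>R\<close>.\<close>
      define Q where "Q = monom c n * m"
      have "c \<noteq> 0" using False m(2) by (simp add: c_def)
      have c: "c \<in> \<rat>" using less.prems m(1) by (auto simp: c_def I_def)
      have degQ: "degree Q = degree R"
        unfolding Q_def using m(2) \<open>c \<noteq> 0\<close> by (subst degree_mult_eq) (auto simp: degree_monom_eq deg)
      have leadQ: "lead_coeff Q = lead_coeff R"
        unfolding Q_def lead_coeff_mult using m(2) \<open>c \<noteq> 0\<close> by (simp add: c_def degree_monom_eq)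
      have QI: "R - Q \<in> I"
        using less.prems m(1) c
        by (auto simp: I_def Q_def coeff_monom_mult intro!: Rats_diff Rats_mult)
      have "m dvd R - Q"
      proof (cases "R - Q = 0")
        case False
        have "degree (R - Q) \<le> degree R" using degQ by (intro degree_diff_le) auto
        moreover have "coeff (R - Q) (degree R) = 0" using degQ leadQ by simp
        ultimately have "degree (R - Q) < degree R"
          using False by (metis le_neq_implies_less leading_coeff_0_iff)
        thus ?thesis using QI by (rule less.hyps)
      qed simp
      moreover have "m dvd Q" by (simp add: Q_def)
      ultimately show ?thesis using dvd_add by fastforce
    qed simp
  qed
  have only: "y = x" if "poly m y = 0" for y
  proof (rule uniq)
    fix P assume "P \<in> Ps"
    hence "m dvd P" using rat root by (intro dvd) (auto simp: I_def)
    thus "poly P y = 0" using that by (auto elim!: dvdE)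
  qed
  have mx: "poly m x = 0" using m(1) by (simp add: I_def)
  hence "[:-x, 1:] dvd m" by (simp only: poly_eq_0_iff_dvd)
  then obtain g where g: "m = [:-x, 1:] * g" by (rule dvdE)
  have "g \<noteq> 0" using g m(2) by auto
  have dg: "degree m = Suc (degree g)" using g \<open>g \<noteq> 0\<close> by (simp add: degree_mult_eq del: mult_pCons_left)
  have "degree g = 0"
  proof (rule ccontr)
    assume "degree g \<noteq> 0"
    hence "\<not> constant (poly g)" by (simp add: constant_degree)
    then obtain y where y: "poly g y = 0" using fundamental_theorem_of_algebra by blast
    hence "y = x" using only[of y] g by simp
    with y have "[:-x, 1:] dvd g" by (simp only: poly_eq_0_iff_dvd)
    then obtain h where h: "g = [:-x, 1:] * h" by (rule dvdE)
    \<comment> \<open>If x were a multiple root, the derivative would lie in \<open>I\<close> and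
      have smaller degree. Hence \<open>m\<close> is linear and its root x is rational.\<close>
    have "poly (pderiv m) x = 0"
      unfolding g h by (simp add: pderiv_mult del: mult_pCons_left)
    moreover have "coeff (pderiv m) i \<in> \<rat>" for i
      using m(1) by (auto simp: coeff_pderiv I_def simp del: of_nat_Suc intro!: Rats_mult)
    ultimately have "pderiv m \<in> I" by (simp add: I_def)
    moreover have "degree (pderiv m) < degree m" using dg by (simp add: degree_pderiv)
    moreover have "pderiv m \<noteq> 0" using dg by (simp add: pderiv_eq_0_iff)
    ultimately show False using min by (meson not_less)
  qed
  then obtain c where c: "g = [:c:]" by (rule degree_eq_zeroE)
  have "c \<noteq> 0" using \<open>g \<noteq> 0\<close> c by simp
  have "m = [:- (x * c), c:]" using g c by simp
  hence "c = coeff m 1" "- (x * c) = coeff m 0" by simp_all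
  hence "c \<in> \<rat>" "- (x * c) \<in> \<rat>" using m(1) unfolding I_def by auto
  hence "(0 - (- (x * c))) / c \<in> \<rat>" by (intro Rats_divide Rats_diff Rats_0)
  thus ?thesis using \<open>c \<noteq> 0\<close> by simp
qed

text \<open>The matrix (a, b; c, e) of determinant p fixes \<open>\<tau>\<close>; equivalently,
  multiplication by c tau + e maps the lattice Z + Z tau into itself and has norm p.\<close>

definition endo_norm :: "complex \<Rightarrow> nat \<Rightarrow> bool" where
  "endo_norm \<tau> p \<longleftrightarrow> (\<exists>a b c e :: int. a * e - b * c = int p \<and>
     of_int c * \<tau>\<^sup>2 + of_int (e - a) * \<tau> + of_int (- b) = 0)"

text \<open>Injectivity of j turns the equality of values into a modular matrix. Its product with
  the matrix of the Hecke point fixes the point and has determinant p.\<close>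

lemma endo_norm_of_fixed_hecke_pt:
  assumes p: "p > 0" and \<tau>: "Im \<tau> > 0" and eq: "j_inv (hecke_pt p i \<tau>) = j_inv \<tau>"
  shows "endo_norm \<tau> p"
proof -
  have "modular_equiv (hecke_pt p i \<tau>) \<tau>"
    by (rule j_inv_injective[OF Im_hecke_pt[OF p \<tau>] \<tau> eq])
  then obtain a b c e :: int where M: "a * e - b * c = 1"
    "\<tau> = (of_int a * hecke_pt p i \<tau> + of_int b) / (of_int c * hecke_pt p i \<tau> + of_int e)"
    by (auto simp: modular_equiv_def)
  have "of_int c * hecke_pt p i \<tau> + of_int e \<noteq> 0"
    using M(1) Im_hecke_pt[OF p \<tau>] by (intro moebius_denominator_nonzero) auto
  hence eq: "\<tau> * (of_int c * hecke_pt p i \<tau> + of_int e) = of_int a * hecke_pt p i \<tau> + of_int b"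
    using M(2) by (metis nonzero_divide_eq_eq)
  show ?thesis
  proof (cases "i = p")
    case True
    have "(a * int p) * e - b * (c * int p) = int p * (a * e - b * c)" by (simp add: algebra_simps)
    hence 1: "(a * int p) * e - b * (c * int p) = int p" by (simp add: M(1))
    have 2: "of_int (c * int p) * \<tau>\<^sup>2 + of_int (e - a * int p) * \<tau> + of_int (- b) = 0"
      using eq True by (simp add: hecke_pt_def algebra_simps power2_eq_square)
    show ?thesis unfolding endo_norm_def using 1 2 by blast
  next
    case False
    hence h: "of_nat p * hecke_pt p i \<tau> = \<tau> + of_nat i" using p by (simp add: hecke_pt_def)
    have "\<tau> * (of_int c * (of_nat p * hecke_pt p i \<tau>) + of_nat p * of_int e) =
       of_nat p * (\<tau> * (of_int c * hecke_pt p i \<tau> + of_int e))" by (simp add: algebra_simps)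
    also have "\<dots> = of_int a * (of_nat p * hecke_pt p i \<tau>) + of_nat p * of_int b"
      unfolding eq by (simp add: algebra_simps)
    finally have 2: "of_int c * \<tau>\<^sup>2 + of_int ((c * int i + e * int p) - a) * \<tau> + of_int (- (a * int i + b * int p)) = 0"
      unfolding h by (simp add: algebra_simps power2_eq_square)
    have "a * (c * int i + e * int p) - (a * int i + b * int p) * c = int p * (a * e - b * c)"
      by (simp add: algebra_simps)
    hence 1: "a * (c * int i + e * int p) - (a * int i + b * int p) * c = int p" by (simp add: M(1))
    show ?thesis unfolding endo_norm_def using 1 2 by blast
  qed
qed

lemma quadratic_point_form:
  fixes A B C :: int
  assumes \<tau>: "Im \<tau> > 0" and eq: "of_int A * \<tau>\<^sup>2 + of_int B * \<tau> + of_int C = 0"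
  shows "of_int B = - 2 * of_int A * Re \<tau>" "of_int C = of_int A * norm \<tau> ^ 2"
proof -
  have re: "of_int A * ((Re \<tau>)\<^sup>2 - (Im \<tau>)\<^sup>2) + of_int B * Re \<tau> + of_int C = 0"
    using arg_cong[OF eq, of Re] by (simp add: power2_eq_square)
  have "Im \<tau> * (2 * of_int A * Re \<tau> + of_int B) = 0"
    using arg_cong[OF eq, of Im] by (simp add: algebra_simps power2_eq_square)
  thus B: "of_int B = - 2 * of_int A * Re \<tau>" using \<tau> by auto
  show "of_int C = of_int A * norm \<tau> ^ 2"
    using re unfolding B cmod_power2 by (simp add: algebra_simps power2_eq_square)
qed

text \<open>The real and imaginary parts fix the proportion of the coefficients; Bezout for the
  primitive form makes the factor an integer.\<close>

lemma primitive_form_multiple: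
  fixes A B C c f g :: int
  assumes \<tau>: "Im \<tau> > 0" and eq: "of_int A * \<tau>\<^sup>2 + of_int B * \<tau> + of_int C = 0"
    and A: "A > 0" "gcd A (gcd B C) = 1"
    and eq': "of_int c * \<tau>\<^sup>2 + of_int f * \<tau> + of_int g = 0"
  shows "\<exists>k. c = k * A \<and> f = k * B \<and> g = k * C"
proof -
  note 1 = quadratic_point_form[OF \<tau> eq] and 2 = quadratic_point_form[OF \<tau> eq']
  have "real_of_int (A * f) = real_of_int (c * B)" "real_of_int (A * g) = real_of_int (c * C)"
    by (simp_all add: 1 2)
  hence fB: "A * f = c * B" and gC: "A * g = c * C" by linarith+
  obtain u w where uw: "u * A + w * gcd B C = 1" using bezout_int[of A "gcd B C"] A(2) by auto
  obtain x y where xy: "x * B + y * C = gcd B C" using bezout_int[of B C] by auto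
  have "c = c * (u * A + w * (x * B + y * C))" by (simp add: xy uw)
  also have "\<dots> = A * (u * c) + w * x * (c * B) + w * y * (c * C)" by (simp add: algebra_simps)
  also have "\<dots> = A * (u * c + w * x * f + w * y * g)" unfolding fB[symmetric] gC[symmetric] by (simp add: algebra_simps)
  finally obtain k where k: "c = A * k" by blast
  have "A * f = A * (k * B)" "A * g = A * (k * C)" using fB gC k by (simp_all add: algebra_simps)
  thus ?thesis using A(1) k by (auto simp: mult.commute)
qed

text \<open>\<open>t\<close> is the trace a + e of the fixing matrix, and the last equation compares
  its discriminant with that of the form. For c = 0 the matrix would be scalar and p a
  square.\<close>

lemma endo_norm_form:
  assumes \<tau>: "Im \<tau> > 0" and p: "prime p" and endo: "endo_norm \<tau> p"
  obtains c f g t :: int where "of_int c * \<tau>\<^sup>2 + of_int f * \<tau> + of_int g = 0" "c \<noteq> 0"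
    "t\<^sup>2 + (4 * c * g - f\<^sup>2) = 4 * int p"
proof -
  obtain a b c e :: int where M: "a * e - b * c = int p"
    "of_int c * \<tau>\<^sup>2 + of_int (e - a) * \<tau> + of_int (- b) = 0"
    using endo by (auto simp: endo_norm_def)
  have "c \<noteq> 0"
  proof
    assume c: "c = 0"
    have "real_of_int (e - a) = 0" "real_of_int (- b) = 0"
      using quadratic_point_form[OF \<tau> M(2)] c by simp_all
    hence "e = a" "b = 0" by simp_all
    hence "int p = a ^ 2" using M(1) c by (simp add: power2_eq_square)
    hence "int p = int (nat \<bar>a\<bar> ^ 2)" by simp
    hence "p = nat \<bar>a\<bar> ^ 2" by (simp only: of_nat_eq_iff)
    thus False using p prime_power_iff[of "nat \<bar>a\<bar>" 2] by simp
  qed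
  moreover have "(a + e)\<^sup>2 + (4 * c * (- b) - (e - a)\<^sup>2) = 4 * int p"
    unfolding M(1)[symmetric] by (simp add: power2_eq_square algebra_simps)
  ultimately show ?thesis using that M(2) by blast
qed

section \<open>The points with complex multiplication\<close>

definition cm_point :: "nat \<Rightarrow> complex" where
  "cm_point d = Complex (1/2) (sqrt (real d) / 2)"

lemma Im_cm_point: "d > 0 \<Longrightarrow> Im (cm_point d) > 0"
  by (simp add: cm_point_def)

text \<open>Since 1 - s is the conjugate of s = \<open>cm_point d\<close>, the left side is the norm
  of s + b.\<close>

lemma cm_point_norm_form: "(cm_point d + of_nat b) * (of_nat b + 1 - cm_point d) = of_nat b ^ 2 + of_nat b + (1 + of_nat d) / 4"
  by (simp add: complex_eq_iff cm_point_def power2_eq_square algebra_simps add_divide_distrib)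

lemma j_inv_shift: "Im \<tau> > 0 \<Longrightarrow> j_inv (\<tau> + of_int n) = j_inv \<tau>"
  by (rule periodic_shift_int[where f = j_inv, OF j_inv_plus_1])

text \<open>Class number one enters through the hypotheses \<open>disc\<close> and \<open>form\<close>.\<close>

lemma cm_point_unique:
  assumes \<tau>: "Im \<tau> > 0" "\<bar>Re \<tau>\<bar> \<le> 1/2" "norm \<tau> \<ge> 1"
    and ps: "\<And>p. p \<in> ps \<Longrightarrow> prime p \<and> endo_norm \<tau> p" "ps \<noteq> {}"
    and disc: "\<And>D. D > 0 \<Longrightarrow> (\<And>p. p \<in> ps \<Longrightarrow> \<exists>t k. k > 0 \<and> t * t + k * k * D = 4 * p) \<Longrightarrow> D = d"
    and form: "\<And>A B C. B \<le> A \<Longrightarrow> A \<le> C \<Longrightarrow> 4 * A * C = B * B + d \<Longrightarrow> A = 1 \<and> B = 1"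
    and d: "d > (0::nat)"
  shows "j_inv \<tau> = j_inv (cm_point d)"
proof -
  from ps obtain p0 where p0: "p0 \<in> ps" by blast
  obtain c f g t where cfg: "of_int c * \<tau>\<^sup>2 + of_int f * \<tau> + of_int g = 0" "c \<noteq> 0"
    using endo_norm_form[OF \<tau>(1)] ps(1)[OF p0] by metis
  \<comment> \<open>The sign makes the leading coefficient of the primitive form positive.\<close>
  define h where "h = gcd c (gcd f g) * sgn c"
  have h0: "h \<noteq> 0" using cfg(2) by (simp add: h_def sgn_0_0)
  define A B C where "A = c div h" and "B = f div h" and "C = g div h"
  have "h dvd c" "h dvd f" "h dvd g"
    unfolding h_def using cfg(2) by (auto simp: sgn_if intro: dvd_trans[OF gcd_dvd2])
  hence ABC: "c = h * A" "f = h * B" "g = h * C" by (simp_all add: A_def B_def C_def)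
  have "of_int h * (of_int A * \<tau>\<^sup>2 + of_int B * \<tau> + of_int C) = 0"
    using cfg(1) unfolding ABC by (simp add: algebra_simps)
  hence eq: "of_int A * \<tau>\<^sup>2 + of_int B * \<tau> + of_int C = 0" using h0 by simp
  have "gcd c (gcd f g) = \<bar>h\<bar> * gcd A (gcd B C)"
  proof -
    have "gcd f g = gcd (h * B) (h * C)" by (simp only: ABC)
    also have "\<dots> = \<bar>h * gcd B C\<bar>" by (simp add: gcd_mult_left abs_mult)
    finally have "gcd c (gcd f g) = gcd (h * A) (h * gcd B C)" by (simp only: ABC gcd_abs2_int)
    thus ?thesis by (simp add: gcd_mult_left abs_mult)
  qed
  moreover have "\<bar>h\<bar> = gcd c (gcd f g)" using cfg(2) by (simp add: h_def abs_mult)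
  moreover have "gcd c (gcd f g) \<noteq> 0" using cfg(2) by simp
  ultimately have prim: "gcd A (gcd B C) = 1" by (metis mult_cancel_left1)
  have "A > 0"
  proof -
    have "sgn h = sgn c" using cfg(2) by (simp add: h_def sgn_mult)
    moreover have "sgn c = sgn h * sgn A" unfolding ABC(1) by (simp add: sgn_mult)
    ultimately have "sgn A = 1" using h0 by (simp add: sgn_0_0)
    thus ?thesis by (simp add: sgn_1_pos)
  qed
  note qf = quadratic_point_form[OF \<tau>(1) eq]
  have BA: "\<bar>B\<bar> \<le> A"
  proof -
    have "\<bar>real_of_int B\<bar> = of_int A * (2 * \<bar>Re \<tau>\<bar>)" using qf(1) \<open>A > 0\<close> by (simp add: abs_mult)
    also have "\<dots> \<le> of_int A * 1" using \<tau>(2) \<open>A > 0\<close> by (intro mult_left_mono) auto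
    finally show ?thesis by linarith
  qed
  have AC: "A \<le> C"
  proof -
    have "real_of_int A * 1 \<le> of_int A * norm \<tau> ^ 2"
      using \<tau>(3) \<open>A > 0\<close> by (intro mult_left_mono one_le_power) auto
    thus ?thesis using qf(2) by linarith
  qed
  define D where "D = 4 * A * C - B\<^sup>2"
  have D_real: "real_of_int D = 4 * of_int A ^ 2 * Im \<tau> ^ 2"
    by (simp add: D_def qf cmod_power2) (simp add: power2_eq_square algebra_simps)
  hence "real_of_int D > 0" using \<open>A > 0\<close> \<tau>(1) by simp
  hence D0: "D > 0" by simp
  have rep: "\<exists>t k. k > 0 \<and> t * t + k * k * nat D = 4 * p" if p: "p \<in> ps" for p
  proof -
    obtain c f g t where cfg: "of_int c * \<tau>\<^sup>2 + of_int f * \<tau> + of_int g = 0" "c \<noteq> 0"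
      "t\<^sup>2 + (4 * c * g - f\<^sup>2) = 4 * int p"
      using endo_norm_form[OF \<tau>(1)] ps(1)[OF p] by metis
    obtain k where k: "c = k * A" "f = k * B" "g = k * C"
      using primitive_form_multiple[OF \<tau>(1) eq \<open>A > 0\<close> prim cfg(1)] by blast
    have "t * t + k * k * D = 4 * int p"
      using cfg(3) unfolding k D_def by (simp add: power2_eq_square algebra_simps)
    hence "int (nat \<bar>t\<bar> * nat \<bar>t\<bar> + nat \<bar>k\<bar> * nat \<bar>k\<bar> * nat D) = int (4 * p)"
      using D0 by simp
    hence "nat \<bar>t\<bar> * nat \<bar>t\<bar> + nat \<bar>k\<bar> * nat \<bar>k\<bar> * nat D = 4 * p" by (simp only: of_nat_eq_iff)
    moreover have "nat \<bar>k\<bar> > 0" using cfg(2) k by auto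
    ultimately show ?thesis by blast
  qed
  have "nat D = d" using D0 by (intro disc rep) auto
  hence Dd: "D = int d" using D0 by simp
  \<comment> \<open>The inequalities defining the fundamental domain say that the form is reduced,
    so only the principal form is left.\<close>
  have "nat A = 1 \<and> nat \<bar>B\<bar> = 1"
  proof (rule form)
    show "nat \<bar>B\<bar> \<le> nat A" using BA by simp
    show "nat A \<le> nat C" using AC by simp
    have "4 * A * C = \<bar>B\<bar> * \<bar>B\<bar> + int d" using Dd by (simp add: D_def power2_eq_square)
    hence "int (4 * nat A * nat C) = int (nat \<bar>B\<bar> * nat \<bar>B\<bar> + d)"
      using \<open>A > 0\<close> AC by simp
    thus "4 * nat A * nat C = nat \<bar>B\<bar> * nat \<bar>B\<bar> + d" by (simp only: of_nat_eq_iff)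
  qed
  hence A1: "A = 1" and "B = 1 \<or> B = -1" by auto
  have "Im \<tau> ^ 2 = real d / 4" using D_real A1 Dd by simp
  hence im: "Im \<tau> = sqrt (real d) / 2"
    using \<tau>(1) by (simp add: real_sqrt_divide real_sqrt_unique[symmetric])
  have re: "Re \<tau> = 1/2 \<or> Re \<tau> = -1/2" using \<open>B = 1 \<or> B = -1\<close> qf(1) A1 by auto
  thus ?thesis
  proof
    assume "Re \<tau> = 1/2"
    thus ?thesis using im by (metis cm_point_def complex_surj)
  next
    assume "Re \<tau> = -1/2"
    hence "cm_point d = \<tau> + of_int 1" using im by (simp add: cm_point_def complex_eq_iff)
    thus ?thesis using j_inv_shift[OF \<tau>(1), of 1] by simp
  qed
qed

lemma j_inv_cm_point_integer:
  assumes ps: "\<And>p. p \<in> ps \<Longrightarrow> prime p \<and> (\<exists>i\<le>p. j_inv (hecke_pt p i (cm_point d)) = j_inv (cm_point d))"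
      "ps \<noteq> {}"
    and disc: "\<And>D. D > 0 \<Longrightarrow> (\<And>p. p \<in> ps \<Longrightarrow> \<exists>t k. k > 0 \<and> t * t + k * k * D = 4 * p) \<Longrightarrow> D = d"
    and form: "\<And>A B C. B \<le> A \<Longrightarrow> A \<le> C \<Longrightarrow> 4 * A * C = B * B + d \<Longrightarrow> A = 1 \<and> B = 1"
    and d: "d > (0::nat)"
  shows "j_inv (cm_point d) \<in> \<int>"
proof -
  define x where "x = j_inv (cm_point d)"
  have "\<exists>P. (\<forall>i. coeff P i \<in> \<int>) \<and> degree P = 2 * p \<and> lead_coeff P = -1 \<and>
      (\<forall>\<tau>. Im \<tau> > 0 \<longrightarrow> (\<Prod>i\<le>p. j_inv \<tau> - j_inv (hecke_pt p i \<tau>)) = poly P (j_inv \<tau>))" if "p \<in> ps" for p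
    using modular_equation_diagonal[of p] ps(1)[OF that] by metis
  then obtain P where P: "\<And>p i. p \<in> ps \<Longrightarrow> coeff (P p) i \<in> \<int>" "\<And>p. p \<in> ps \<Longrightarrow> degree (P p) = 2 * p"
     "\<And>p. p \<in> ps \<Longrightarrow> lead_coeff (P p) = -1"
     "\<And>p \<tau>. p \<in> ps \<Longrightarrow> Im \<tau> > 0 \<Longrightarrow> (\<Prod>i\<le>p. j_inv \<tau> - j_inv (hecke_pt p i \<tau>)) = poly (P p) (j_inv \<tau>)"
    by metis
  have root: "poly (P p) x = 0" if p: "p \<in> ps" for p
  proof -
    have "(\<Prod>i\<le>p. j_inv (cm_point d) - j_inv (hecke_pt p i (cm_point d))) = 0"
    proof -
      obtain i where "i \<le> p" "j_inv (hecke_pt p i (cm_point d)) = j_inv (cm_point d)" using ps(1)[OF p] by blast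
      thus ?thesis by (intro prod_zero bexI[of _ i]) auto
    qed
    thus ?thesis using P(4)[OF p Im_cm_point[OF d]] by (simp add: x_def)
  qed
  from ps(2) obtain p0 where p0: "p0 \<in> ps" by blast
  have "x \<in> \<rat>"
  proof (rule rational_unique_common_root[of "P ` ps"])
    fix y assume y: "\<And>Q. Q \<in> P ` ps \<Longrightarrow> poly Q y = 0"
    obtain \<tau> where \<tau>: "Im \<tau> > 0" "j_inv \<tau> = y" "\<bar>Re \<tau>\<bar> \<le> 1/2" "norm \<tau> \<ge> 1"
      using j_inv_surj[of y] by blast
    have "endo_norm \<tau> p" if p: "p \<in> ps" for p
    proof -
      have "(\<Prod>i\<le>p. j_inv \<tau> - j_inv (hecke_pt p i \<tau>)) = 0"
        using P(4)[OF p \<tau>(1)] y \<tau>(2) p by simp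
      then obtain i where "j_inv (hecke_pt p i \<tau>) = j_inv \<tau>" by (auto simp: prod_zero_iff)
      thus ?thesis using endo_norm_of_fixed_hecke_pt \<tau>(1) ps(1)[OF p] prime_gt_0_nat by blast
    qed
    hence "j_inv \<tau> = j_inv (cm_point d)"
      using ps(1) by (intro cm_point_unique[OF \<tau>(1,3,4) _ ps(2) disc form d]) blast+
    thus "y = x" using \<tau>(2) by (simp add: x_def)
  next
    show "\<exists>Q\<in>P ` ps. Q \<noteq> 0" using P(3)[OF p0] p0 by (intro bexI[of _ "P p0"]) auto
  qed (use P(1) root Ints_subset_Rats in auto)
  moreover have "algebraic_int x"
  proof (rule algebraic_int.intros)
    show "lead_coeff (- P p0) = 1" using P(3)[OF p0] by simp
    show "\<forall>i. coeff (- P p0) i \<in> \<int>" using P(1)[OF p0] by simp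
    show "poly (- P p0) x = 0" using root[OF p0] by simp
  qed
  ultimately show ?thesis unfolding x_def by (rule rational_algebraic_int_is_int[rotated])
qed

text \<open>p is the norm of s + b. Hence (s + b)/p is the reciprocal of the conjugate b + 1 - s,
  which is the inversion applied to a translate of s.\<close>

lemma hecke_pt_cm_point:
  assumes b: "4 * p = 4 * b * b + 4 * b + d + 1" and d: "d > 0"
  shows "b \<le> p" "j_inv (hecke_pt p b (cm_point d)) = j_inv (cm_point d)"
proof -
  have "4 * b < 4 * p" unfolding b using d by simp
  hence bp: "b < p" by simp
  thus "b \<le> p" by simp
  define s where "s = cm_point d"
  have s: "Im s > 0" unfolding s_def by (rule Im_cm_point[OF d])
  have "(of_nat (4 * p) :: complex) = of_nat (4 * b * b + 4 * b + d + 1)" by (simp only: b)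
  hence "(s + of_nat b) * (of_nat b + 1 - s) = of_nat p"
    unfolding s_def cm_point_norm_form by (simp add: power2_eq_square field_simps)
  moreover have "of_nat b + 1 - s \<noteq> 0" using s by (auto simp: complex_eq_iff)
  ultimately have "(s + of_nat b) / of_nat p = 1 / (of_nat b + 1 - s)"
    using bp by (simp add: field_simps)
  also have "\<dots> = -1 / (s + of_int (- int b - 1))"
  proof -
    have "s + of_int (- int b - 1) = - (of_nat b + 1 - s)" by simp
    moreover have "1 / y = -1 / (- y)" for y :: complex by simp
    ultimately show ?thesis by (simp only:)
  qed
  finally have "j_inv (hecke_pt p b s) = j_inv (-1 / (s + of_int (- int b - 1)))"
    using bp by (simp add: hecke_pt_def)
  also have "\<dots> = j_inv (s + of_int (- int b - 1))" using s by (intro j_inv_minus_inverse) simp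
  also have "\<dots> = j_inv s" by (rule j_inv_shift[OF s])
  finally show "j_inv (hecke_pt p b (cm_point d)) = j_inv (cm_point d)" by (simp add: s_def)
qed

lemma reduced_form_bound:
  fixes A B C d :: nat
  assumes "B \<le> A" "A \<le> C" "4 * A * C = B * B + d"
  shows "3 * (A * A) \<le> d" "4 * A dvd B * B + d"
proof -
  have "B * B \<le> A * A" "A * A \<le> A * C" using assms by (simp_all add: mult_le_mono)
  thus "3 * (A * A) \<le> d" using assms(3) by linarith
  show "4 * A dvd B * B + d" using assms(3) by (metis dvd_triv_left)
qed

section \<open>Integrality of the singular moduli\<close>

text \<open>Executable search for n = t^2 + k^2 D with k > 0. The range up to 15 is exhaustive for n
  < 256, that is, for n = 4 p with p < 64.\<close>

definition represents :: "int \<Rightarrow> int \<Rightarrow> bool" where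
  "represents D n \<longleftrightarrow>
     list_ex (\<lambda>k. if n < k * k * D then False else list_ex (\<lambda>t. t * t = n - k * k * D) [0..15]) [1..15]"

lemma representsI:
  fixes t k D n :: nat
  assumes "t * t + k * k * D = n" "k > 0" "D > 0" "n < 256"
  shows "represents (int D) (int n)" "D \<le> n"
proof -
  have "k * k * 1 \<le> k * k * D" using assms by (intro mult_left_mono) auto
  hence "t * t < 16 * 16" "k * k < 16 * 16" using assms by linarith+
  hence tk: "t < 16" "k < 16" by (meson mult_le_mono not_le)+
  have eq: "int t * int t = int n - int k * int k * int D"
    using assms(1) by (simp flip: of_nat_mult of_nat_add)
  have A: "\<not> int n < int k * int k * int D" using eq zero_le_square[of "int t"] by linarith
  have B: "\<exists>t\<in>set [0..15]. t * t = int n - int k * int k * int D"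
    using eq tk(1) by (intro bexI[of _ "int t"]) simp_all
  have "int k \<in> set [1..15]" using tk(2) assms(2) by simp
  thus "represents (int D) (int n)"
    unfolding represents_def list_ex_iff by (intro bexI[of _ "int k"]) (simp_all only: A B if_False)
  have "1 * D \<le> k * k * D" using assms by (intro mult_right_mono) auto
  thus "D \<le> n" using assms(1) by linarith
qed

text \<open>The search is evaluated on integers, where arithmetic is on binary numerals;
  \<open>ps\<close> and \<open>qs\<close> are the same primes in the two types.\<close>

lemma disc_from_primes:
  fixes ps :: "nat list" and d :: nat
  assumes "list_all (\<lambda>D. D = int d \<or> \<not> list_all (\<lambda>p. represents D (4 * p)) qs) [1..255]"
    and "map int ps = qs" "ps \<noteq> []" "\<forall>p\<in>set ps. p < 64"
    and "D > 0" "\<And>p. p \<in> set ps \<Longrightarrow> \<exists>t k. k > 0 \<and> t * t + k * k * D = 4 * p"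
  shows "D = d"
proof -
  have *: "represents (int D) (int (4 * p)) \<and> D \<le> 4 * p" if p: "p \<in> set ps" for p
  proof -
    obtain t k where "k > 0" "t * t + k * k * D = 4 * p" using assms(6)[OF p] by blast
    moreover have "4 * p < 256" using assms(4) p by auto
    ultimately show ?thesis using representsI[of t k D "4 * p"] assms(5) by blast
  qed
  obtain p where "p \<in> set ps" using assms(3) by (cases ps) auto
  with * assms(4) have "D < 256" by fastforce
  hence "int D \<in> set [1..255]" using assms(5) by simp
  hence "int D = int d \<or> \<not> list_all (\<lambda>p. represents (int D) (4 * p)) qs"
    using assms(1) by (simp only: list_all_iff)
  moreover have "list_all (\<lambda>p. represents (int D) (4 * p)) qs"
    using * unfolding assms(2)[symmetric] by (auto simp: list_all_iff)
  ultimately show ?thesis by simp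
qed

text \<open>A reduced form satisfies 3 A^2 <= d, so it is enough to inspect A <= N. With A = 1, the
  value B = 0 is impossible modulo 4.\<close>

lemma one_reduced_form:
  fixes d :: nat and N :: int
  assumes check: "list_all (\<lambda>A. list_all (\<lambda>B. \<not> (4 * A dvd B * B + int d \<and> 4 * A * A \<le> B * B + int d)) [0..A]) [2..N]"
    and N: "int d < 3 * ((N + 1) * (N + 1))" "N \<ge> 0" and d: "d mod 4 = 3"
    and ABC: "B \<le> A" "A \<le> C" "4 * A * C = B * B + d"
  shows "A = 1 \<and> B = 1"
proof -
  note b = reduced_form_bound[OF ABC]
  have "int A \<le> N"
  proof (rule ccontr)
    assume "\<not> int A \<le> N"
    hence "(N + 1) * (N + 1) \<le> int A * int A" using N(2) by (intro mult_mono) auto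
    moreover have "int (3 * (A * A)) \<le> int d" using b(1) by (simp only: of_nat_le_iff)
    ultimately show False using N(1) by simp
  qed
  moreover have "int (4 * A) dvd int (B * B + d)" using b(2) by (simp only: of_nat_dvd_iff)
  moreover have "4 * A * A \<le> B * B + d" using ABC(2) unfolding ABC(3)[symmetric] by simp
  hence "int (4 * A * A) \<le> int (B * B + d)" by (simp only: of_nat_le_iff)
  ultimately have "\<not> int A \<in> set [2..N]"
    using check ABC(1) by (fastforce simp: list_all_iff)
  hence "A < 2" using \<open>int A \<le> N\<close> by simp
  moreover have "A \<noteq> 0"
  proof
    assume "A = 0"
    with ABC(1,3) have "d = 0" by simp
    thus False using d by simp
  qed
  ultimately have A: "A = 1" by simp
  have "B \<noteq> 0"
  proof
    assume "B = 0"
    hence "d = 4 * C" using ABC(3) A by simp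
    thus False using d by simp
  qed
  thus ?thesis using A ABC(1) by simp
qed

lemma hecke_pt_cm_point_ex:
  assumes "4 * p = 4 * b * b + 4 * b + d + 1" "d > 0"
  shows "\<exists>i\<le>p. j_inv (hecke_pt p i (cm_point d)) = j_inv (cm_point d)"
  using hecke_pt_cm_point[OF assms] by blast

text \<open>3 and 5 are the norms of s and s + 1. The first prime admits D = 2, 3, 8, 11 and 12, and
  of these the second leaves only 11.\<close>

lemma j_inv_integer_11: "j_inv (cm_point 11) \<in> \<int>"
proof (rule j_inv_cm_point_integer[of "set [3, 5]"])
  fix p :: nat assume "p \<in> set [3, 5]"
  thus "prime p \<and> (\<exists>i\<le>p. j_inv (hecke_pt p i (cm_point 11)) = j_inv (cm_point 11))"
    using hecke_pt_cm_point_ex[of 3 0 11] hecke_pt_cm_point_ex[of 5 1 11] by auto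
next
  show "D = 11" if "D > 0" "\<And>p. p \<in> set [3, 5 :: nat] \<Longrightarrow> \<exists>t k. k > 0 \<and> t * t + k * k * D = 4 * p" for D
    by (rule disc_from_primes[where ps = "[3, 5]" and qs = "[3, 5]", OF _ _ _ _ that]) (code_simp, simp_all)
  show "A = 1 \<and> B = 1" if "B \<le> A" "A \<le> C" "4 * A * C = B * B + 11" for A B C :: nat
    by (rule one_reduced_form[where N = 1, OF _ _ _ _ that]) (code_simp, simp_all)
qed auto

lemma j_inv_integer_19: "j_inv (cm_point 19) \<in> \<int>"
proof (rule j_inv_cm_point_integer[of "set [5, 7]"])
  fix p :: nat assume "p \<in> set [5, 7]"
  thus "prime p \<and> (\<exists>i\<le>p. j_inv (hecke_pt p i (cm_point 19)) = j_inv (cm_point 19))"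
    using hecke_pt_cm_point_ex[of 5 0 19] hecke_pt_cm_point_ex[of 7 1 19] by auto
next
  show "D = 19" if "D > 0" "\<And>p. p \<in> set [5, 7 :: nat] \<Longrightarrow> \<exists>t k. k > 0 \<and> t * t + k * k * D = 4 * p" for D
    by (rule disc_from_primes[where ps = "[5, 7]" and qs = "[5, 7]", OF _ _ _ _ that]) (code_simp, simp_all)
  show "A = 1 \<and> B = 1" if "B \<le> A" "A \<le> C" "4 * A * C = B * B + 19" for A B C :: nat
    by (rule one_reduced_form[where N = 2, OF _ _ _ _ that]) (code_simp, simp_all)
qed auto

lemma j_inv_integer_43: "j_inv (cm_point 43) \<in> \<int>"
proof (rule j_inv_cm_point_integer[of "set [11, 13]"])
  fix p :: nat assume "p \<in> set [11, 13]"
  thus "prime p \<and> (\<exists>i\<le>p. j_inv (hecke_pt p i (cm_point 43)) = j_inv (cm_point 43))"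
    using hecke_pt_cm_point_ex[of 11 0 43] hecke_pt_cm_point_ex[of 13 1 43] by auto
next
  show "D = 43" if "D > 0" "\<And>p. p \<in> set [11, 13 :: nat] \<Longrightarrow> \<exists>t k. k > 0 \<and> t * t + k * k * D = 4 * p" for D
    by (rule disc_from_primes[where ps = "[11, 13]" and qs = "[11, 13]", OF _ _ _ _ that]) (code_simp, simp_all)
  show "A = 1 \<and> B = 1" if "B \<le> A" "A \<le> C" "4 * A * C = B * B + 43" for A B C :: nat
    by (rule one_reduced_form[where N = 3, OF _ _ _ _ that]) (code_simp, simp_all)
qed auto

text \<open>The primes are the norms of s + 1 and s + 3. The smallest ones, 17 for s and 19 for s +
  1, would still admit D = 2, 8 and 19.\<close>

lemma j_inv_integer_67: "j_inv (cm_point 67) \<in> \<int>"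
proof (rule j_inv_cm_point_integer[of "set [19, 29]"])
  fix p :: nat assume "p \<in> set [19, 29]"
  thus "prime p \<and> (\<exists>i\<le>p. j_inv (hecke_pt p i (cm_point 67)) = j_inv (cm_point 67))"
    using hecke_pt_cm_point_ex[of 19 1 67] hecke_pt_cm_point_ex[of 29 3 67] by auto
next
  show "D = 67" if "D > 0" "\<And>p. p \<in> set [19, 29 :: nat] \<Longrightarrow> \<exists>t k. k > 0 \<and> t * t + k * k * D = 4 * p" for D
    by (rule disc_from_primes[where ps = "[19, 29]" and qs = "[19, 29]", OF _ _ _ _ that]) (code_simp, simp_all)
  show "A = 1 \<and> B = 1" if "B \<le> A" "A \<le> C" "4 * A * C = B * B + 67" for A B C :: nat
    by (rule one_reduced_form[where N = 4, OF _ _ _ _ that]) (code_simp, simp_all)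
qed auto

text \<open>The primes are the norms of s, s + 1 and s + 4, values of Euler's polynomial b^2 + b +
  41.\<close>

lemma j_inv_integer_163: "j_inv (cm_point 163) \<in> \<int>"
proof (rule j_inv_cm_point_integer[of "set [41, 43, 61]"])
  fix p :: nat assume "p \<in> set [41, 43, 61]"
  thus "prime p \<and> (\<exists>i\<le>p. j_inv (hecke_pt p i (cm_point 163)) = j_inv (cm_point 163))"
    using hecke_pt_cm_point_ex[of 41 0 163] hecke_pt_cm_point_ex[of 43 1 163] hecke_pt_cm_point_ex[of 61 4 163] by auto
next
  show "D = 163" if "D > 0" "\<And>p. p \<in> set [41, 43, 61 :: nat] \<Longrightarrow> \<exists>t k. k > 0 \<and> t * t + k * k * D = 4 * p" for D
    by (rule disc_from_primes[where ps = "[41, 43, 61]" and qs = "[41, 43, 61]", OF _ _ _ _ that]) (code_simp, simp_all)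
  show "A = 1 \<and> B = 1" if "B \<le> A" "A \<le> C" "4 * A * C = B * B + 163" for A B C :: nat
    by (rule one_reduced_form[where N = 7, OF _ _ _ _ that]) (code_simp, simp_all)
qed auto

text \<open>The norm b^2 + b + 2 of s + b is even, so it gives the prime 2 only. The other prime,
  23, is the norm of 3 + 2 s; its Hecke point is reached from (s + 9)(10 - s) = 4 * 23 by two
  inversions.\<close>

lemma hecke_pt_cm_point_7:
  "j_inv (hecke_pt 2 0 (cm_point 7)) = j_inv (cm_point 7)"
  "j_inv (hecke_pt 23 9 (cm_point 7)) = j_inv (cm_point 7)"
proof -
  define s where "s = cm_point 7"
  have s: "Im s > 0" unfolding s_def by (rule Im_cm_point) simp
  have nf: "s * (1 - s) = 2"
    unfolding s_def using cm_point_norm_form[of 7 0] by simp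
  show "j_inv (hecke_pt 2 0 (cm_point 7)) = j_inv (cm_point 7)"
    by (rule hecke_pt_cm_point) auto
  have nz: "10 - s \<noteq> 0" "1 + s \<noteq> 0" using s by (auto simp: complex_eq_iff)
  have e1: "(s + 9) / 23 = -1 / ((s - 2) / 4 + of_int (-2))"
  proof -
    have "(s + 9) * (10 - s) = 92" using nf by (simp add: algebra_simps)
    hence "(s + 9) / 23 = 4 / (10 - s)" using nz by (simp add: field_simps)
    also have "\<dots> = -1 / ((s - 10) / 4)" using nz by (simp add: divide_simps)
    also have "(s - 10) / 4 = (s - 2) / 4 + of_int (-2)" by (simp add: field_simps)
    finally show ?thesis .
  qed
  have e2: "(s - 2) / 4 = -1 / (s + of_int 1)"
  proof -
    have "(s - 2) * (s + 1) = -4" using nf by (simp add: algebra_simps)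
    thus ?thesis using nz by (simp add: field_simps)
  qed
  have p: "Im ((s - 2) / 4) > 0" using s by simp
  have "j_inv ((s + 9) / 23) = j_inv ((s - 2) / 4 + of_int (-2))"
    unfolding e1 using p by (intro j_inv_minus_inverse) simp
  also have "\<dots> = j_inv ((s - 2) / 4)" by (rule j_inv_shift[OF p])
  also have "\<dots> = j_inv (s + of_int 1)"
    unfolding e2 using s by (intro j_inv_minus_inverse) simp
  also have "\<dots> = j_inv s" by (rule j_inv_shift[OF s])
  finally show "j_inv (hecke_pt 23 9 (cm_point 7)) = j_inv (cm_point 7)"
    by (simp add: hecke_pt_def s_def)
qed

lemma j_inv_integer_7: "j_inv (cm_point 7) \<in> \<int>"
proof (rule j_inv_cm_point_integer[of "set [2, 23]"])
  fix p :: nat assume "p \<in> set [2, 23]"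
  moreover have "\<exists>i\<le>2. j_inv (hecke_pt 2 i (cm_point 7)) = j_inv (cm_point 7)"
    by (rule exI[of _ 0]) (simp add: hecke_pt_cm_point_7)
  moreover have "\<exists>i\<le>23. j_inv (hecke_pt 23 i (cm_point 7)) = j_inv (cm_point 7)"
    by (rule exI[of _ 9]) (simp add: hecke_pt_cm_point_7)
  ultimately show "prime p \<and> (\<exists>i\<le>p. j_inv (hecke_pt p i (cm_point 7)) = j_inv (cm_point 7))"
    by auto
next
  show "D = 7" if "D > 0" "\<And>p. p \<in> set [2, 23 :: nat] \<Longrightarrow> \<exists>t k. k > 0 \<and> t * t + k * k * D = 4 * p" for D
    by (rule disc_from_primes[where ps = "[2, 23]" and qs = "[2, 23]", OF _ _ _ _ that]) (code_simp, simp_all)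
  show "A = 1 \<and> B = 1" if "B \<le> A" "A \<le> C" "4 * A * C = B * B + 7" for A B C :: nat
    by (rule one_reduced_form[where N = 1, OF _ _ _ _ that]) (code_simp, simp_all)
qed auto

text \<open>Here -1/s = s - 1, so the inversion and the translation combine to an equation for
  lambda(s) itself.\<close>

lemma mod_lambda_cm_point_3: "1 - mod_lambda (cm_point 3) + mod_lambda (cm_point 3) ^ 2 = 0"
proof -
  define r where "r = cm_point 3"
  have r: "Im r > 0" "Im (r - 1) > 0" unfolding r_def using Im_cm_point[of 3] by simp_all
  define l where "l = mod_lambda r"
  have "r * (1 - r) = 1" unfolding r_def using cm_point_norm_form[of 3 0] by simp
  moreover have "r \<noteq> 0" using r by auto
  ultimately have "-1/r = r - 1" by (simp add: field_simps)
  hence 1: "mod_lambda (r - 1) = 1 - l"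
    using mod_lambda_inversion[OF r(1)] one_minus_mod_lambda[OF r(1)] by (simp add: l_def)
  have "mod_lambda (r - 1 + 1) = - mod_lambda (r - 1) / (1 - mod_lambda (r - 1))"
    using mod_lambda_plus_1[OF r(2)] one_minus_mod_lambda[OF r(2)] by simp
  hence "l = - (1 - l) / l" by (simp add: 1 l_def)
  moreover have "l \<noteq> 0" using mod_lambda_nonzero[OF r(1)] by (simp add: l_def)
  ultimately have "l * l = l - 1" by (simp add: field_simps)
  thus ?thesis by (simp add: l_def r_def power2_eq_square)
qed

text \<open>The order of conductor 3 is reached from \<open>\<rho> = cm_point 3\<close>: all 3-isogenies of \<open>\<rho>\<close> but one lead to it.\<close>

lemma j_inv_integer_27: "3 * j_inv (cm_point 27) \<in> \<int>"
proof -
  define r where "r = cm_point 3"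
  have r: "Im r > 0" unfolding r_def by (rule Im_cm_point) simp
  have j0: "j_inv r = 0" using mod_lambda_cm_point_3 by (simp add: j_inv_def r_def)
  have nf: "r * (1 - r) = 1" unfolding r_def using cm_point_norm_form[of 3 0] by simp
  have rr: "r * r = r - 1" using nf by (simp add: algebra_simps)
  have nz: "r \<noteq> 0" "r - 2 \<noteq> 0" "r - 1 \<noteq> 0" using r by (auto simp: complex_eq_iff)
  have "sqrt 27 = 3 * sqrt 3" by (rule real_sqrt_unique) (auto simp: power_mult_distrib)
  hence r27: "cm_point 27 = 3 * r - 1" by (simp add: cm_point_def r_def complex_eq_iff)
  have p27: "Im (cm_point 27) > 0" by (rule Im_cm_point) simp
  have i3: "j_inv (3 * r) = j_inv (cm_point 27)"
    using j_inv_shift[OF p27, of 1] by (simp add: r27)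
  have i0: "j_inv (r / 3) = j_inv (cm_point 27)"
  proof -
    have "-1 / (r / 3) = cm_point 27 + of_int (-2)"
    proof -
      have "(cm_point 27 + of_int (-2)) * (r / 3) = -1" using rr by (simp add: r27 algebra_simps)
      moreover have "r / 3 \<noteq> 0" using nz(1) by simp
      ultimately show ?thesis by (metis nonzero_eq_divide_eq)
    qed
    moreover have "j_inv (-1 / (r / 3)) = j_inv (r / 3)" using r by (intro j_inv_minus_inverse) simp
    ultimately show ?thesis using j_inv_shift[OF p27, of "-2"] by simp
  qed
  have i1: "j_inv ((r + 1) / 3) = 0"
  proof -
    have "(r + 1) * (r - 2) = -3" using rr by (simp add: algebra_simps)
    hence "(r + 1) / 3 = -1 / (r + of_int (-2))" using nz by (simp add: field_simps)
    also have "j_inv \<dots> = j_inv (r + of_int (-2))" using r by (intro j_inv_minus_inverse) simp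
    also have "\<dots> = 0" using j_inv_shift[OF r, of "-2"] j0 by simp
    finally show ?thesis .
  qed
  have i2: "j_inv ((r + 2) / 3) = j_inv (cm_point 27)"
  proof -
    have p: "Im ((r - 1) / 3) > 0" using r by simp
    have "(r + 2) / 3 = (r - 1) / 3 + of_int 1" by (simp add: field_simps)
    hence "j_inv ((r + 2) / 3) = j_inv ((r - 1) / 3)" using j_inv_shift[OF p, of 1] by (simp only:)
    also have "\<dots> = j_inv (-1 / ((r - 1) / 3))" by (rule j_inv_minus_inverse[OF p, symmetric])
    also have "-1 / ((r - 1) / 3) = 3 * r"
    proof -
      have "(3 * r) * ((r - 1) / 3) = r * r - r" by (simp add: right_diff_distrib)
      hence "(3 * r) * ((r - 1) / 3) = -1" by (simp add: rr)
      moreover have "(r - 1) / 3 \<noteq> 0" using nz(3) by simp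
      ultimately show ?thesis by (metis nonzero_eq_divide_eq)
    qed
    finally show ?thesis using i3 by simp
  qed
  obtain P where P: "\<forall>i. coeff P i \<in> \<int>"
    "\<And>\<tau>. Im \<tau> > 0 \<Longrightarrow> (\<Sum>i\<le>3. j_inv (hecke_pt 3 i \<tau>)) = poly P (j_inv \<tau>)"
    using hecke_trace_polynomial[of 3] by auto
  have "(\<Sum>i\<le>3. j_inv (hecke_pt 3 i r)) = 3 * j_inv (cm_point 27)"
    by (simp add: numeral_3_eq_3 hecke_pt_def) (simp add: i0 i1 i2 i3)
  \<comment> \<open>At j = 0 the integral polynomial reduces to its constant term.\<close>
  hence "3 * j_inv (cm_point 27) = coeff P 0" using P(2)[OF r] j0 by (simp add: poly_0_coeff_0)
  thus ?thesis using P(1) by simp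
qed

section \<open>Numerical bounds\<close>

lemma qprod_of_real:
  assumes "\<bar>s\<bar> < 1"
  shows "qprod (of_real x) (of_real s) \<in> \<real>"
proof (rule Lim_in_closed_set[OF closed_complex_Reals])
  show "(\<lambda>N. \<Prod>n<N. 1 + complex_of_real x * of_real s ^ n) \<longlonglongrightarrow> qprod (of_real x) (of_real s)"
    by (rule qprod_tendsto) (use assms in simp)
  show "eventually (\<lambda>N. (\<Prod>n<N. 1 + complex_of_real x * of_real s ^ n) \<in> \<real>) sequentially"
    by (intro always_eventually allI prod_in_Reals) (simp flip: of_real_power)
qed simp

text \<open>By Euler's identity for prod (1 + q^n), h is (eta(2 tau) / eta(tau))^24, the Hauptmodul
  of level 2. It depends on q alone, which is real at \<open>cm_point d\<close>, whereas lambda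
  involves the imaginary nome. The link is 256 h (1 - lambda) = lambda^2.\<close>

lemma j_inv_hauptmodul:
  assumes \<tau>: "Im \<tau> > 0"
  defines "q \<equiv> qexp \<tau>"
  defines "h \<equiv> q * qprod q q ^ 16 / qprod (-q) (q\<^sup>2) ^ 8"
  shows "h \<noteq> 0" "j_inv \<tau> = (1 + 256 * h) ^ 3 / h"
proof -
  define t where "t = nome \<tau>"
  have t: "norm t < 1" using \<tau> by (simp add: t_def)
  have qt: "q = t\<^sup>2" by (simp add: q_def qexp_def t_def)
  note nz = qprod_disc_nonzero[OF t]
  have m: "qprod t q * qprod (-t) q = qprod (-q) (q\<^sup>2)"
    unfolding qt by (rule qprod_neg_mult[OF disc_sq[OF t]])
  define l where "l = mod_lambda \<tau>"
  have l: "l = 16 * t * (qprod q q / qprod t q) ^ 8"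
    by (simp add: l_def mod_lambda_def lambda_disc_def t_def[symmetric] qt)
  have l1: "1 - l = (qprod (-t) q / qprod t q) ^ 8"
    unfolding l_def one_minus_mod_lambda[OF \<tau>] by (simp add: mod_colambda_def colambda_disc_def t_def[symmetric] qt)
  have "t \<noteq> 0" by (simp add: t_def)
  show h0: "h \<noteq> 0"
    unfolding h_def m[symmetric] using nz \<open>t \<noteq> 0\<close> by (simp add: qt)
  have nz1: "1 - l \<noteq> 0" unfolding l1 using nz by (simp add: qt)
  have "256 * (t\<^sup>2 * A ^ 16 / (P * M) ^ 8) * (M / P) ^ 8 = (16 * t * (A / P) ^ 8) ^ 2"
    if "P \<noteq> 0" "M \<noteq> 0" for A P M :: complex
    using that by (simp add: power_mult_distrib power_divide field_simps flip: power_mult power_add)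
  hence hl: "256 * h * (1 - l) = l\<^sup>2"
    unfolding l1 unfolding l h_def m[symmetric] using nz by (simp add: qt)
  have "1 - l + l\<^sup>2 = (1 - l) * (1 + 256 * h)"
    unfolding hl[symmetric] by (simp add: algebra_simps)
  hence "j_inv \<tau> = 256 * ((1 - l) * (1 + 256 * h)) ^ 3 / (256 * h * (1 - l) * (1 - l)\<^sup>2)"
    unfolding j_inv_def l_def[symmetric] hl[symmetric] by simp
  also have "\<dots> = (1 + 256 * h) ^ 3 / h"
    using nz1 h0 by (simp add: power_mult_distrib power2_eq_square power3_eq_cube)
  finally show "j_inv \<tau> = (1 + 256 * h) ^ 3 / h" .
qed

lemma qexp_cm_point: "qexp (cm_point d) = of_real (- exp (- (pi * sqrt (real d))))"
proof -
  have "2 * pi * \<i> * cm_point d = pi * \<i> + of_real (- (pi * sqrt (real d)))"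
    by (simp add: cm_point_def complex_eq_iff)
  hence "qexp (cm_point d) = exp (pi * \<i>) * exp (of_real (- (pi * sqrt (real d))))"
    unfolding qexp_exp by (simp only: exp_add)
  thus ?thesis by (simp only: exp_pi_i exp_of_real) simp
qed

lemma abs_ln_one_plus_le:
  fixes y :: real
  assumes "\<bar>y\<bar> \<le> 1/2"
  shows "\<bar>ln (1 + y) - y\<bar> \<le> 2 * y\<^sup>2" "\<bar>ln (1 + y)\<bar> \<le> 2 * \<bar>y\<bar>"
proof -
  show 1: "\<bar>ln (1 + y) - y\<bar> \<le> 2 * y\<^sup>2"
    using assms by (rule abs_ln_one_plus_x_minus_x_bound)
  have "2 * \<bar>y\<bar>\<^sup>2 \<le> \<bar>y\<bar>" using assms mult_left_mono[of "\<bar>y\<bar>" "1/2" "\<bar>y\<bar>"] by (simp add: power2_eq_square)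
  with 1 show "\<bar>ln (1 + y)\<bar> \<le> 2 * \<bar>y\<bar>" by simp
qed

text \<open>\<open>x\<close> stands for -q = exp(-pi sqrt d), and \<open>u\<close>, \<open>v\<close>
  for the two products without their first factors. Taking logarithms, the linear terms add up to 8
  x + 16 x.\<close>

lemma hauptmodul_asymptotics:
  fixes x u v :: real
  assumes x: "0 < x" "x \<le> 1/4000" and u: "\<bar>u - 1\<bar> \<le> 2 * x\<^sup>2" and v: "\<bar>v - 1\<bar> \<le> 2 * x\<^sup>2"
  shows "\<bar>((1 + x) * v) ^ 8 / ((1 - x) * u) ^ 16 - 1 - 24 * x\<bar> \<le> 800 * x\<^sup>2"
proof -
  have x2: "x\<^sup>2 \<le> x / 4000" "0 < x\<^sup>2" using x by (simp_all add: power2_eq_square)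
  have uv: "u > 0" "v > 0" using u v x x2 by linarith+
  define z where "z = 8 * (ln (1 + x) + ln v) - 16 * (ln (1 - x) + ln u)"
  have eq: "((1 + x) * v) ^ 8 / ((1 - x) * u) ^ 16 = exp z"
    unfolding z_def using x uv
    by (simp add: exp_diff exp_add exp_of_nat_mult[where n = 8, simplified, symmetric] distrib_left
        exp_of_nat_mult[where n = 16, simplified] exp_of_nat_mult[where n = 8, simplified] power_mult_distrib)
  have "\<bar>ln (1 + x) - x\<bar> \<le> 2 * x\<^sup>2" using x by (intro abs_ln_one_plus_le) auto
  moreover have "\<bar>ln (1 - x) + x\<bar> \<le> 2 * x\<^sup>2" using x abs_ln_one_plus_le(1)[of "-x"] by simp
  moreover have "\<bar>ln u\<bar> \<le> 4 * x\<^sup>2" using x x2 u abs_ln_one_plus_le(2)[of "u - 1"] by simp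
  moreover have "\<bar>ln v\<bar> \<le> 4 * x\<^sup>2" using x x2 v abs_ln_one_plus_le(2)[of "v - 1"] by simp
  \<comment> \<open>The four errors add up to 8 (2 + 4) + 16 (2 + 4) = 144 times x^2.\<close>
  ultimately have z: "\<bar>z - 24 * x\<bar> \<le> 144 * x\<^sup>2" unfolding z_def abs_le_iff ring_distribs
    by (elim conjE) (intro conjI; linarith)
  have z01: "0 \<le> z" "z \<le> 25 * x" using z x x2 by linarith+
  have "z\<^sup>2 \<le> (25 * x)\<^sup>2" using z01 by (intro power_mono)
  hence "z\<^sup>2 \<le> 625 * x\<^sup>2" by (simp add: power_mult_distrib)
  moreover have "exp z \<le> 1 + z + z\<^sup>2" using z01 x by (intro exp_bound) auto
  moreover have "1 + z \<le> exp z" by (rule exp_ge_add_one_self)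
  \<comment> \<open>The total error is (144 + 625) x^2.\<close>
  ultimately show ?thesis unfolding eq using z x2(2) by linarith
qed

text \<open>Here w = -1/h for the Hauptmodul h. It is positive and close to exp(pi sqrt d) + 24, and
  j = -(w - 256)^3 / w^2 is therefore about -exp(pi sqrt d) + 744.\<close>

lemma j_inv_cm_point_real:
  fixes d :: nat
  assumes E: "exp (pi * sqrt (real d)) \<ge> 4000" and d: "d > 0"
  obtains w where "\<bar>w - exp (pi * sqrt (real d)) - 24\<bar> \<le> 800 / exp (pi * sqrt (real d))" "w > 0"
    "j_inv (cm_point d) = - of_real ((w - 256) ^ 3 / w ^ 2)"
proof -
  define E where "E = exp (pi * sqrt (real d))"
  define x where "x = exp (- (pi * sqrt (real d)))"
  have xE: "x = 1 / E" by (simp add: x_def E_def exp_minus inverse_eq_divide)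
  have E0: "E \<ge> 4000" using assms by (simp add: E_def)
  have x: "0 < x" "x \<le> 1/4000" using E0 by (simp_all add: xE divide_simps)
  have x2: "x\<^sup>2 \<le> x / 4000" "0 < x\<^sup>2" using x by (simp_all add: power2_eq_square)
  define q where "q = qexp (cm_point d)"
  have q: "q = - of_real x" by (simp add: q_def qexp_cm_point x_def)
  have "x\<^sup>2 < 1" using x x2 by linarith
  hence nq: "norm q < 1" "norm (q\<^sup>2) < 1" using x by (simp_all add: q norm_power)
  \<comment> \<open>The two products without their first factors; both are 1 + O(x^2).\<close>
  define U V where "U = qprod (q\<^sup>2) q" and "V = qprod (-q * q\<^sup>2) (q\<^sup>2)"
  define u v where "u = Re U" and "v = Re V"
  have U: "U = of_real u"
    using qprod_of_real[of "-x" "x\<^sup>2"] x by (simp add: U_def u_def q)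
  have V: "V = of_real v"
    using qprod_of_real[of "x\<^sup>2" "x * x\<^sup>2"] x x2 by (simp add: V_def v_def q)
  have qq: "qprod q q = of_real ((1 - x) * u)"
    using qprod_step[OF nq(1), of q] by (simp add: U_def[symmetric] U flip: power2_eq_square) (simp add: q)
  have q2: "qprod (-q) (q\<^sup>2) = of_real ((1 + x) * v)"
    using qprod_step[OF nq(2), of "-q"] by (simp add: V_def[symmetric, simplified] V) (simp add: q)
  \<comment> \<open>For y <= 1/10 one has exp y - 1 <= 11/10 y, and 11/10 * 3/2 < 2.\<close>
  have ebound: "exp y - 1 \<le> 2 * x\<^sup>2" if "0 \<le> y" "y \<le> 3/2 * x\<^sup>2" for y
  proof -
    have "y \<le> 1/10" using that x x2 by linarith
    have "y * y \<le> 1/10 * y" using that(1) \<open>y \<le> 1/10\<close> by (intro mult_right_mono)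
    moreover have "exp y \<le> 1 + y + y\<^sup>2" using that \<open>y \<le> 1/10\<close> by (intro exp_bound) auto
    ultimately show ?thesis using that by (simp add: power2_eq_square)
  qed
  have "\<bar>u - 1\<bar> = norm (U - 1)" unfolding U by (metis norm_of_real of_real_1 of_real_diff)
  also have "\<dots> \<le> exp (x\<^sup>2 / (1 - x)) - 1"
    unfolding U_def using norm_qprod_minus_1_le[OF nq(1), of "q\<^sup>2"] x by (simp add: q norm_power)
  also have "\<dots> \<le> 2 * x\<^sup>2"
  proof (rule ebound)
    have "x\<^sup>2 * 1 \<le> x\<^sup>2 * (3/2 * (1 - x))" using x x2 by (intro mult_left_mono) auto
    thus "x\<^sup>2 / (1 - x) \<le> 3/2 * x\<^sup>2" using x by (simp add: divide_simps mult_ac)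
  qed (use x in simp)
  finally have u: "\<bar>u - 1\<bar> \<le> 2 * x\<^sup>2" .
  have "\<bar>v - 1\<bar> = norm (V - 1)" unfolding V by (metis norm_of_real of_real_1 of_real_diff)
  also have "\<dots> \<le> exp (x * x\<^sup>2 / (1 - x\<^sup>2)) - 1"
    unfolding V_def using norm_qprod_minus_1_le[OF nq(2), of "-q * q\<^sup>2"] x by (simp add: q norm_power norm_mult)
  also have "\<dots> \<le> 2 * x\<^sup>2"
  proof (rule ebound)
    have "x\<^sup>2 * x \<le> x\<^sup>2 * (3/2 * (1 - x\<^sup>2))" using x x2 by (intro mult_left_mono) auto
    thus "x * x\<^sup>2 / (1 - x\<^sup>2) \<le> 3/2 * x\<^sup>2" using x x2 by (simp add: divide_simps mult_ac)
  qed (use x \<open>x\<^sup>2 < 1\<close> in \<open>auto intro!: divide_nonneg_pos\<close>)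
  finally have v: "\<bar>v - 1\<bar> \<le> 2 * x\<^sup>2" .
  have uv: "u > 0" "v > 0" using u v x x2 by linarith+
  define F where "F = ((1 + x) * v) ^ 8 / ((1 - x) * u) ^ 16"
  have F: "\<bar>F - 1 - 24 * x\<bar> \<le> 800 * x\<^sup>2"
    unfolding F_def by (rule hauptmodul_asymptotics[OF x u v])
  have F0: "F > 0" unfolding F_def using x uv by simp
  define w where "w = F / x"
  define h where "h = q * qprod q q ^ 16 / qprod (-q) (q\<^sup>2) ^ 8"
  have h: "h = of_real (- 1 / w)"
  proof -
    have "q * of_real A ^ 16 / of_real B ^ 8 = of_real (- 1 / (B ^ 8 / A ^ 16 / x))" for A B
    proof -
      have "- 1 / (B ^ 8 / A ^ 16 / x) = - x * A ^ 16 / B ^ 8" by simp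
      thus ?thesis by (simp only: q of_real_minus of_real_mult of_real_divide of_real_power)
    qed
    thus ?thesis unfolding h_def qq q2 w_def F_def .
  qed
  have "w > 0" using F0 x by (simp add: w_def)
  have "E = 1 / x" by (simp add: xE)
  hence "w - E - 24 = (F - 1 - 24 * x) / x" using x by (simp add: w_def diff_divide_distrib)
  hence "\<bar>w - E - 24\<bar> = \<bar>F - 1 - 24 * x\<bar> / x" using x by (simp add: abs_divide)
  also have "\<dots> \<le> 800 * x\<^sup>2 / x" using F x by (intro divide_right_mono) auto
  also have "\<dots> = 800 / E" using x by (simp add: power2_eq_square xE)
  finally have 1: "\<bar>w - E - 24\<bar> \<le> 800 / E" .
  have "j_inv (cm_point d) = (1 + 256 * h) ^ 3 / h"
    unfolding h_def q_def by (rule j_inv_hauptmodul(2)[OF Im_cm_point[OF d]])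
  also have "\<dots> = of_real ((1 + 256 * (- 1 / w)) ^ 3 / (- 1 / w))" by (simp add: h)
  also have "(1 + 256 * (- 1 / w)) ^ 3 / (- 1 / w) = - ((w - 256) ^ 3 / w ^ 2)"
    using \<open>w > 0\<close> by (simp add: field_simps power3_eq_cube power2_eq_square)
  finally show ?thesis using that[of w] 1 \<open>w > 0\<close> by (simp add: E_def)
qed

text \<open>(w - 256)^3 / w^2 = w - 768 + 196608 / w - 16777216 / w^2. Each term is monotone in w
  and is bounded separately at the ends of the interval.\<close>

lemma j_inv_cm_point_approx:
  fixes d :: nat and n \<delta> El Eu wl wu :: real
  assumes d: "d > 0" and El: "4000 \<le> El" "El \<le> exp (pi * sqrt (real d))" and Eu: "exp (pi * sqrt (real d)) \<le> Eu"
    and wl: "0 < wl" "wl + 800 / El \<le> El + 24" and wu: "Eu + 24 + 800 / El \<le> wu"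
    and lo: "n - \<delta> < wl - 768 + 196608 / wu - 16777216 / wl ^ 2"
    and up: "wu - 768 + 196608 / wl - 16777216 / wu ^ 2 < n + \<delta>"
  shows "\<exists>r. j_inv (cm_point d) = of_real r \<and> \<bar>r + n\<bar> < \<delta>"
proof -
  obtain w where w: "\<bar>w - exp (pi * sqrt (real d)) - 24\<bar> \<le> 800 / exp (pi * sqrt (real d))" "w > 0"
    "j_inv (cm_point d) = - of_real ((w - 256) ^ 3 / w ^ 2)"
    using j_inv_cm_point_real[OF order.trans[OF El] d] by blast
  have "800 / exp (pi * sqrt (real d)) \<le> 800 / El" using El by (intro divide_left_mono) auto
  hence b: "wl \<le> w" "w \<le> wu" using w(1) El Eu wl wu by linarith+
  have "(w - 256) ^ 3 / w ^ 2 = w - 768 + 196608 / w - 16777216 / w ^ 2"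
  proof -
    have "(w - 256) ^ 3 = w * w\<^sup>2 - 768 * w\<^sup>2 + 196608 * w - 16777216"
      by (simp add: power3_eq_cube power2_eq_square algebra_simps)
    thus ?thesis using w(2) by (simp add: add_divide_distrib diff_divide_distrib) (simp add: power2_eq_square)
  qed
  moreover have "196608 / wu \<le> 196608 / w" "196608 / w \<le> 196608 / wl"
    using b wl by (auto intro!: divide_left_mono)
  moreover have "16777216 / wu ^ 2 \<le> 16777216 / w ^ 2" "16777216 / w ^ 2 \<le> 16777216 / wl ^ 2"
    using b wl by (auto intro!: divide_left_mono power_mono)
  ultimately have "\<bar>- ((w - 256) ^ 3 / w ^ 2) + n\<bar> < \<delta>" using lo up b by linarith
  thus ?thesis using w(3) by (intro exI[of _ "- ((w - 256) ^ 3 / w ^ 2)"]) simp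
qed

text \<open>Fixed-point arithmetic with 100 fractional bits, rounding outwards. The lists contain the
  denominators of the Horner scheme.\<close>

definition fix_one :: int where "fix_one = 1267650600228229401496703205376"

definition fix_exp_lower :: "int list \<Rightarrow> int \<Rightarrow> int" where
  "fix_exp_lower ks y = foldr (\<lambda>k a. fix_one + (y * a) div (k * fix_one)) ks fix_one"

text \<open>The scheme starts with 2 where the lower one starts with 1: this covers the remainder of
  the series, because exp is at most 2 on [0, 1/2]. The added 1 rounds upwards.\<close>

definition fix_exp_upper :: "int list \<Rightarrow> int \<Rightarrow> int" where
  "fix_exp_upper ks y = foldr (\<lambda>k a. fix_one + (y * a) div (k * fix_one) + 1) ks (2 * fix_one)"

definition fix_square :: "int \<Rightarrow> int" where "fix_square a = (a * a) div fix_one"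

definition fix_squares_lower :: "int list \<Rightarrow> int \<Rightarrow> int" where
  "fix_squares_lower xs a = foldr (\<lambda>_. fix_square) xs a"

definition fix_square' :: "int \<Rightarrow> int" where "fix_square' a = fix_square a + 1"

definition fix_squares_upper :: "int list \<Rightarrow> int \<Rightarrow> int" where
  "fix_squares_upper xs a = foldr (\<lambda>_. fix_square') xs a"

definition horner_exp :: "real \<Rightarrow> int list \<Rightarrow> real \<Rightarrow> real" where
  "horner_exp b ks y = foldr (\<lambda>k a. 1 + y * a / of_int k) ks b"

lemma fix_one_pos: "fix_one > 0" by (simp add: fix_one_def)

lemma real_of_int_div_bounds:
  fixes a b :: int
  assumes "b > 0"
  shows "real_of_int (a div b) \<le> of_int a / of_int b" "of_int a / of_int b \<le> real_of_int (a div b) + 1"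
  using assms real_of_int_div4[of a b] real_of_int_div3[of a b] by auto

lemma fix_exp_lower_horner:
  assumes "\<forall>k\<in>set ks. k > 0" "0 \<le> Y" "of_int Y \<le> of_int fix_one * y"
  shows "of_int (fix_exp_lower ks Y) \<le> of_int fix_one * horner_exp 1 ks y \<and> 0 \<le> fix_exp_lower ks Y"
  using assms(1)
proof (induction ks)
  case (Cons k ks)
  define a where "a = fix_exp_lower ks Y"
  define e where "e = horner_exp 1 ks y"
  have a: "of_int a \<le> of_int fix_one * e" "0 \<le> a" and k: "k > 0" using Cons by (simp_all add: a_def e_def)
  have S: "real_of_int fix_one > 0" using fix_one_pos by simp
  have eq: "fix_exp_lower (k # ks) Y = fix_one + (Y * a) div (k * fix_one)"
    "horner_exp 1 (k # ks) y = 1 + y * e / of_int k"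
    by (simp_all add: fix_exp_lower_def horner_exp_def a_def e_def)
  have A: "of_int (fix_exp_lower (k # ks) Y) \<le> of_int fix_one * horner_exp 1 (k # ks) y"
  proof -
    have "of_int ((Y * a) div (k * fix_one)) \<le> real_of_int Y * of_int a / (of_int k * of_int fix_one)"
      using real_of_int_div_bounds(1)[of "k * fix_one" "Y * a"] k fix_one_pos by simp
    also have "\<dots> \<le> (of_int fix_one * y) * (of_int fix_one * e) / (of_int k * of_int fix_one)"
      using a assms(2,3) k S by (intro divide_right_mono mult_mono) auto
    also have "\<dots> = of_int fix_one * (y * e / of_int k)" using S by simp
    finally show ?thesis unfolding eq by (simp add: distrib_left)
  qed
  moreover have "0 \<le> fix_exp_lower (k # ks) Y"
    unfolding eq using a assms(2) k fix_one_pos by (intro add_nonneg_nonneg) (simp_all add: pos_imp_zdiv_nonneg_iff)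
  ultimately show ?case ..
qed (auto simp: fix_exp_lower_def horner_exp_def fix_one_def)

lemma fix_exp_upper_horner:
  assumes "\<forall>k\<in>set ks. k > 0" "0 \<le> y" "of_int fix_one * y \<le> of_int Y"
  shows "of_int fix_one * horner_exp 2 ks y \<le> of_int (fix_exp_upper ks Y) \<and> 0 \<le> horner_exp 2 ks y"
  using assms(1)
proof (induction ks)
  case (Cons k ks)
  define a where "a = fix_exp_upper ks Y"
  define e where "e = horner_exp 2 ks y"
  have a: "of_int fix_one * e \<le> of_int a" "0 \<le> e" and k: "k > 0" using Cons by (simp_all add: a_def e_def)
  have S: "real_of_int fix_one > 0" using fix_one_pos by simp
  have eq: "fix_exp_upper (k # ks) Y = fix_one + (Y * a) div (k * fix_one) + 1"
    "horner_exp 2 (k # ks) y = 1 + y * e / of_int k"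
    by (simp_all add: fix_exp_upper_def horner_exp_def a_def e_def)
  have A: "of_int fix_one * horner_exp 2 (k # ks) y \<le> of_int (fix_exp_upper (k # ks) Y)"
  proof -
    have Y0: "0 \<le> real_of_int Y" using assms(2,3) S by (meson mult_nonneg_nonneg less_imp_le order.trans)
    have "of_int fix_one * (y * e / of_int k) = (of_int fix_one * y) * (of_int fix_one * e) / (of_int k * of_int fix_one)"
      using S by simp
    also have "\<dots> \<le> real_of_int Y * of_int a / (of_int k * of_int fix_one)"
      using a assms(2,3) k S Y0 by (intro divide_right_mono mult_mono) auto
    also have "\<dots> \<le> of_int ((Y * a) div (k * fix_one)) + 1"
      using real_of_int_div_bounds(2)[of "k * fix_one" "Y * a"] k fix_one_pos by simp
    finally show ?thesis unfolding eq by (simp add: distrib_left)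
  qed
  moreover have "0 \<le> horner_exp 2 (k # ks) y" unfolding eq using a assms(2) k by simp
  ultimately show ?case ..
qed (auto simp: fix_exp_upper_def horner_exp_def)

text \<open>The starting index m is general for the sake of the induction; the factor y^m / m! turns
  the nested scheme into a segment of the exponential series.\<close>

lemma horner_exp_sum:
  "horner_exp b [int m + 1..int m + int n] y * (y ^ m / fact m) =
     (\<Sum>j<n. y ^ (m + j) / fact (m + j)) + b * y ^ (m + n) / fact (m + n)"
proof (induction n arbitrary: m)
  case 0
  show ?case by (simp add: horner_exp_def)
next
  case (Suc n)
  have "horner_exp b [int m + 1..int m + int (Suc n)] y =
      1 + y * horner_exp b [int (Suc m) + 1..int (Suc m) + int n] y / (1 + real m)"
    by (subst upto_rec1) (simp_all add: horner_exp_def add_ac)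
  moreover have split: "(1 + y * A / (1 + real m)) * (B / F) = B / F + A * (y * B / ((1 + real m) * F))" for F y A B :: real and m
  proof -
    have "(1 + y * A / (1 + real m)) * (B / F) = B / F + y * A / (1 + real m) * (B / F)"
      by (simp only: distrib_right mult_1)
    also have "y * A / (1 + real m) * (B / F) = A * (y * B / ((1 + real m) * F))"
      by (simp only: times_divide_times_eq times_divide_eq_right divide_divide_eq_left mult_ac)
    finally show ?thesis .
  qed
  ultimately have "horner_exp b [int m + 1..int m + int (Suc n)] y * (y ^ m / fact m) =
      y ^ m / fact m + horner_exp b [int (Suc m) + 1..int (Suc m) + int n] y * (y ^ Suc m / fact (Suc m))"
    using split[of "fact m" y _ m "y ^ m"] by (simp add: mult_ac)
  also have "\<dots> = y ^ m / fact m + (\<Sum>j<n. y ^ (m + Suc j) / fact (m + Suc j)) + b * y ^ (m + Suc n) / fact (m + Suc n)"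
    unfolding Suc.IH by simp
  also have "y ^ m / fact m + (\<Sum>j<n. y ^ (m + Suc j) / fact (m + Suc j)) = (\<Sum>j<Suc n. y ^ (m + j) / fact (m + j))"
    by (subst sum.lessThan_Suc_shift) simp
  finally show ?case .
qed

lemma horner_exp_bounds:
  assumes "0 \<le> y"
  shows "horner_exp 1 [1..int n] y \<le> exp y" and "y \<le> 1/2 \<Longrightarrow> exp y \<le> horner_exp 2 [1..int n] y"
proof -
  obtain t where t: "\<bar>t\<bar> \<le> \<bar>y\<bar>" "exp y = (\<Sum>m<n. y ^ m / fact m) + exp t / fact n * y ^ n"
    using Maclaurin_exp_le[of y n] by blast
  have h: "horner_exp b [1..int n] y = (\<Sum>j<n. y ^ j / fact j) + b * y ^ n / fact n" for b
    using horner_exp_sum[of b 0 n y] by simp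
  obtain t' where "exp y = (\<Sum>m<Suc n. y ^ m / fact m) + exp t' / fact (Suc n) * y ^ Suc n"
    using Maclaurin_exp_le[of y "Suc n"] by blast
  moreover have "exp t' / fact (Suc n) * y ^ Suc n \<ge> 0" using assms by simp
  ultimately have "(\<Sum>m<Suc n. y ^ m / fact m) \<le> exp y" by linarith
  thus "horner_exp 1 [1..int n] y \<le> exp y" unfolding h by simp
  assume y: "y \<le> 1/2"
  have "exp t \<le> exp (1/2)" using t(1) y assms by simp
  also have "exp (1/2 :: real) \<le> 1 + 1/2 + (1/2)\<^sup>2" by (rule exp_bound) auto
  also have "\<dots> \<le> 2" by (simp add: power2_eq_square)
  finally have "exp t * y ^ n / fact n \<le> 2 * y ^ n / fact n"
    using assms by (intro divide_right_mono mult_right_mono) auto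
  thus "exp y \<le> horner_exp 2 [1..int n] y" unfolding h t(2) by simp
qed

lemma fix_squares_lower_exp:
  fixes y :: real
  assumes "0 \<le> a" "of_int a \<le> of_int fix_one * exp y"
  shows "of_int (fix_squares_lower xs a) \<le> of_int fix_one * exp (2 ^ length xs * y) \<and> 0 \<le> fix_squares_lower xs a"
proof (induction xs)
  case (Cons x xs)
  define b where "b = fix_squares_lower xs a"
  define z where "z = 2 ^ length xs * y"
  have e2: "exp (2 * z) = exp z * exp z" by (simp only: mult_2 exp_add)
  have b: "of_int b \<le> of_int fix_one * exp z" "0 \<le> b" using Cons by (simp_all add: b_def z_def)
  have S: "real_of_int fix_one > 0" using fix_one_pos by simp
  have eq: "fix_squares_lower (x # xs) a = (b * b) div fix_one"
    by (simp add: fix_squares_lower_def fix_square_def b_def)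
  have "real_of_int ((b * b) div fix_one) \<le> of_int b * of_int b / of_int fix_one"
    using real_of_int_div_bounds(1)[OF fix_one_pos, of "b * b"] by simp
  also have "\<dots> \<le> (of_int fix_one * exp z) * (of_int fix_one * exp z) / of_int fix_one"
    using b S by (intro divide_right_mono mult_mono) auto
  also have "\<dots> = of_int fix_one * exp (2 * z)" using S by (simp add: e2)
  finally show ?case
    unfolding eq using b fix_one_pos by (auto simp: z_def mult.assoc pos_imp_zdiv_nonneg_iff)
qed (use assms in \<open>simp add: fix_squares_lower_def\<close>)

lemma fix_squares_upper_exp:
  fixes y :: real
  assumes "of_int fix_one * exp y \<le> of_int a"
  shows "of_int fix_one * exp (2 ^ length xs * y) \<le> of_int (fix_squares_upper xs a)"
proof (induction xs)
  case (Cons x xs)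
  define b where "b = fix_squares_upper xs a"
  define z where "z = 2 ^ length xs * y"
  have e2: "exp (2 * z) = exp z * exp z" by (simp only: mult_2 exp_add)
  have b: "of_int fix_one * exp z \<le> of_int b" using Cons by (simp add: b_def z_def)
  have S: "real_of_int fix_one > 0" using fix_one_pos by simp
  have b0: "0 \<le> real_of_int b" using b S by (meson exp_ge_zero less_imp_le mult_nonneg_nonneg order.trans)
  have eq: "fix_squares_upper (x # xs) a = (b * b) div fix_one + 1"
    by (simp add: fix_squares_upper_def fix_square'_def fix_square_def b_def)
  have "of_int fix_one * exp (2 * z) = (of_int fix_one * exp z) * (of_int fix_one * exp z) / of_int fix_one"
    using S by (simp add: e2)
  also have "\<dots> \<le> of_int b * of_int b / of_int fix_one"
    using b b0 S by (intro divide_right_mono mult_mono) auto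
  also have "\<dots> \<le> real_of_int ((b * b) div fix_one) + 1"
    using real_of_int_div_bounds(2)[OF fix_one_pos, of "b * b"] by simp
  finally show ?case unfolding eq by (simp add: z_def mult.assoc)
qed (use assms in \<open>simp add: fix_squares_upper_def\<close>)

section \<open>Decimal bounds for pi and enclosures of exp(pi sqrt d)\<close>

definition arctan_sum :: "nat \<Rightarrow> real \<Rightarrow> real" where
  "arctan_sum n x = (\<Sum>k<n. (-1) ^ k * x ^ (2 * k + 1) / real (2 * k + 1))"

lemma arctan_minus_sum_deriv:
  "((\<lambda>x. arctan x - arctan_sum n x) has_real_derivative (- (x\<^sup>2)) ^ n / (1 + x\<^sup>2)) (at x)"
proof -
  have "((\<lambda>x. (-1) ^ k * x ^ (2 * k + 1) / real (2 * k + 1)) has_real_derivative (- (x\<^sup>2)) ^ k) (at x)" for k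
  proof -
    have "((\<lambda>x. (-1) ^ k * x ^ (2 * k + 1) / real (2 * k + 1)) has_real_derivative
        (-1) ^ k * (real (2 * k + 1) * x ^ (2 * k)) / real (2 * k + 1)) (at x)"
    proof (rule DERIV_cdivide, rule DERIV_cmult)
      show "((\<lambda>x. x ^ (2 * k + 1)) has_real_derivative real (2 * k + 1) * x ^ (2 * k)) (at x)"
        using DERIV_pow[of "2 * k + 1" x UNIV] by (simp only: add_diff_cancel_right' One_nat_def[symmetric])
    qed
    moreover have "(-1) ^ k * (real (2 * k + 1) * x ^ (2 * k)) / real (2 * k + 1) = (- (x\<^sup>2)) ^ k"
      by (simp add: power_mult power_minus[of "x\<^sup>2"] del: of_nat_Suc of_nat_add of_nat_mult)
    ultimately show ?thesis by simp
  qed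
  hence "(arctan_sum n has_real_derivative (\<Sum>k<n. (- (x\<^sup>2)) ^ k)) (at x)"
    unfolding arctan_sum_def by (intro DERIV_sum)
  hence "((\<lambda>x. arctan x - arctan_sum n x) has_real_derivative inverse (1 + x\<^sup>2) - (\<Sum>k<n. (- (x\<^sup>2)) ^ k)) (at x)"
    by (intro DERIV_diff DERIV_arctan)
  moreover have pos: "1 + x\<^sup>2 > 0" by (simp add: add_pos_nonneg)
  have "(\<Sum>k<n. (- (x\<^sup>2)) ^ k) = (1 - (- (x\<^sup>2)) ^ n) / (1 + x\<^sup>2)"
    using pos by (subst sum_gp_strict) auto
  hence "inverse (1 + x\<^sup>2) - (\<Sum>k<n. (- (x\<^sup>2)) ^ k) = (- (x\<^sup>2)) ^ n / (1 + x\<^sup>2)"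
    by (simp add: inverse_eq_divide diff_divide_distrib)
  ultimately show ?thesis by simp
qed

text \<open>The difference to arctan vanishes at 0 and has the derivative (-x^2)^n / (1 + x^2),
  whose sign depends on the parity of n alone.\<close>

lemma arctan_sum_bounds:
  assumes "0 \<le> x"
  shows "even n \<Longrightarrow> arctan_sum n x \<le> arctan x" "odd n \<Longrightarrow> arctan x \<le> arctan_sum n x"
proof -
  have 0: "arctan 0 - arctan_sum n 0 = 0" by (simp add: arctan_sum_def)
  have pos: "1 + y\<^sup>2 > 0" for y :: real by (simp add: add_pos_nonneg)
  {
    assume "even n"
    hence "(- (y\<^sup>2)) ^ n / (1 + y\<^sup>2) \<ge> 0" for y :: real
      using pos[of y] by (intro divide_nonneg_pos) (auto simp: zero_le_even_power)
    hence "arctan 0 - arctan_sum n 0 \<le> arctan x - arctan_sum n x"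
      using assms by (intro DERIV_nonneg_imp_nondecreasing[of 0 x "\<lambda>x. arctan x - arctan_sum n x"])
        (auto intro!: exI arctan_minus_sum_deriv)
    thus "arctan_sum n x \<le> arctan x" using 0 by simp
  }
  {
    assume "odd n"
    hence "(- (y\<^sup>2)) ^ n / (1 + y\<^sup>2) \<le> 0" for y :: real
      using pos[of y] by (intro divide_nonpos_pos) (auto simp: power_le_zero_eq)
    hence "arctan x - arctan_sum n x \<le> arctan 0 - arctan_sum n 0"
      using assms by (intro DERIV_nonpos_imp_nonincreasing[of 0 x "\<lambda>x. arctan x - arctan_sum n x"])
        (auto intro!: exI arctan_minus_sum_deriv)
    thus "arctan x \<le> arctan_sum n x" using 0 by simp
  }
qed

lemma pi_bounds:
  "31415926535897932384626433 / 10 ^ 25 \<le> pi" "pi \<le> 31415926535897932384626434 / 10 ^ 25"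
proof -
  have lower: "L \<le> pi" if "L \<le> 4 * (4 * s - t)" "s \<le> arctan (1/5)" "arctan (1/239) \<le> t" for L s t
    using that machin by argo
  have upper: "pi \<le> L" if "4 * (4 * s - t) \<le> L" "arctan (1/5) \<le> s" "t \<le> arctan (1/239)" for L s t
    using that machin by argo
  show "31415926535897932384626433 / 10 ^ 25 \<le> pi"
  proof (rule lower)
    \<comment> \<open>Machin's formula: an even number of terms bounds arctan (1/5) from below and
      an odd number bounds arctan (1/239) from above. The upper bound for pi exchanges the
      parities.\<close>
    show "31415926535897932384626433 / 10 ^ 25 \<le> 4 * (4 * arctan_sum 18 (1/5) - arctan_sum 5 (1/239))"
      unfolding arctan_sum_def by (simp add: lessThan_nat_numeral power_divide)
  qed (simp_all add: arctan_sum_bounds)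
  show "pi \<le> 31415926535897932384626434 / 10 ^ 25"
  proof (rule upper)
    show "4 * (4 * arctan_sum 19 (1/5) - arctan_sum 6 (1/239)) \<le> 31415926535897932384626434 / 10 ^ 25"
      unfolding arctan_sum_def by (simp add: lessThan_nat_numeral power_divide)
  qed (simp_all add: arctan_sum_bounds)
qed

text \<open>The argument is divided by 4096 = 2^12 to make a short series accurate, and twelve
  squarings undo this. Hypothesis \<open>sq\<close> puts Y / 2^100 below pi sqrt d / 4096, squared
  to become a statement on integers. Of the two lists, the first only counts squarings and the
  second holds the denominators of the series. N counts thousandths.\<close>

lemma exp_pi_sqrt_lower:
  fixes d :: nat and Y N D :: int
  assumes "0 \<le> Y" and sq: "(4096 * Y * 10 ^ 25)\<^sup>2 \<le> (fix_one * 31415926535897932384626433)\<^sup>2 * D" "D = int d"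
    and check: "N * fix_one \<le> 1000 * fix_squares_lower [1..12] (fix_exp_lower [1..12] Y)"
  shows "of_int N / 1000 \<le> exp (pi * sqrt (real d))"
proof -
  define y where "y = pi * sqrt (real d) / 4096"
  have S: "real_of_int fix_one > 0" using fix_one_pos by simp
  have "real_of_int ((4096 * Y * 10 ^ 25)\<^sup>2) \<le> real_of_int ((fix_one * 31415926535897932384626433)\<^sup>2 * D)"
    using sq(1) by (simp only: of_int_le_iff)
  hence "(4096 * real_of_int Y * 10 ^ 25)\<^sup>2 \<le> (of_int fix_one * 31415926535897932384626433)\<^sup>2 * real d"
    unfolding sq(2) by (simp only: of_int_mult of_int_power of_int_numeral of_int_of_nat_eq)
  hence "4096 * real_of_int Y * 10 ^ 25 \<le> sqrt ((of_int fix_one * 31415926535897932384626433)\<^sup>2 * real d)"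
    by (rule real_le_rsqrt)
  also have "\<dots> = of_int fix_one * 31415926535897932384626433 * sqrt (real d)"
    using S by (simp add: real_sqrt_mult)
  also have "\<dots> \<le> of_int fix_one * (10 ^ 25 * pi) * sqrt (real d)"
    using S pi_bounds(1) by (intro mult_right_mono mult_left_mono) auto
  finally have Y: "of_int Y \<le> of_int fix_one * y" by (simp add: y_def mult_ac)
  have "0 \<le> y" by (simp add: y_def)
  define a where "a = fix_exp_lower [1..int 12] Y"
  have a: "of_int a \<le> of_int fix_one * exp y" "0 \<le> a"
  proof -
    have "of_int a \<le> of_int fix_one * horner_exp 1 [1..int 12] y"
      unfolding a_def using assms(1) Y by (intro conjunct1[OF fix_exp_lower_horner]) auto
    also have "\<dots> \<le> of_int fix_one * exp y" using S horner_exp_bounds(1)[OF \<open>0 \<le> y\<close>, of 12] by simp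
    finally show "of_int a \<le> of_int fix_one * exp y" .
    show "0 \<le> a" unfolding a_def using assms(1) Y by (intro conjunct2[OF fix_exp_lower_horner]) auto
  qed
  have "of_int (fix_squares_lower [1..12] a) \<le> of_int fix_one * exp (2 ^ length [1..12::int] * y)"
    using fix_squares_lower_exp[OF a(2,1)] by blast
  also have "2 ^ length [1..12::int] * y = pi * sqrt (real d)" by (simp add: y_def)
  finally have "real_of_int (1000 * fix_squares_lower [1..12] a) \<le> 1000 * (of_int fix_one * exp (pi * sqrt (real d)))" by simp
  moreover have "real_of_int (N * fix_one) \<le> real_of_int (1000 * fix_squares_lower [1..12] a)"
    using check unfolding a_def by (simp only: of_int_le_iff of_nat_numeral)
  ultimately have "of_int N * of_int fix_one \<le> (1000 * exp (pi * sqrt (real d))) * of_int fix_one" by (simp add: mult_ac)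
  thus ?thesis using S by simp
qed

lemma exp_pi_sqrt_upper:
  fixes d :: nat and Y N D :: int
  assumes "0 \<le> Y" and sq: "(fix_one * 31415926535897932384626434)\<^sup>2 * D \<le> (4096 * Y * 10 ^ 25)\<^sup>2" "D = int d" and "d \<le> 163"
    and check: "1000 * fix_squares_upper [1..12] (fix_exp_upper [1..12] Y) \<le> N * fix_one"
  shows "exp (pi * sqrt (real d)) \<le> of_int N / 1000"
proof -
  define y where "y = pi * sqrt (real d) / 4096"
  have S: "real_of_int fix_one > 0" using fix_one_pos by simp
  have "of_int fix_one * (10 ^ 25 * pi) * sqrt (real d) \<le> of_int fix_one * 31415926535897932384626434 * sqrt (real d)"
    using S pi_bounds(2) by (intro mult_right_mono mult_left_mono) auto
  also have "\<dots> = sqrt ((of_int fix_one * 31415926535897932384626434)\<^sup>2 * real d)"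
    using S by (simp add: real_sqrt_mult)
  also have "\<dots> \<le> 4096 * real_of_int Y * 10 ^ 25"
  proof (rule real_le_lsqrt)
    have "real_of_int ((fix_one * 31415926535897932384626434)\<^sup>2 * D) \<le> real_of_int ((4096 * Y * 10 ^ 25)\<^sup>2)"
      using sq(1) by (simp only: of_int_le_iff)
    thus "(of_int fix_one * 31415926535897932384626434)\<^sup>2 * real d \<le> (4096 * real_of_int Y * 10 ^ 25)\<^sup>2"
      unfolding sq(2) by (simp only: of_int_mult of_int_power of_int_numeral of_int_of_nat_eq)
  qed (use assms(1) in simp_all)
  finally have Y: "of_int fix_one * y \<le> of_int Y" by (simp add: y_def mult_ac)
  have "0 \<le> y" by (simp add: y_def)
  \<comment> \<open>The upper Horner bound requires an argument of at most 1/2; 13^2 = 169 exceeds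
    163.\<close>
  have "sqrt (real d) \<le> sqrt (13\<^sup>2)" using \<open>d \<le> 163\<close> by (intro real_sqrt_le_mono) simp
  hence "pi * sqrt (real d) \<le> 4 * 13" using pi_less_4 by (intro mult_mono) auto
  hence y2: "y \<le> 1/2" by (simp add: y_def)
  define a where "a = fix_exp_upper [1..int 12] Y"
  have a: "of_int fix_one * exp y \<le> of_int a"
  proof -
    have "of_int fix_one * exp y \<le> of_int fix_one * horner_exp 2 [1..int 12] y"
      using S horner_exp_bounds(2)[OF \<open>0 \<le> y\<close> y2, of 12] by simp
    also have "\<dots> \<le> of_int a"
      unfolding a_def using \<open>0 \<le> y\<close> Y by (intro conjunct1[OF fix_exp_upper_horner]) auto
    finally show ?thesis .
  qed
  have "of_int fix_one * exp (2 ^ length [1..12::int] * y) \<le> of_int (fix_squares_upper [1..12] a)"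
    by (rule fix_squares_upper_exp[OF a])
  moreover have "2 ^ length [1..12::int] * y = pi * sqrt (real d)" by (simp add: y_def)
  ultimately have "1000 * (of_int fix_one * exp (pi * sqrt (real d))) \<le> real_of_int (1000 * fix_squares_upper [1..12] a)" by simp
  moreover have "real_of_int (1000 * fix_squares_upper [1..12] a) \<le> real_of_int (N * fix_one)"
    using check unfolding a_def by (simp only: of_int_le_iff of_nat_numeral)
  ultimately have "(1000 * exp (pi * sqrt (real d))) * of_int fix_one \<le> of_int N * of_int fix_one" by (simp add: mult_ac)
  thus ?thesis using S by simp
qed

text \<open>Evaluation rules for the simplifier. Squaring is unfolded on numerals only, so that an
  argument is evaluated before it is duplicated.\<close>

lemma fixed_point_simps:
  "fix_exp_lower [] Y = 1267650600228229401496703205376"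
  "fix_exp_lower (k # ks) Y = 1267650600228229401496703205376 + (Y * fix_exp_lower ks Y) div (k * 1267650600228229401496703205376)"
  "fix_exp_upper [] Y = 2535301200456458802993406410752"
  "fix_exp_upper (k # ks) Y = 1267650600228229401496703205376 + (Y * fix_exp_upper ks Y) div (k * 1267650600228229401496703205376) + 1"
  "fix_squares_lower [] a = a"
  "fix_squares_lower (x # xs) a = fix_square (fix_squares_lower xs a)"
  "fix_squares_upper [] a = a"
  "fix_squares_upper (x # xs) a = fix_square' (fix_squares_upper xs a)"
  "fix_square (numeral m) = (numeral m * numeral m) div 1267650600228229401496703205376"
  "fix_square' (numeral m) = (numeral m * numeral m) div 1267650600228229401496703205376 + 1"
  "[1..12::int] = [1,2,3,4,5,6,7,8,9,10,11,12]"
  by (simp_all add: fix_exp_lower_def fix_exp_upper_def fix_squares_lower_def fix_squares_upper_def fix_square_def fix_square'_def fix_one_def upto_rec1)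

lemma small_int_zero:
  fixes z :: complex
  assumes "z \<in> \<int>" "z = of_real r" "\<bar>r\<bar> < 1"
  shows "z = 0"
proof -
  obtain n where n: "z = of_int n" using assms(1) by (auto elim: Ints_cases)
  hence "complex_of_real (real_of_int n) = of_real r" using assms(2) by simp
  hence "real_of_int n = r" by (simp only: of_real_eq_iff)
  thus ?thesis using assms(3) n by simp
qed

section \<open>Values of the singular moduli\<close>

text \<open>The two values of \<open>Y\<close> are 2^100 pi sqrt 7 / 4096 rounded outwards, and the
  fractions passed to \<open>j_inv_cm_point_approx\<close> enclose w. For d = 7 this interval is the
  widest of all, about 0.395, and still within the tolerance.\<close>

lemma j_inv_value_7: "j_inv (cm_point 7) = - 3375"
proof -
  have l: "of_int 4071932 / 1000 \<le> exp (pi * sqrt (real 7))"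
    by (rule exp_pi_sqrt_lower[where Y = 2572400060539993018964212838 and D = 7])
      (simp, simp add: fix_one_def, simp, simp add: fix_one_def fixed_point_simps)
  have u: "exp (pi * sqrt (real 7)) \<le> of_int 4071933 / 1000"
    by (rule exp_pi_sqrt_upper[where Y = 2572400060539993018964212921 and D = 7])
      (simp, simp add: fix_one_def, simp, simp, simp add: fix_one_def fixed_point_simps)
  obtain r where r: "j_inv (cm_point 7) = of_real r" "\<bar>r + 3375\<bar> < 1/3"
    using j_inv_cm_point_approx[OF _ _ l u, of "4095735 / 1000" "4096130 / 1000" 3375 "1/3"] by (auto simp: power_divide)
  have "j_inv (cm_point 7) + 3375 \<in> \<int>"
    using j_inv_integer_7 by simp
  moreover have "j_inv (cm_point 7) + 3375 = of_real (r + 3375)" by (simp add: r)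
  ultimately have "j_inv (cm_point 7) + 3375 = 0" by (rule small_int_zero) (use r(2) in simp)
  thus ?thesis by (simp add: add_eq_0_iff2)
qed

lemma j_inv_value_11: "j_inv (cm_point 11) = - 32768"
proof -
  have l: "of_int 33506143 / 1000 \<le> exp (pi * sqrt (real 11))"
    by (rule exp_pi_sqrt_lower[where Y = 3224674131623396791795434766 and D = 11])
      (simp, simp add: fix_one_def, simp, simp add: fix_one_def fixed_point_simps)
  have u: "exp (pi * sqrt (real 11)) \<le> of_int 33506144 / 1000"
    by (rule exp_pi_sqrt_upper[where Y = 3224674131623396791795434870 and D = 11])
      (simp, simp add: fix_one_def, simp, simp, simp add: fix_one_def fixed_point_simps)
  obtain r where r: "j_inv (cm_point 11) = of_real r" "\<bar>r + 32768\<bar> < 1/3"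
    using j_inv_cm_point_approx[OF _ _ l u, of "33530119 / 1000" "33530168 / 1000" 32768 "1/3"] by (auto simp: power_divide)
  have "j_inv (cm_point 11) + 32768 \<in> \<int>"
    using j_inv_integer_11 by simp
  moreover have "j_inv (cm_point 11) + 32768 = of_real (r + 32768)" by (simp add: r)
  ultimately have "j_inv (cm_point 11) + 32768 = 0" by (rule small_int_zero) (use r(2) in simp)
  thus ?thesis by (simp add: add_eq_0_iff2)
qed

lemma j_inv_value_19: "j_inv (cm_point 19) = - 884736"
proof -
  have l: "of_int 885479777 / 1000 \<le> exp (pi * sqrt (real 19))"
    by (rule exp_pi_sqrt_lower[where Y = 4238052102387487759701784718 and D = 19])
      (simp, simp add: fix_one_def, simp, simp add: fix_one_def fixed_point_simps)
  have u: "exp (pi * sqrt (real 19)) \<le> of_int 885479778 / 1000"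
    by (rule exp_pi_sqrt_upper[where Y = 4238052102387487759701784854 and D = 19])
      (simp, simp add: fix_one_def, simp, simp, simp add: fix_one_def fixed_point_simps)
  obtain r where r: "j_inv (cm_point 19) = of_real r" "\<bar>r + 884736\<bar> < 1/3"
    using j_inv_cm_point_approx[OF _ _ l u, of "885503776 / 1000" "885503779 / 1000" 884736 "1/3"] by (auto simp: power_divide)
  have "j_inv (cm_point 19) + 884736 \<in> \<int>"
    using j_inv_integer_19 by simp
  moreover have "j_inv (cm_point 19) + 884736 = of_real (r + 884736)" by (simp add: r)
  ultimately have "j_inv (cm_point 19) + 884736 = 0" by (rule small_int_zero) (use r(2) in simp)
  thus ?thesis by (simp add: add_eq_0_iff2)
qed

text \<open>Integrality is known for three times the value, hence the factor 3 and the tolerance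
  1/3.\<close>

lemma j_inv_value_27: "j_inv (cm_point 27) = - 12288000"
proof -
  have l: "of_int 12288743983 / 1000 \<le> exp (pi * sqrt (real 27))"
    by (rule exp_pi_sqrt_lower[where Y = 5052093426485787177620881173 and D = 27])
      (simp, simp add: fix_one_def, simp, simp add: fix_one_def fixed_point_simps)
  have u: "exp (pi * sqrt (real 27)) \<le> of_int 12288743984 / 1000"
    by (rule exp_pi_sqrt_upper[where Y = 5052093426485787177620881335 and D = 27])
      (simp, simp add: fix_one_def, simp, simp, simp add: fix_one_def fixed_point_simps)
  obtain r where r: "j_inv (cm_point 27) = of_real r" "\<bar>r + 12288000\<bar> < 1/3"
    using j_inv_cm_point_approx[OF _ _ l u, of "12288767982 / 1000" "12288767985 / 1000" 12288000 "1/3"] by (auto simp: power_divide)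
  have "3 * (j_inv (cm_point 27) + 12288000) \<in> \<int>"
    using j_inv_integer_27 by (simp add: distrib_left)
  moreover have "3 * (j_inv (cm_point 27) + 12288000) = of_real (3 * (r + 12288000))" by (simp add: r)
  ultimately have "3 * (j_inv (cm_point 27) + 12288000) = 0" by (rule small_int_zero) (use r(2) in \<open>simp only: abs_mult abs_numeral, simp\<close>)
  thus ?thesis by (simp add: add_eq_0_iff2)
qed

lemma j_inv_value_43: "j_inv (cm_point 43) = - 884736000"
proof -
  have l: "of_int 884736743999 / 1000 \<le> exp (pi * sqrt (real 43))"
    by (rule exp_pi_sqrt_lower[where Y = 6375639005207297305747654382 and D = 43])
      (simp, simp add: fix_one_def, simp, simp add: fix_one_def fixed_point_simps)
  have u: "exp (pi * sqrt (real 43)) \<le> of_int 884736744000 / 1000"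
    by (rule exp_pi_sqrt_upper[where Y = 6375639005207297305747654586 and D = 43])
      (simp, simp add: fix_one_def, simp, simp, simp add: fix_one_def fixed_point_simps)
  obtain r where r: "j_inv (cm_point 43) = of_real r" "\<bar>r + 884736000\<bar> < 1/3"
    using j_inv_cm_point_approx[OF _ _ l u, of "884736767998 / 1000" "884736768001 / 1000" 884736000 "1/3"] by (auto simp: power_divide)
  have "j_inv (cm_point 43) + 884736000 \<in> \<int>"
    using j_inv_integer_43 by simp
  moreover have "j_inv (cm_point 43) + 884736000 = of_real (r + 884736000)" by (simp add: r)
  ultimately have "j_inv (cm_point 43) + 884736000 = 0" by (rule small_int_zero) (use r(2) in simp)
  thus ?thesis by (simp add: add_eq_0_iff2)
qed

lemma j_inv_value_67: "j_inv (cm_point 67) = - 147197952000"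
proof -
  have l: "of_int 147197952743999 / 1000 \<le> exp (pi * sqrt (real 67))"
    by (rule exp_pi_sqrt_lower[where Y = 7958420686724872184334547914 and D = 67])
      (simp, simp add: fix_one_def, simp, simp add: fix_one_def fixed_point_simps)
  have u: "exp (pi * sqrt (real 67)) \<le> of_int 147197952744000 / 1000"
    by (rule exp_pi_sqrt_upper[where Y = 7958420686724872184334548169 and D = 67])
      (simp, simp add: fix_one_def, simp, simp, simp add: fix_one_def fixed_point_simps)
  obtain r where r: "j_inv (cm_point 67) = of_real r" "\<bar>r + 147197952000\<bar> < 1/3"
    using j_inv_cm_point_approx[OF _ _ l u, of "147197952767998 / 1000" "147197952768001 / 1000" 147197952000 "1/3"] by (auto simp: power_divide)
  have "j_inv (cm_point 67) + 147197952000 \<in> \<int>"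
    using j_inv_integer_67 by simp
  moreover have "j_inv (cm_point 67) + 147197952000 = of_real (r + 147197952000)" by (simp add: r)
  ultimately have "j_inv (cm_point 67) + 147197952000 = 0" by (rule small_int_zero) (use r(2) in simp)
  thus ?thesis by (simp add: add_eq_0_iff2)
qed

text \<open>exp(pi sqrt 163) differs from the integer 640320^3 + 744 by less than 10^-12, so bounds
  in thousandths must lie on either side of that integer.\<close>

lemma j_inv_value_163: "j_inv (cm_point 163) = - 262537412640768000"
proof -
  have l: "of_int 262537412640768743999 / 1000 \<le> exp (pi * sqrt (real 163))"
    by (rule exp_pi_sqrt_lower[where Y = 12413186868631646779537863516 and D = 163])
      (simp, simp add: fix_one_def, simp, simp add: fix_one_def fixed_point_simps)
  have u: "exp (pi * sqrt (real 163)) \<le> of_int 262537412640768744001 / 1000"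
    by (rule exp_pi_sqrt_upper[where Y = 12413186868631646779537863912 and D = 163])
      (simp, simp add: fix_one_def, simp, simp, simp add: fix_one_def fixed_point_simps)
  obtain r where r: "j_inv (cm_point 163) = of_real r" "\<bar>r + 262537412640768000\<bar> < 1/3"
    using j_inv_cm_point_approx[OF _ _ l u, of "262537412640768767998 / 1000" "262537412640768768002 / 1000" 262537412640768000 "1/3"] by (auto simp: power_divide)
  have "j_inv (cm_point 163) + 262537412640768000 \<in> \<int>"
    using j_inv_integer_163 by simp
  moreover have "j_inv (cm_point 163) + 262537412640768000 = of_real (r + 262537412640768000)" by (simp add: r)
  ultimately have "j_inv (cm_point 163) + 262537412640768000 = 0" by (rule small_int_zero) (use r(2) in simp)
  thus ?thesis by (simp add: add_eq_0_iff2)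
qed

section \<open>From the j-invariant to the lambda function\<close>

lemma qprod_cnj:
  assumes "norm s < 1"
  shows "cnj (qprod x s) = qprod (cnj x) (cnj s)"
proof (rule LIMSEQ_unique)
  show "(\<lambda>N. \<Prod>n<N. 1 + cnj x * cnj s ^ n) \<longlonglongrightarrow> qprod (cnj x) (cnj s)"
    using assms by (intro qprod_tendsto) simp
  have "(\<lambda>N. cnj (\<Prod>n<N. 1 + x * s ^ n)) \<longlonglongrightarrow> cnj (qprod x s)"
    by (intro tendsto_cnj qprod_tendsto assms)
  thus "(\<lambda>N. \<Prod>n<N. 1 + cnj x * cnj s ^ n) \<longlonglongrightarrow> cnj (qprod x s)"
    by simp
qed

text \<open>Since sqrt(-d) + 1 = 2 s, the argument of lambda is 1 - 1/s: an inversion followed by a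
  translation.\<close>

lemma lambda_tilde_cm_point:
  assumes "d > 0"
  shows "lambda_tilde (real d) = 1 - 1 / mod_lambda (cm_point d)"
proof -
  define s where "s = cm_point d"
  have s: "Im s > 0" unfolding s_def by (rule Im_cm_point[OF assms])
  define w where "w = sqrt_neg (real d)"
  have ws: "w + 1 = 2 * s" by (simp add: w_def s_def sqrt_neg_def cm_point_def complex_eq_iff)
  have "s \<noteq> 0" using s by auto
  have "(w - 1) / (w + 1) = -1/s + 1"
    using ws \<open>s \<noteq> 0\<close> by (simp add: divide_simps) (simp add: algebra_simps)
  hence "lambda_tilde (real d) = mod_lambda (-1/s + 1)"
    using Im_minus_inverse_pos[OF s] elliptic_lambda_nome[of "-1/s + 1"]
    by (simp only: lambda_tilde_def w_def mod_lambda_def) simp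
  also have "\<dots> = - (1 - mod_lambda s) / mod_lambda s"
    using mod_lambda_plus_1[OF Im_minus_inverse_pos[OF s]] mod_lambda_inversion[OF s]
      mod_colambda_inversion[OF s] one_minus_mod_lambda[OF s] by simp
  also have "\<dots> = 1 - 1 / mod_lambda s"
    using mod_lambda_nonzero[OF s] by (simp add: field_simps)
  finally show ?thesis by (simp add: s_def)
qed

lemma nome_cm_point: "nome (cm_point d) = \<i> * of_real (exp (- (pi * sqrt (real d) / 2)))"
proof -
  have "pi * \<i> * cm_point d = \<i> * of_real (pi / 2) + of_real (- (pi * sqrt (real d) / 2))"
    by (simp add: cm_point_def complex_eq_iff)
  hence "nome (cm_point d) = exp (\<i> * of_real (pi / 2)) * exp (of_real (- (pi * sqrt (real d) / 2)))"
    unfolding nome_def by (simp only: exp_add)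
  also have "exp (\<i> * of_real (pi / 2)) = \<i>"
    by (simp only: cis_conv_exp[symmetric] cis_pi_half)
  finally show ?thesis by (simp only: exp_of_real)
qed

text \<open>The nome at s is purely imaginary, so conjugating lambda(s) amounts to passing to s - 1.
  The law for the translation then reads 1/l = 1 - conj (1/l).\<close>

lemma Re_lambda_tilde:
  assumes "d > 0"
  shows "Re (lambda_tilde (real d)) = 1/2"
proof -
  define s where "s = cm_point d"
  have s: "Im s > 0" "Im (s - 1) > 0" using Im_cm_point[OF assms] by (simp_all add: s_def)
  define t where "t = nome s"
  have t: "norm t < 1" using s by (simp add: t_def)
  define l where "l = mod_lambda s"
  have "cnj t = - t" by (simp add: t_def s_def nome_cm_point)
  hence "cnj l = lambda_disc (- t)"
    unfolding l_def mod_lambda_def t_def[symmetric] lambda_disc_def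
    using qprod_cnj[OF disc_sq[OF t]] by simp
  also have "- t = nome (s - 1)" using nome_plus_1[of "s - 1"] by (simp add: t_def)
  finally have cl: "cnj l = mod_lambda (s - 1)" by (simp add: mod_lambda_def)
  have nz: "l \<noteq> 0" "cnj l \<noteq> 0" "1 - cnj l \<noteq> 0"
    using mod_lambda_nonzero[OF s(1)] mod_lambda_nonzero[OF s(2)] mod_lambda_neq_1[OF s(2)] by (auto simp: l_def cl[unfolded l_def])
  have "l = - cnj l / (1 - cnj l)"
    using mod_lambda_plus_1(1)[OF s(2)] one_minus_mod_lambda[OF s(2)] unfolding cl by (simp add: l_def)
  hence "1 / l = 1 / (- cnj l / (1 - cnj l))" by (rule arg_cong)
  also have "\<dots> = 1 - 1 / cnj l" using nz by (simp add: field_simps)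
  finally have "1 / l = 1 - cnj (1 / l)" by simp
  moreover have "Re z = 1/2" if "z = 1 - cnj z" for z
    using arg_cong[OF that, of Re] by simp
  ultimately have "Re (1 / l) = 1/2" by blast
  thus ?thesis unfolding lambda_tilde_cm_point[OF assms] s_def[symmetric] l_def[symmetric] by simp
qed

lemma exp_pi_sqrt_half_bound:
  assumes "d \<ge> 3"
  shows "exp (- (pi * sqrt (real d) / 2)) \<le> 2/25"
proof -
  have p: "(314/100) * (173/100) \<le> pi * sqrt (real d)"
  proof (intro mult_mono)
    show "314/100 \<le> pi" using pi_approx by simp
    show "173/100 \<le> sqrt (real d)" using assms by (intro real_le_rsqrt) (simp add: power2_eq_square)
  qed auto
  \<comment> \<open>27/40 is a quarter of 2.7, which is below 3.14 * 1.73 / 2, and 1.9^4 exceeds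
    25/2.\<close>
  have "(19/10 :: real) \<le> exp (27/40)"
    using exp_lower_Taylor_quadratic[of "27/40"] by (simp add: power2_eq_square)
  hence "(19/10 :: real) ^ 4 \<le> exp (27/40) ^ 4" by (intro power_mono) auto
  also have "exp (27/40 :: real) ^ 4 = exp (27/10)" by (simp add: exp_of_nat_mult[symmetric])
  also have "\<dots> \<le> exp (pi * sqrt (real d) / 2)" using p by simp
  finally have "25/2 \<le> exp (pi * sqrt (real d) / 2)" by (simp add: power_divide)
  thus ?thesis by (simp add: exp_minus field_simps)
qed

text \<open>The relation with j involves only y^2, so the sign comes from the product: at the nome i
  r, 1/lambda is -i N times a positive number, and |N - 1| < 1 makes the real part of N
  positive.\<close>

lemma Im_lambda_tilde_pos:
  assumes "d \<ge> 3"
  shows "Im (lambda_tilde (real d)) > 0"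
proof -
  have d: "d > 0" using assms by simp
  define r where "r = exp (- (pi * sqrt (real d) / 2))"
  have r: "0 < r" "r \<le> 2/25" using exp_pi_sqrt_half_bound[OF assms] by (simp_all add: r_def)
  define t where "t = nome (cm_point d)"
  have t: "t = \<i> * of_real r" by (simp add: t_def nome_cm_point r_def)
  have nt: "norm t < 1" "norm (t\<^sup>2) < 1" using Im_cm_point[OF d] by (simp_all add: t_def)
  have r2: "r\<^sup>2 \<le> 4/625" using power_mono[OF r(2), of 2] r(1) by (simp add: power_divide)
  have t2: "t\<^sup>2 = of_real (- (r\<^sup>2))" by (simp add: t power_mult_distrib)
  define N where "N = qprod t (t\<^sup>2) ^ 8"
  have "qprod (t\<^sup>2) (t\<^sup>2) \<in> \<real>" unfolding t2 using r2 by (intro qprod_of_real) simp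
  then obtain e where e: "qprod (t\<^sup>2) (t\<^sup>2) = of_real e" by (auto elim: Reals_cases)
  have e0: "e \<noteq> 0" using qprod_disc_nonzero(3)[OF nt(1)] e by auto
  have "norm (N - 1) \<le> (1 + norm (qprod t (t\<^sup>2) - 1)) ^ 8 - 1"
    using norm_prod_minus1_le_prod_minus1[of "\<lambda>_. qprod t (t\<^sup>2) - 1" "{..<8::nat}"] by (simp add: N_def)
  also have "\<dots> \<le> exp (r / (1 - r\<^sup>2)) ^ 8 - 1"
    using norm_qprod_minus_1_le[OF nt(2), of t] r
    by (intro diff_mono power_mono) (simp_all add: t norm_mult norm_power)
  also have "exp (r / (1 - r\<^sup>2)) ^ 8 = exp (8 * (r / (1 - r\<^sup>2)))" by (simp add: exp_of_nat_mult[symmetric])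
  also have "\<dots> < 2"
  proof -
    have "8 * r < 2/3 * (1 - r\<^sup>2)" using r r2 by simp
    hence "8 * (r / (1 - r\<^sup>2)) < 2/3" using r2 by (simp add: field_simps)
    also have "2/3 \<le> ln (2::real)" by (rule ln2_ge_two_thirds)
    finally have "exp (8 * (r / (1 - r\<^sup>2))) < exp (ln 2)" by (subst exp_less_cancel_iff)
    thus ?thesis by simp
  qed
  finally have "norm (N - 1) < 1" by simp
  hence "\<bar>Re (N - 1)\<bar> < 1" using abs_Re_le_cmod[of "N - 1"] by linarith
  hence N: "Re N > 0" by simp
  have "1 / mod_lambda (cm_point d) = N / (16 * t * of_real e ^ 8)"
    unfolding mod_lambda_def t_def[symmetric] lambda_disc_def e N_def by (simp add: power_divide)
  also have "\<dots> = - \<i> * N / of_real (16 * r * e ^ 8)"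
    using r(1) e0 by (simp add: t divide_simps)
  finally have "Im (1 / mod_lambda (cm_point d)) = - Re N / (16 * r * e ^ 8)"
    by (simp only: Im_divide_of_real) simp
  moreover have "16 * r * e ^ 8 > 0" using r(1) e0 by (simp add: zero_less_power_eq)
  ultimately show ?thesis
    unfolding lambda_tilde_cm_point[OF d] using N by simp
qed

text \<open>j has the same expression in L = 1 - 1/l, another of the six conjugates of l. On the
  line L = 1/2 + i y it becomes a function of y^2.\<close>

lemma lambda_tilde_height:
  assumes "d \<ge> 3"
  obtains y where "y > 0" "lambda_tilde (real d) = 1/2 + \<i> * of_real y"
    "j_inv (cm_point d) = of_real (256 * (3/4 - y\<^sup>2) ^ 3 / (1/4 + y\<^sup>2)\<^sup>2)"
proof -
  have d: "d > 0" using assms by simp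
  define L where "L = lambda_tilde (real d)"
  define y where "y = Im L"
  have L: "L = 1/2 + \<i> * of_real y"
    using Re_lambda_tilde[OF d] by (simp add: complex_eq_iff y_def L_def)
  have s: "Im (cm_point d) > 0" by (rule Im_cm_point[OF d])
  define l where "l = mod_lambda (cm_point d)"
  have l: "l \<noteq> 0" "l \<noteq> 1" using mod_lambda_nonzero[OF s] mod_lambda_neq_1[OF s] by (simp_all add: l_def)
  have Ll: "L = 1 - 1 / l" unfolding L_def l_def by (rule lambda_tilde_cm_point[OF d])
  have "1 - L + L\<^sup>2 = (1 - l + l\<^sup>2) / l\<^sup>2" using l by (simp add: Ll field_simps power2_eq_square)
  moreover have "L * (1 - L) = - (1 - l) / l\<^sup>2" using l by (simp add: Ll field_simps power2_eq_square)
  ultimately have "256 * (1 - L + L\<^sup>2) ^ 3 / (L * (1 - L))\<^sup>2 = 256 * ((1 - l + l\<^sup>2) / l\<^sup>2) ^ 3 / ((1 - l) / l\<^sup>2)\<^sup>2"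
    by (simp add: power_divide power2_commute[of 1 l])
  also have "\<dots> = 256 * (1 - l + l\<^sup>2) ^ 3 / (l\<^sup>2 * (1 - l)\<^sup>2)"
  proof -
    have "256 * (P / l\<^sup>2) ^ 3 / (m / l\<^sup>2)\<^sup>2 = 256 * P ^ 3 / (l\<^sup>2 * m\<^sup>2)" if "m \<noteq> 0" for P m
      using that l(1) by (simp add: power_divide power2_eq_square power3_eq_cube)
    thus ?thesis using l by simp
  qed
  finally have "j_inv (cm_point d) = 256 * (1 - L + L\<^sup>2) ^ 3 / (L * (1 - L))\<^sup>2"
    by (simp add: j_inv_def l_def)
  also have "1 - L + L\<^sup>2 = of_real (3/4 - y\<^sup>2)"
    by (simp add: L complex_eq_iff power2_eq_square)
  also have "L * (1 - L) = of_real (1/4 + y\<^sup>2)"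
    by (simp add: L complex_eq_iff power2_eq_square)
  finally have "j_inv (cm_point d) = of_real (256 * (3/4 - y\<^sup>2) ^ 3 / (1/4 + y\<^sup>2)\<^sup>2)" by simp
  moreover have "y > 0" unfolding y_def L_def by (rule Im_lambda_tilde_pos[OF assms])
  ultimately show ?thesis using that[of y] L by (simp add: L_def)
qed

text \<open>Cross-multiplied monotonicity of (s - 3/4)^3 / (1/4 + s)^2: the ratio (s - 3/4) / (1/4 +
  s) increases, and its square is multiplied by the increasing factor s - 3/4.\<close>

lemma height_equation_strict_mono:
  fixes s t :: real
  assumes "3/4 < s" "s < t"
  shows "(s - 3/4) ^ 3 * (1/4 + t)\<^sup>2 < (t - 3/4) ^ 3 * (1/4 + s)\<^sup>2"
proof -
  have "(t - 3/4) * (1/4 + s) = (s - 3/4) * (1/4 + t) + (t - s)" by (simp add: field_simps)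
  hence "(s - 3/4) * (1/4 + t) < (t - 3/4) * (1/4 + s)" using assms by simp
  hence "((s - 3/4) * (1/4 + t))\<^sup>2 < ((t - 3/4) * (1/4 + s))\<^sup>2"
    using assms by (intro power_strict_mono) auto
  hence "(s - 3/4) * ((s - 3/4) * (1/4 + t))\<^sup>2 < (t - 3/4) * ((t - 3/4) * (1/4 + s))\<^sup>2"
    using assms by (intro mult_strict_mono) auto
  thus ?thesis by (simp add: power_mult_distrib power3_eq_cube power2_eq_square mult_ac)
qed

lemma height_equation_gt:
  fixes y n :: real
  assumes "n > 0" "256 * (y\<^sup>2 - 3/4) ^ 3 = n * (1/4 + y\<^sup>2)\<^sup>2"
  shows "y\<^sup>2 > 3/4"
proof -
  have "1/4 + y\<^sup>2 > 0" by (simp add: add_pos_nonneg)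
  hence "(y\<^sup>2 - 3/4) ^ 3 > 0" using assms by (smt (verit) mult_pos_pos zero_less_power)
  thus ?thesis by (simp add: zero_less_power_eq)
qed

lemma height_equation_unique:
  fixes y Y n :: real
  assumes n: "n > 0" and pos: "y > 0" "Y > 0"
    and y: "256 * (y\<^sup>2 - 3/4) ^ 3 = n * (1/4 + y\<^sup>2)\<^sup>2"
    and Y: "256 * (Y\<^sup>2 - 3/4) ^ 3 = n * (1/4 + Y\<^sup>2)\<^sup>2"
  shows "y = Y"
proof -
  have g: "y\<^sup>2 > 3/4" "Y\<^sup>2 > 3/4" using height_equation_gt[OF n] y Y by auto
  have "256 * ((y\<^sup>2 - 3/4) ^ 3 * (1/4 + Y\<^sup>2)\<^sup>2) = n * (1/4 + y\<^sup>2)\<^sup>2 * (1/4 + Y\<^sup>2)\<^sup>2"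
    unfolding y[symmetric] by simp
  also have "\<dots> = 256 * ((Y\<^sup>2 - 3/4) ^ 3 * (1/4 + y\<^sup>2)\<^sup>2)"
    using arg_cong[OF Y, of "\<lambda>z. z * (1/4 + y\<^sup>2)\<^sup>2"] by (simp only: mult_ac)
  finally have "(y\<^sup>2 - 3/4) ^ 3 * (1/4 + Y\<^sup>2)\<^sup>2 = (Y\<^sup>2 - 3/4) ^ 3 * (1/4 + y\<^sup>2)\<^sup>2" by simp
  hence "y\<^sup>2 = Y\<^sup>2"
    using height_equation_strict_mono[OF g(1), of "Y\<^sup>2"] height_equation_strict_mono[OF g(2), of "y\<^sup>2"] by linarith
  thus ?thesis using pos by (simp add: power2_eq_iff)
qed

lemma lambda_tilde_eqI:
  fixes d :: nat and n Y :: real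
  assumes d: "d \<ge> 3" and j: "j_inv (cm_point d) = of_real (- n)" and n: "n > 0"
    and Y: "Y > 0" "256 * (Y\<^sup>2 - 3/4) ^ 3 = n * (1/4 + Y\<^sup>2)\<^sup>2"
  shows "lambda_tilde (real d) = 1/2 + \<i> * of_real Y"
proof -
  obtain y where y: "y > 0" "lambda_tilde (real d) = 1/2 + \<i> * of_real y"
    "j_inv (cm_point d) = of_real (256 * (3/4 - y\<^sup>2) ^ 3 / (1/4 + y\<^sup>2)\<^sup>2)"
    using lambda_tilde_height[OF d] .
  have "- n = 256 * (3/4 - y\<^sup>2) ^ 3 / (1/4 + y\<^sup>2)\<^sup>2"
    using y(3) unfolding j by (simp only: of_real_eq_iff)
  moreover have "1/4 + y\<^sup>2 > 0" by (simp add: add_pos_nonneg)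
  ultimately have "- n * (1/4 + y\<^sup>2)\<^sup>2 = 256 * (3/4 - y\<^sup>2) ^ 3" by simp
  moreover have "(3/4 - y\<^sup>2) ^ 3 = - ((y\<^sup>2 - 3/4) ^ 3)" by (simp add: power3_eq_cube algebra_simps)
  ultimately have "256 * (y\<^sup>2 - 3/4) ^ 3 = n * (1/4 + y\<^sup>2)\<^sup>2" by simp
  hence "y = Y" using height_equation_unique[OF n y(1) Y(1) _ Y(2)] by blast
  thus ?thesis using y(2) by simp
qed

text \<open>Cardano: \<open>s = r\<^sub>1 + r\<^sub>2\<close> with \<open>r\<^sub>1 r\<^sub>2 = k\<close> satisfies \<open>s\<^sup>3 = 3 k s + 2 A \<surd>d\<close>; dividing by \<open>\<surd>d\<close>
  leaves a rational cubic for \<open>v = s / \<surd>d\<close>.\<close>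

lemma lambda_tilde_cardano:
  fixes d :: nat and A k n a b :: real
  assumes d: "d \<ge> 3" and j: "j_inv (cm_point d) = of_real (- n)" and n: "n > 0"
    and k: "A\<^sup>2 * real d - 27 = k ^ 3" "k \<ge> 0" "A > 0" "a > 0" "b \<ge> 0"
    and cubic: "\<And>v. real d * v ^ 3 = 3 * k * v + 2 * A \<Longrightarrow>
      256 * (real d * (a + b * v)\<^sup>2 - 3/4) ^ 3 = n * (1/4 + real d * (a + b * v)\<^sup>2)\<^sup>2"
  shows "lambda_tilde (real d) = 1/2 + of_real a * sqrt_neg (real d) +
     of_real b * \<i> * of_real (root 3 (A * sqrt (real d) + 3 * sqrt 3) + root 3 (A * sqrt (real d) - 3 * sqrt 3))"
proof -
  define D where "D = sqrt (real d)"
  have D: "D > 0" "D\<^sup>2 = real d" using d by (simp_all add: D_def)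
  define r1 r2 where "r1 = root 3 (A * D + 3 * sqrt 3)" and "r2 = root 3 (A * D - 3 * sqrt 3)"
  have cubes: "r1 ^ 3 = A * D + 3 * sqrt 3" "r2 ^ 3 = A * D - 3 * sqrt 3"
    by (simp_all add: r1_def r2_def odd_real_root_pow)
  have "(A * D + 3 * sqrt 3) * (A * D - 3 * sqrt 3) = A\<^sup>2 * D\<^sup>2 - 9 * (sqrt 3)\<^sup>2"
    by (simp add: algebra_simps power2_eq_square)
  also have "\<dots> = k ^ 3" unfolding D(2) k(1)[symmetric] by simp
  finally have prod: "(A * D + 3 * sqrt 3) * (A * D - 3 * sqrt 3) = k ^ 3" .
  have rk: "r1 * r2 = k"
    unfolding r1_def r2_def real_root_mult[symmetric] prod by (simp add: odd_real_root_power_cancel)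
  have p1: "A * D + 3 * sqrt 3 > 0" using k(3) D by (simp add: add_pos_pos)
  have "A * D - 3 * sqrt 3 \<ge> 0"
    using prod p1 k(2) by (metis zero_le_mult_iff zero_le_power not_less order_less_imp_le)
  hence pos: "r1 \<ge> 0" "r2 \<ge> 0" using p1 by (simp_all add: r1_def r2_def)
  define s where "s = r1 + r2"
  have "s ^ 3 = r1 ^ 3 + r2 ^ 3 + 3 * (r1 * r2) * s"
    by (simp add: s_def power3_eq_cube algebra_simps)
  hence s3: "s ^ 3 = 3 * k * s + 2 * A * D" by (simp add: cubes rk)
  define v where "v = s / D"
  have sv: "s = D * v" using D by (simp add: v_def)
  have "D * (D\<^sup>2 * v ^ 3) = D * (3 * k * v + 2 * A)"
    using s3 unfolding sv by (simp add: power_mult_distrib power3_eq_cube power2_eq_square algebra_simps)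
  hence "real d * v ^ 3 = 3 * k * v + 2 * A" using D by simp
  note c = cubic[OF this]
  define Y where "Y = a * D + b * s"
  have "Y\<^sup>2 = D\<^sup>2 * (a + b * v)\<^sup>2" by (simp add: Y_def sv power2_eq_square algebra_simps)
  hence Y2: "Y\<^sup>2 = real d * (a + b * v)\<^sup>2" by (simp only: D(2))
  have "Y > 0" using D k pos by (simp add: Y_def s_def add_pos_nonneg)
  have "lambda_tilde (real d) = 1/2 + \<i> * of_real Y"
    by (rule lambda_tilde_eqI[OF d j n \<open>Y > 0\<close>]) (use c in \<open>simp only: Y2\<close>)
  thus ?thesis
    unfolding Y_def s_def r1_def r2_def sqrt_neg_def D_def by (simp add: algebra_simps)
qed

text \<open>Here j = 0 gives y^2 = 3/4 at once; the uniqueness argument is for negative j.\<close>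

lemma lambda_tilde_3: "lambda_tilde 3 = 1/2 + 1/2 * sqrt_neg 3"
proof -
  obtain y where y: "y > 0" "lambda_tilde (real 3) = 1/2 + \<i> * of_real y"
    "j_inv (cm_point 3) = of_real (256 * (3/4 - y\<^sup>2) ^ 3 / (1/4 + y\<^sup>2)\<^sup>2)"
    using lambda_tilde_height[of 3] by auto
  have "j_inv (cm_point 3) = 0" using mod_lambda_cm_point_3 by (simp add: j_inv_def)
  hence "256 * (3/4 - y\<^sup>2) ^ 3 / (1/4 + y\<^sup>2)\<^sup>2 = 0" using y(3) by (metis of_real_eq_0_iff)
  moreover have "1/4 + y\<^sup>2 > 0" by (simp add: add_pos_nonneg)
  ultimately have "y\<^sup>2 = 3/4" by simp
  hence "y = sqrt (3/4)" using y(1) by (simp add: real_sqrt_unique)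
  hence "y = sqrt 3 / 2" by (simp add: real_sqrt_divide)
  with y(2) have "lambda_tilde (real 3) = 1/2 + \<i> * of_real (sqrt 3 / 2)" by (simp only:)
  thus ?thesis by (simp add: sqrt_neg_def)
qed

lemma lambda_tilde_7: "lambda_tilde 7 = 1/2 + 3/2 * sqrt_neg 7"
proof -
  have "(3/2 * sqrt 7)\<^sup>2 = 63/4" by (simp add: power_mult_distrib power_divide)
  hence "lambda_tilde (real 7) = 1/2 + \<i> * of_real (3/2 * sqrt 7)"
    by (intro lambda_tilde_eqI[where n = 3375]) (simp_all add: j_inv_value_7 power_divide)
  thus ?thesis by (simp add: sqrt_neg_def)
qed

text \<open>The candidate is verified in the cubic field of c, the real cube root of 2;
  \<open>mult\<close> is multiplication in the basis 1, c, c^2.\<close>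

lemma lambda_tilde_27:
  "lambda_tilde 27 = 1/2 + 1/6 * sqrt_neg 3 * complex_of_real (253 + 200 * root 3 2 + 160 * root 3 4)"
proof -
  define c where "c = root 3 2"
  have c3: "c ^ 3 = 2" by (simp add: c_def odd_real_root_pow)
  have c0: "c > 0" by (simp add: c_def)
  have "root 3 4 = root 3 (2 * 2)" by simp
  hence c2: "root 3 4 = c\<^sup>2" by (simp only: real_root_mult c_def power2_eq_square)
  have mult: "(a0 + a1 * c + a2 * c\<^sup>2) * (b0 + b1 * c + b2 * c\<^sup>2) =
      (a0 * b0 + 2 * (a1 * b2 + a2 * b1)) + (a0 * b1 + a1 * b0 + 2 * a2 * b2) * c + (a0 * b2 + a1 * b1 + a2 * b0) * c\<^sup>2"
    for a0 a1 a2 b0 b1 b2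
  proof -
    have "(a0 + a1 * c + a2 * c\<^sup>2) * (b0 + b1 * c + b2 * c\<^sup>2) =
      (a0 * b0 + (a1 * b2 + a2 * b1) * c ^ 3) + (a0 * b1 + a1 * b0 + a2 * b2 * c ^ 3) * c + (a0 * b2 + a1 * b1 + a2 * b0) * c\<^sup>2"
      by (simp add: power2_eq_square power3_eq_cube algebra_simps)
    thus ?thesis by (simp add: c3 mult_ac)
  qed
  define Y where "Y = sqrt 3 / 6 * (253 + 200 * c + 160 * c\<^sup>2)"
  have Y2: "Y\<^sup>2 = 64003 / 4 + 12700 * c + 10080 * c\<^sup>2"
  proof -
    have "Y\<^sup>2 = 1/12 * ((253 + 200 * c + 160 * c\<^sup>2) * (253 + 200 * c + 160 * c\<^sup>2))"
      by (simp add: Y_def power_mult_distrib power_divide power2_eq_square[of "253 + 200 * c + 160 * c\<^sup>2"])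
    thus ?thesis unfolding mult by simp
  qed
  have "Y > 0" using c0 by (simp add: Y_def add_pos_pos)
  define T where "T = Y\<^sup>2 - 3/4"
  have T: "T = 16000 + 12700 * c + 10080 * c\<^sup>2" unfolding T_def Y2 by simp
  have "T * T = 768064000 + 609612800 * c + 483850000 * c\<^sup>2" unfolding T mult by simp
  hence "T * T * T = 36868608048000 + 29262633600000 * c + 23225767680000 * c\<^sup>2" unfolding T by (simp only: mult) simp
  moreover have "1/4 + Y\<^sup>2 = 16001 + 12700 * c + 10080 * c\<^sup>2" unfolding Y2 by simp
  hence "(1/4 + Y\<^sup>2) * (1/4 + Y\<^sup>2) = 768096001 + 609638200 * c + 483870160 * c\<^sup>2" by (simp only: mult) simp
  ultimately have "256 * T ^ 3 = 12288000 * (1/4 + Y\<^sup>2)\<^sup>2"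
    unfolding power3_eq_cube power2_eq_square[of "1/4 + Y\<^sup>2"] by (simp add: ring_distribs)
  hence "lambda_tilde (real 27) = 1/2 + \<i> * of_real Y"
    using \<open>Y > 0\<close> unfolding T_def by (intro lambda_tilde_eqI[where n = 12288000]) (simp_all add: j_inv_value_27)
  thus ?thesis by (simp add: Y_def c_def[symmetric] c2 sqrt_neg_def)
qed

text \<open>In this and the following cases n = (4 k)^3, and A^2 d = k^3 + 27 says that j - 1728 =
  -d (8 A)^2. The coefficients are a = A/6 and b = k/6. The height equation has degree 6 in v and is
  divisible by the cubic for v; the last factor is the quotient.\<close>

lemma lambda_tilde_11:
  "lambda_tilde 11 = 1/2 + 7 / 6 * sqrt_neg 11 + 4 / 3 * \<i> * complex_of_real
     (root 3 (7 * sqrt 11 + 3 * sqrt 3) + root 3 (7 * sqrt 11 - 3 * sqrt 3))"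
proof -
  have "256 * (real 11 * (7 / 6 + 4 / 3 * v)\<^sup>2 - 3/4) ^ 3 = 32768 * (1/4 + real 11 * (7 / 6 + 4 / 3 * v)\<^sup>2)\<^sup>2"
    if "real 11 * v ^ 3 = 3 * 8 * v + 2 * 7" for v
  proof -
    have "256 * (real 11 * (7 / 6 + 4 / 3 * v)\<^sup>2 - 3/4) ^ 3 - 32768 * (1/4 + real 11 * (7 / 6 + 4 / 3 * v)\<^sup>2)\<^sup>2 =
       (real 11 * v ^ 3 - (3 * 8 * v + 2 * 7)) * (357023744 / 729 + (98762752 / 81) * v + (222035968 / 243) * v\<^sup>2 + (126877696 / 729) * v ^ 3)"
      by (simp add: power2_eq_square power3_eq_cube field_simps)
    thus ?thesis using that by simp
  qed
  from lambda_tilde_cardano[where A = 7 and k = 8, OF _ _ _ _ _ _ _ _ this]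
  show ?thesis by (simp add: j_inv_value_11)
qed

lemma lambda_tilde_19:
  "lambda_tilde 19 = 1/2 + 9 / 2 * sqrt_neg 19 + 4 * \<i> * complex_of_real
     (root 3 (27 * sqrt 19 + 3 * sqrt 3) + root 3 (27 * sqrt 19 - 3 * sqrt 3))"
proof -
  have "256 * (real 19 * (9 / 2 + 4 * v)\<^sup>2 - 3/4) ^ 3 = 884736 * (1/4 + real 19 * (9 / 2 + 4 * v)\<^sup>2)\<^sup>2"
    if "real 19 * v ^ 3 = 3 * 24 * v + 2 * 27" for v
  proof -
    have "256 * (real 19 * (9 / 2 + 4 * v)\<^sup>2 - 3/4) ^ 3 - 884736 * (1/4 + real 19 * (9 / 2 + 4 * v)\<^sup>2)\<^sup>2 =
       (real 19 * v ^ 3 - (3 * 24 * v + 2 * 27)) * (2160082944 + (4314562560) * v + (2555117568) * v\<^sup>2 + (378535936) * v ^ 3)"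
      by (simp add: power2_eq_square power3_eq_cube algebra_simps)
    thus ?thesis using that by simp
  qed
  from lambda_tilde_cardano[where A = 27 and k = 24, OF _ _ _ _ _ _ _ _ this]
  show ?thesis by (simp add: j_inv_value_19)
qed

lemma lambda_tilde_43:
  "lambda_tilde 43 = 1/2 + 189 / 2 * sqrt_neg 43 + 40 * \<i> * complex_of_real
     (root 3 (567 * sqrt 43 + 3 * sqrt 3) + root 3 (567 * sqrt 43 - 3 * sqrt 3))"
proof -
  have "256 * (real 43 * (189 / 2 + 40 * v)\<^sup>2 - 3/4) ^ 3 = 884736000 * (1/4 + real 43 * (189 / 2 + 40 * v)\<^sup>2)\<^sup>2"
    if "real 43 * v ^ 3 = 3 * 240 * v + 2 * 567" for v
  proof -
    have "256 * (real 43 * (189 / 2 + 40 * v)\<^sup>2 - 3/4) ^ 3 - 884736000 * (1/4 + real 43 * (189 / 2 + 40 * v)\<^sup>2)\<^sup>2 =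
       (real 43 * v ^ 3 - (3 * 240 * v + 2 * 567)) * (102261725282304000 + (97391992504320000) * v + (27482731315200000) * v\<^sup>2 + (1938817024000000) * v ^ 3)"
      by (simp add: power2_eq_square power3_eq_cube algebra_simps)
    thus ?thesis using that by simp
  qed
  from lambda_tilde_cardano[where A = 567 and k = 240, OF _ _ _ _ _ _ _ _ this]
  show ?thesis by (simp add: j_inv_value_43)
qed

lemma lambda_tilde_67:
  "lambda_tilde 67 = 1/2 + 1953 / 2 * sqrt_neg 67 + 220 * \<i> * complex_of_real
     (root 3 (5859 * sqrt 67 + 3 * sqrt 3) + root 3 (5859 * sqrt 67 - 3 * sqrt 3))"
proof -
  have "256 * (real 67 * (1953 / 2 + 220 * v)\<^sup>2 - 3/4) ^ 3 = 147197952000 * (1/4 + real 67 * (1953 / 2 + 220 * v)\<^sup>2)\<^sup>2"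
    if "real 67 * v ^ 3 = 3 * 1320 * v + 2 * 5859" for v
  proof -
    have "256 * (real 67 * (1953 / 2 + 220 * v)\<^sup>2 - 3/4) ^ 3 - 147197952000 * (1/4 + real 67 * (1953 / 2 + 220 * v)\<^sup>2)\<^sup>2 =
       (real 67 * v ^ 3 - (3 * 1320 * v + 2 * 5859)) * (45575805439885400064000 + (23102942668903342080000) * v + (3469976014521139200000) * v\<^sup>2 + (130294371598336000000) * v ^ 3)"
      by (simp add: power2_eq_square power3_eq_cube algebra_simps)
    thus ?thesis using that by simp
  qed
  from lambda_tilde_cardano[where A = 5859 and k = 1320, OF _ _ _ _ _ _ _ _ this]
  show ?thesis by (simp add: j_inv_value_67)
qed

lemma lambda_tilde_163:
  "lambda_tilde 163 = 1/2 + 1672209 / 2 * sqrt_neg 163 + 26680 * \<i> * complex_of_real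
     (root 3 (5016627 * sqrt 163 + 3 * sqrt 3) + root 3 (5016627 * sqrt 163 - 3 * sqrt 3))"
proof -
  have "256 * (real 163 * (1672209 / 2 + 26680 * v)\<^sup>2 - 3/4) ^ 3 = 262537412640768000 * (1/4 + real 163 * (1672209 / 2 + 26680 * v)\<^sup>2)\<^sup>2"
    if "real 163 * v ^ 3 = 3 * 160080 * v + 2 * 5016627" for v
  proof -
    have "256 * (real 163 * (1672209 / 2 + 26680 * v)\<^sup>2 - 3/4) ^ 3 - 262537412640768000 * (1/4 + real 163 * (1672209 / 2 + 26680 * v)\<^sup>2)\<^sup>2 =
       (real 163 * v ^ 3 - (3 * 160080 * v + 2 * 5016627)) * (302005132505261070425031949149192192000 + (21683136622624017101840376730091520000) * v + (461270957630780607807085373030400000) * v\<^sup>2 + (2453184011804989012795457536000000) * v ^ 3)"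
      by (simp add: power2_eq_square power3_eq_cube algebra_simps)
    thus ?thesis using that by simp
  qed
  from lambda_tilde_cardano[where A = 5016627 and k = 160080, OF _ _ _ _ _ _ _ _ this]
  show ?thesis by (simp add: j_inv_value_163)
qed

theorem theorem4p1:
  shows "lambda_tilde 3 = 1/2 + 1/2 * sqrt_neg 3 \<and>
         lambda_tilde 7 = 1/2 + 3/2 * sqrt_neg 7 \<and>
         lambda_tilde 11 = 1/2 + 7/6 * sqrt_neg 11
           + 4/3 * \<i> * complex_of_real
               (root 3 (7 * sqrt 11 + 3 * sqrt 3) + root 3 (7 * sqrt 11 - 3 * sqrt 3)) \<and>
         lambda_tilde 19 = 1/2 + 9/2 * sqrt_neg 19
           + 4 * \<i> * complex_of_real
               (root 3 (27 * sqrt 19 + 3 * sqrt 3) + root 3 (27 * sqrt 19 - 3 * sqrt 3)) \<and>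
         lambda_tilde 27 = 1/2 + 1/6 * sqrt_neg 3
           * complex_of_real (253 + 200 * root 3 2 + 160 * root 3 4) \<and>
         lambda_tilde 43 = 1/2 + 189/2 * sqrt_neg 43
           + 40 * \<i> * complex_of_real
               (root 3 (567 * sqrt 43 + 3 * sqrt 3) + root 3 (567 * sqrt 43 - 3 * sqrt 3)) \<and>
         lambda_tilde 67 = 1/2 + 1953/2 * sqrt_neg 67
           + 220 * \<i> * complex_of_real
               (root 3 (5859 * sqrt 67 + 3 * sqrt 3) + root 3 (5859 * sqrt 67 - 3 * sqrt 3)) \<and>
         lambda_tilde 163 = 1/2 + 1672209/2 * sqrt_neg 163
           + 26680 * \<i> * complex_of_real
               (root 3 (5016627 * sqrt 163 + 3 * sqrt 3) + root 3 (5016627 * sqrt 163 - 3 * sqrt 3))"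
  using lambda_tilde_3 lambda_tilde_7 lambda_tilde_11 lambda_tilde_19 lambda_tilde_27
    lambda_tilde_43 lambda_tilde_67 lambda_tilde_163 by blast

end
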